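(* Let $n\in\mathbf{N}$ and $g_1,\ldots,g_{2n}\in C[0,1]$. For $N\in\mathbf{N}$ and $j\in\{1,\ldots,2n\}$ let $D_N^{(j)}=\mathrm{diag}\big(g_j(\tfrac1N),g_j(\tfrac2N),\ldots,g_j(\tfrac NN)\big)$. For $t\in[0,1]$ let $h_N(t)$ be the least element of $\{1,\ldots,N\}$ such that $t\le h_N(t)/N$. Then for all $t\in[0,1]$, $$\lim_{N\to\infty}\mathbb{E}\big(D_N^{(1)}X_N^*D_N^{(2)}X_ND_N^{(3)}X_N^*D_N^{(4)}X_N\cdots D_N^{(2n-1)}X_N^*D_N^{(2n)}X_N\big)_{h_N(t),h_N(t)}=\sum_{\pi\in\mathcal{P}(n)}g_1(t)\,\Lambda_\pi(g_3,g_5,\ldots,g_{2n-1})(t)\,\tau\big(\Gamma_\pi(g_2,g_4,\ldots,g_{2n})\big)$$ and $$\lim_{N\to\infty}\mathbb{E}\big(D_N^{(1)}X_ND_N^{(2)}X_N^*D_N^{(3)}X_ND_N^{(4)}X_N^*\cdots D_N^{(2n-1)}X_ND_N^{(2n)}X_N^*\big)_{h_N(t),h_N(t)}=\sum_{\pi\in\mathcal{P}(n)}\Gamma_\pi(g_1,g_3,\ldots,g_{2n-1})(t)\,\tau\big(\Lambda_\pi(g_2,g_4,\ldots,g_{2n-2})\,g_{2n}\big).$$ Furthermore, in both cases the convergence is uniform for $t\in[0,1]$, and the rate of convergence can be controlled in terms of only $\max_i\|g_i\|$ and a common modulus of continuity for $\{g_1,\ldots,g_{2n}\}$.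
   Context: $X_N$ is the $N\times N$ random Vandermonde matrix whose $(i,j)$ entry is $N^{-1/2}\zeta_i^{\,j}$ ($1\le i,j\le N$), where $\zeta_1,\ldots,\zeta_N$ are independent and uniformly (Haar) distributed on the unit circle; $\mathbb{E}$ is expectation. $\tau$ is the tracial state on $C[0,1]$ given by integration against Lebesgue measure. $\mathcal{P}(n)$ is the set of all set partitions of $\{1,\ldots,n\}$; $S_\pi(j)$ is the block of $\pi$ containing $j$. For $f_1,\ldots,f_n\in C[0,1]$, $$\Gamma_\pi(f_1,\ldots,f_n)=\prod_{j\in S_\pi(1)}f_j\prod_{S\in\pi\setminus\{S_\pi(1)\}}\tau\Big(\prod_{j\in S}f_j\Big)\in C[0,1].$$ Let $J_\pi=\bigcup_{S\in\pi}(S\setminus\{\max S\})$ and $I_\pi(p)=\{j\in\{1,\ldots,p\}: S_\pi(j)\not\subseteq\{1,\ldots,p\}\}\subseteq J_\pi$. If $J_\pi=\emptyset$ (all blocks singletons), $\Lambda_\pi(f_1,\ldots,f_{n-1})=\prod_{j=1}^{n-1}f_j$ (equal to the constant $1$ if $n=1$). Otherwise, for $t\in[0,1]$, let $$E(\pi,t)=\Big\{(t_j)_{j\in J_\pi}\in\mathbf{R}^{J_\pi}: \forall p\in\{1,\ldots,n-1\},\ 0<t+\sum_{j\in I_\pi(p)}t_j\le1\Big\},$$ $$\Lambda_\pi(f_1,\ldots,f_{n-1})(t)=\int_{E(\pi,t)}\prod_{p=1}^{n-1}f_p\Big(t+\sum_{j\in I_\pi(p)}t_j\Big)\,d\lambda((t_j)_{j\in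 J_\pi}),$$ with $\lambda$ the $|J_\pi|$-dimensional Lebesgue measure.
   Formalization: At t=0 only, E(π,0) omits the conditions for p with I_π(p) empty (they read 0<0), giving Λ_π(0) its continuous value; taken literally the first formula fails at t=0, e.g. n=3 and all g_i=1: the limit is 5 but the sum is 3. *)

theory Defs
  imports "HOL-Probability.Probability" "Jordan_Normal_Form.Schur_Decomposition"
begin

text \<open>Elements of $C[0,1]$ are represented by functions of type \<^typ>\<open>real \<Rightarrow> complex\<close> that are
  continuous on \<^term>\<open>{0..1::real}\<close>; families \<open>f\<^sub>1, \<dots>, f\<^sub>n\<close> are indexed by \<^typ>\<open>nat\<close>, starting at 1.\<close>

subsection \<open>Random Vandermonde matrices\<close>

definition haar_circle :: "complex measure" where
  "haar_circle = distr (uniform_measure lborel {0..1}) borel (\<lambda>x. cis (2 * pi * x))"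

definition iid_haar :: "'a measure \<Rightarrow> nat \<Rightarrow> (nat \<Rightarrow> 'a \<Rightarrow> complex) \<Rightarrow> bool" where
  "iid_haar M N \<zeta> \<longleftrightarrow> prob_space M \<and> prob_space.indep_vars M (\<lambda>_. borel) \<zeta> {1..N} \<and>
     (\<forall>i\<in>{1..N}. distr M borel (\<zeta> i) = haar_circle)"

text \<open>Matrix positions are counted from 0 in the library and from 1 in the mathematics.\<close>

definition vandermonde :: "nat \<Rightarrow> (nat \<Rightarrow> complex) \<Rightarrow> complex mat" where
  "vandermonde N z =
     Matrix.mat N N (\<lambda>(i, j). z (Suc i) ^ Suc j / complex_of_real (sqrt (real N)))"

definition sample_diag :: "nat \<Rightarrow> (real \<Rightarrow> complex) \<Rightarrow> complex mat" where
  "sample_diag N f = mat_diag N (\<lambda>i. f (real (Suc i) / real N))"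

text \<open>The words \<open>D\<^sub>1 X* D\<^sub>2 X \<cdots> D\<^sub>2\<^sub>n\<^sub>-\<^sub>1 X* D\<^sub>2\<^sub>n X\<close> and \<open>D\<^sub>1 X D\<^sub>2 X* \<cdots> D\<^sub>2\<^sub>n\<^sub>-\<^sub>1 X D\<^sub>2\<^sub>n X*\<close>.\<close>

definition word_adj_first ::
    "nat \<Rightarrow> nat \<Rightarrow> (nat \<Rightarrow> real \<Rightarrow> complex) \<Rightarrow> complex mat \<Rightarrow> complex mat" where
  "word_adj_first N n g X =
     foldr (\<lambda>k B. sample_diag N (g (2 * k - 1)) * mat_adjoint X * sample_diag N (g (2 * k)) * X * B)
       [1..<n + 1] (1\<^sub>m N)"

definition word_adj_last ::
    "nat \<Rightarrow> nat \<Rightarrow> (nat \<Rightarrow> real \<Rightarrow> complex) \<Rightarrow> complex mat \<Rightarrow> complex mat" where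
  "word_adj_last N n g X =
     foldr (\<lambda>k B. sample_diag N (g (2 * k - 1)) * X * sample_diag N (g (2 * k)) * mat_adjoint X * B)
       [1..<n + 1] (1\<^sub>m N)"

definition sample_index :: "nat \<Rightarrow> real \<Rightarrow> nat" where
  "sample_index N t = (LEAST h. h \<in> {1..N} \<and> t \<le> real h / real N)"

definition expect_diag_adj_first ::
    "'a measure \<Rightarrow> (nat \<Rightarrow> 'a \<Rightarrow> complex) \<Rightarrow> nat \<Rightarrow> nat \<Rightarrow> (nat \<Rightarrow> real \<Rightarrow> complex) \<Rightarrow> real \<Rightarrow> complex" where
  "expect_diag_adj_first M \<zeta> N n g t =
     (LINT w|M. word_adj_first N n g (vandermonde N (\<lambda>i. \<zeta> i w))
        $$ (sample_index N t - 1, sample_index N t - 1))"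

definition expect_diag_adj_last ::
    "'a measure \<Rightarrow> (nat \<Rightarrow> 'a \<Rightarrow> complex) \<Rightarrow> nat \<Rightarrow> nat \<Rightarrow> (nat \<Rightarrow> real \<Rightarrow> complex) \<Rightarrow> real \<Rightarrow> complex" where
  "expect_diag_adj_last M \<zeta> N n g t =
     (LINT w|M. word_adj_last N n g (vandermonde N (\<lambda>i. \<zeta> i w))
        $$ (sample_index N t - 1, sample_index N t - 1))"

subsection \<open>The functionals attached to a set partition\<close>

definition set_partitions :: "nat \<Rightarrow> nat set set set" where
  "set_partitions n = {\<pi>. partition_on {1..n} \<pi>}"

definition block_of :: "nat set set \<Rightarrow> nat \<Rightarrow> nat set" where
  "block_of \<pi> j = (THE S. S \<in> \<pi> \<and> j \<in> S)"

definition tau :: "(real \<Rightarrow> complex) \<Rightarrow> complex" where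
  "tau f = (LINT s:{0..1}|lborel. f s)"

definition Gamma_part :: "nat set set \<Rightarrow> (nat \<Rightarrow> real \<Rightarrow> complex) \<Rightarrow> real \<Rightarrow> complex" where
  "Gamma_part \<pi> f t =
     (\<Prod>j\<in>block_of \<pi> 1. f j t) * (\<Prod>S\<in>\<pi> - {block_of \<pi> 1}. tau (\<lambda>s. \<Prod>j\<in>S. f j s))"

definition J_part :: "nat set set \<Rightarrow> nat set" where
  "J_part \<pi> = (\<Union>S\<in>\<pi>. S - {Max S})"

definition I_part :: "nat set set \<Rightarrow> nat \<Rightarrow> nat set" where
  "I_part \<pi> p = {j \<in> {1..p}. \<not> block_of \<pi> j \<subseteq> {1..p}}"

text \<open>The set \<open>E(\<pi>, t)\<close>, with \<open>\<real>\<^sup>J\<close> rendered as the extensional functions on \<open>J\<close>.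
  For \<open>t \<noteq> 0\<close> the guard below is true and the set is \<open>{x. \<forall>p<n. 0 < t + (\<Sum>j\<in>I(p). x\<^sub>j) \<le> 1}\<close>.
  At \<open>t = 0\<close> the condition for a \<open>p\<close> with \<open>I(p) = {}\<close> would read \<open>0 < 0\<close> and make the set empty,
  so that \<open>\<Lambda>\<close> would be discontinuous at 0 and the first limit formula would fail there: for
  \<open>n = 3\<close>, \<open>t = 0\<close> and all functions equal to 1, each expectation tends to 5, whereas the
  partitions \<open>{{1},{2,3}}\<close> and \<open>{{1,2},{3}}\<close> would contribute 0 and leave the sum 3.  The guard
  drops only these conditions, which restrict \<open>t\<close> and not \<open>x\<close>; this gives the value at 0 for
  which \<open>\<Lambda>\<close> belongs to $C[0,1]$.\<close>

definition E_part :: "nat \<Rightarrow> nat set set \<Rightarrow> real \<Rightarrow> (nat \<Rightarrow> real) set" where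
  "E_part n \<pi> t = {x \<in> J_part \<pi> \<rightarrow>\<^sub>E UNIV. \<forall>p\<in>{1..n - 1}. t \<noteq> 0 \<or> I_part \<pi> p \<noteq> {} \<longrightarrow>
     0 < t + (\<Sum>j\<in>I_part \<pi> p. x j) \<and> t + (\<Sum>j\<in>I_part \<pi> p. x j) \<le> 1}"

definition Lambda_part ::
    "nat \<Rightarrow> nat set set \<Rightarrow> (nat \<Rightarrow> real \<Rightarrow> complex) \<Rightarrow> real \<Rightarrow> complex" where
  "Lambda_part n \<pi> f t =
     (if J_part \<pi> = {} then \<Prod>j=1..n - 1. f j t
      else LINT x:E_part n \<pi> t|Pi\<^sub>M (J_part \<pi>) (\<lambda>_. lborel).
             \<Prod>p=1..n - 1. f p (t + (\<Sum>j\<in>I_part \<pi> p. x j)))"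

lemma E_part_nonzero:
  assumes "t \<noteq> 0"
  shows "E_part n \<pi> t = {x \<in> J_part \<pi> \<rightarrow>\<^sub>E UNIV. \<forall>p\<in>{1..n - 1}.
     0 < t + (\<Sum>j\<in>I_part \<pi> p. x j) \<and> t + (\<Sum>j\<in>I_part \<pi> p. x j) \<le> 1}"
  using assms by (simp add: E_part_def)

subsection \<open>The limits\<close>

definition limit_adj_first :: "nat \<Rightarrow> (nat \<Rightarrow> real \<Rightarrow> complex) \<Rightarrow> real \<Rightarrow> complex" where
  "limit_adj_first n g t = (\<Sum>\<pi>\<in>set_partitions n.
     g 1 t * Lambda_part n \<pi> (\<lambda>j. g (2 * j + 1)) t * tau (Gamma_part \<pi> (\<lambda>j. g (2 * j))))"

definition limit_adj_last :: "nat \<Rightarrow> (nat \<Rightarrow> real \<Rightarrow> complex) \<Rightarrow> real \<Rightarrow> complex" where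
  "limit_adj_last n g t = (\<Sum>\<pi>\<in>set_partitions n.
     Gamma_part \<pi> (\<lambda>j. g (2 * j - 1)) t *
     tau (\<lambda>s. Lambda_part n \<pi> (\<lambda>j. g (2 * j)) s * g (2 * n) s))"

end

theory Submission
  imports Defs
begin

text \<open>
  Expanding both words along closed paths of matrix positions, an expected diagonal entry becomes
  \<open>N\<^sup>-\<^sup>n\<close> times a sum over row indices \<open>i\<^sub>1, \<dots>, i\<^sub>n\<close> and exponents \<open>j\<^sub>1, \<dots>, j\<^sub>n\<close> in \<open>{1..N}\<close>
  of products of sampled values of the functions with the expectation of the product of
  \<open>\<zeta>(i\<^sub>k)\<close> to the power \<open>j\<^sub>k - j\<^sub>k\<^sub>-\<^sub>1\<close>, where the index \<open>k\<close> runs cyclically.  The variables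
  are independent and Haar distributed, so this expectation is 1 if the increments of \<open>j\<close> sum to
  zero over every block of the kernel \<open>\<pi>\<close> of \<open>i\<close>, and 0 otherwise (\<open>haar_product_moment\<close>).  It
  depends on \<open>i\<close> only through \<open>\<pi>\<close>; hence for each \<open>\<pi>\<close> the sum is a product of a sum over \<open>i\<close> with
  kernel \<open>\<pi>\<close> and a sum over balanced \<open>j\<close>.  This is an exact formula for every \<open>N\<close>
  (\<open>expect_diag_adj_first_eq\<close> and \<open>expect_diag_adj_last_eq\<close>), and it remains to take the limit of
  the two normalised factors \<open>Gamma_disc\<close> and \<open>Lambda_disc\<close>.

  An \<open>i\<close> with kernel \<open>\<pi>\<close> is an injective labelling of the blocks of \<open>\<pi>\<close>.  Dropping injectivity
  costs \<open>O(1/N)\<close> and leaves a product of one averaged sum per block; the averages tend to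
  integrals and the product to \<open>\<Gamma>\<^sub>\<pi>\<close> (\<open>sampled_limit_Gamma\<close>).  A balanced \<open>j\<close> ending at \<open>h\<close> is a
  closed walk starting at \<open>h\<close>.  The balance condition fixes the increment at the maximum of each
  block in terms of the increments at \<open>J\<^sub>\<pi>\<close>, which are free, so balanced \<open>j\<close> are the lattice points
  of the dilated polytope \<open>E(\<pi>, t)\<close> (\<open>bij_betw_walk\<close>).  The normalised sum is the integral of a
  step function in which every coordinate is rounded up to the grid.  Step function and limit
  integrand are close except where some partial sum lies within \<open>n/N\<close> of 0 or 1, that is in
  finitely many slabs of measure \<open>O(1/N)\<close>; this gives \<open>\<Lambda>\<^sub>\<pi>\<close> (\<open>sampled_limit_Lambda\<close>).

  Every estimate uses only a common bound and a common modulus of continuity of the functions.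
  The limits are therefore formulated as uniform limits over all pairs of an equibounded,
  equicontinuous family and a point of \<open>[0,1]\<close> (\<open>sampled_limit\<close>).  For the family of all tuples
  with a prescribed bound and modulus the supremum of the error is the required rate; for a single
  tuple of continuous functions one obtains the uniform and the pointwise limits.
\<close>

section \<open>Products of matrices as sums over paths\<close>

lemma sum_PiE_insert:
  assumes "a \<notin> S"
  shows "(\<Sum>w\<in>PiE (insert a S) B. F w) = (\<Sum>v\<in>B a. \<Sum>w\<in>PiE S B. F (w(a := v)))"
proof -
  have "(\<Sum>w\<in>PiE (insert a S) B. F w) = (\<Sum>(v, w)\<in>B a \<times> PiE S B. F (w(a := v)))"
    unfolding PiE_insert_eq
    by (subst sum.reindex) (use inj_combinator[OF assms, of B] in \<open>auto simp: case_prod_unfold\<close>)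
  then show ?thesis
    by (simp add: sum.cartesian_product)
qed

abbreviation tuples :: "nat \<Rightarrow> nat \<Rightarrow> (nat \<Rightarrow> nat) set" where
  "tuples n N \<equiv> {1..n} \<rightarrow>\<^sub>E {1..N}"

text \<open>Positions counted from 1, as in the sampled functions and in the exponents of the
  Vandermonde matrix.\<close>

definition entry :: "complex mat \<Rightarrow> nat \<Rightarrow> nat \<Rightarrow> complex" where
  "entry A u v = A $$ (u - 1, v - 1)"

lemma entry_mult:
  assumes "A \<in> carrier_mat N N" "B \<in> carrier_mat N N" "u \<in> {1..N}" "v \<in> {1..N}"
  shows "entry (A * B) u v = (\<Sum>w\<in>{1..N}. entry A u w * entry B w v)"
proof -
  have "u - 1 < N" "v - 1 < N"
    using assms(3,4) by auto
  then have "entry (A * B) u v = (\<Sum>w\<in>{0..<N}. A $$ (u - 1, w) * B $$ (w, v - 1))"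
    using assms(1,2) by (simp add: entry_def scalar_prod_def)
  also have "\<dots> = (\<Sum>w\<in>{1..N}. entry A u w * entry B w v)"
    unfolding entry_def
    by (rule sum.reindex_bij_witness[of _ "\<lambda>w. w - 1" Suc]) auto
  finally show ?thesis .
qed

lemma foldr_mult_carrier:
  fixes A :: "nat \<Rightarrow> complex mat"
  assumes "\<And>k. A k \<in> carrier_mat N N"
  shows "foldr (\<lambda>k B. A k * B) ks (1\<^sub>m N) \<in> carrier_mat N N"
  using assms by (induction ks) (auto intro: mult_carrier_mat)

lemma foldr_mult_snoc:
  fixes A :: "nat \<Rightarrow> complex mat"
  assumes "\<And>k. A k \<in> carrier_mat N N"
  shows "foldr (\<lambda>k B. A k * B) (ks @ [m]) (1\<^sub>m N) = foldr (\<lambda>k B. A k * B) ks (1\<^sub>m N) * A m"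
proof (induction ks)
  case Nil
  then show ?case
    using left_mult_one_mat[OF assms[of m]] right_mult_one_mat[OF assms[of m]] by simp
next
  case (Cons k ks)
  then show ?case
    using assoc_mult_mat[OF assms[of k] foldr_mult_carrier[where A = A and ks = ks, OF assms] assms[of m]]
    by simp
qed

text \<open>The shift \<open>m\<close> lets a path be indexed either by its endpoints before each
  factor or after each factor; closed paths are used with the shift 0 in one word and 1 in the
  other.\<close>

lemma entry_foldr_mult:
  assumes "\<And>k. A k \<in> carrier_mat N N" "x \<in> {1..N}" "y \<in> {1..N}"
  shows "entry (foldr (\<lambda>k B. A k * B) [1..<n + 1] (1\<^sub>m N)) x y =
    (\<Sum>w\<in>{m..m + n} \<rightarrow>\<^sub>E {1..N}. of_bool (w m = x \<and> w (m + n) = y) *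
       (\<Prod>k=1..n. entry (A k) (w (m + k - 1)) (w (m + k))))"
  using assms(3)
proof (induction n arbitrary: y)
  case 0
  have "(\<Sum>w\<in>{m..m} \<rightarrow>\<^sub>E {1..N}. of_bool (w m = x \<and> w m = y) :: complex) =
      (\<Sum>v\<in>{1..N}. of_bool (v = x \<and> v = y))"
    by (simp, subst sum_PiE_insert) auto
  also have "\<dots> = (\<Sum>v\<in>{1..N}. if v = x then of_bool (x = y) else 0)"
    by (rule sum.cong) auto
  also have "\<dots> = of_bool (x = y)"
    using assms(2) by simp
  finally show ?case
    using assms(2) 0 by (auto simp: entry_def)
next
  case (Suc n)
  define P where "P = foldr (\<lambda>k B. A k * B) [1..<n + 1] (1\<^sub>m N)"
  define W where "W = {m..m + n} \<rightarrow>\<^sub>E {1..N}"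
  define Q where "Q w = (\<Prod>k=1..n. entry (A k) (w (m + k - 1)) (w (m + k)))" for w
  have finW: "finite W"
    by (simp add: W_def finite_PiE)
  have WN: "w (m + n) \<in> {1..N}" if "w \<in> W" for w
    using PiE_mem[OF that[unfolded W_def], of "m + n"] by simp
  have P: "P \<in> carrier_mat N N"
    unfolding P_def by (rule foldr_mult_carrier) (rule assms)
  have "entry (foldr (\<lambda>k B. A k * B) [1..<Suc n + 1] (1\<^sub>m N)) x y = entry (P * A (Suc n)) x y"
    using foldr_mult_snoc[where A = A and ks = "[1..<n + 1]" and m = "Suc n", OF assms(1)]
    by (simp add: P_def)
  also have "\<dots> = (\<Sum>v\<in>{1..N}. entry P x v * entry (A (Suc n)) v y)"
    by (rule entry_mult) (use P assms Suc in auto)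
  also have "\<dots> = (\<Sum>v\<in>{1..N}. \<Sum>w\<in>W. of_bool (w m = x \<and> w (m + n) = v) * Q w * entry (A (Suc n)) v y)"
    using Suc.IH by (intro sum.cong refl) (simp add: P_def W_def Q_def sum_distrib_right)
  also have "\<dots> = (\<Sum>w\<in>W. \<Sum>v\<in>{1..N}. if v = w (m + n) then of_bool (w m = x) * Q w * entry (A (Suc n)) v y else 0)"
    by (subst sum.swap) (intro sum.cong refl, auto)
  also have "\<dots> = (\<Sum>w\<in>W. of_bool (w m = x) * Q w * entry (A (Suc n)) (w (m + n)) y)"
    using WN by (intro sum.cong refl) simp
  also have "\<dots> = (\<Sum>v\<in>{1..N}. if v = y then \<Sum>w\<in>W. of_bool (w m = x) * Q w * entry (A (Suc n)) (w (m + n)) v else 0)"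
    using Suc.prems by simp
  also have "\<dots> = (\<Sum>v\<in>{1..N}. \<Sum>w\<in>W. of_bool ((w(m + Suc n := v)) m = x \<and> (w(m + Suc n := v)) (m + Suc n) = y) *
       (\<Prod>k=1..Suc n. entry (A k) ((w(m + Suc n := v)) (m + k - 1)) ((w(m + Suc n := v)) (m + k))))"
  proof (intro sum.cong refl)
    fix v
    have *: "(\<Prod>k=1..n. entry (A k) ((w(m + Suc n := v)) (m + k - 1)) ((w(m + Suc n := v)) (m + k))) = Q w" for w
      unfolding Q_def by (intro prod.cong refl) auto
    show "(if v = y then \<Sum>w\<in>W. of_bool (w m = x) * Q w * entry (A (Suc n)) (w (m + n)) v else 0) =
      (\<Sum>w\<in>W. of_bool ((w(m + Suc n := v)) m = x \<and> (w(m + Suc n := v)) (m + Suc n) = y) *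
       (\<Prod>k=1..Suc n. entry (A k) ((w(m + Suc n := v)) (m + k - 1)) ((w(m + Suc n := v)) (m + k))))"
      using * by (auto intro!: sum.cong simp: prod.nat_ivl_Suc')
  qed
  also have "\<dots> = (\<Sum>w\<in>{m..m + Suc n} \<rightarrow>\<^sub>E {1..N}. of_bool (w m = x \<and> w (m + Suc n) = y) *
       (\<Prod>k=1..Suc n. entry (A k) (w (m + k - 1)) (w (m + k))))"
  proof -
    have "{m..m + Suc n} = insert (m + Suc n) {m..m + n}"
      by auto
    then show ?thesis
      by (simp only: W_def) (subst sum_PiE_insert, auto)
  qed
  finally show ?case .
qed

definition cyc_pred :: "nat \<Rightarrow> nat \<Rightarrow> nat" where
  "cyc_pred n k = (if k = 1 then n else k - 1)"

definition cyc_succ :: "nat \<Rightarrow> nat \<Rightarrow> nat" where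
  "cyc_succ n k = (if k = n then 1 else k + 1)"

text \<open>On a closed path the initial vertex repeats the last one and can be dropped.\<close>

lemma entry_foldr_mult_closed_last:
  assumes "\<And>k. A k \<in> carrier_mat N N" "h \<in> {1..N}" "n \<ge> 1"
  shows "entry (foldr (\<lambda>k B. A k * B) [1..<n + 1] (1\<^sub>m N)) h h =
    (\<Sum>j\<in>tuples n N. of_bool (j n = h) * (\<Prod>k=1..n. entry (A k) (j (cyc_pred n k)) (j k)))"
proof -
  define F where "F w = of_bool (w 0 = h \<and> w (0 + n) = h) *
    (\<Prod>k=1..n. entry (A k) (w (0 + k - 1)) (w (0 + k)))" for w :: "nat \<Rightarrow> nat"
  define G where "G j = of_bool (j n = h) * (\<Prod>k=1..n. entry (A k) (j (cyc_pred n k)) (j k))" for j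
  have eq: "{0..0 + n} = insert 0 {1..n}"
    by auto
  have upd: "F (j(0 := v)) = (if v = h then G j else 0)" for j v
    using assms(3) by (auto intro!: prod.cong simp: F_def G_def cyc_pred_def)
  have "entry (foldr (\<lambda>k B. A k * B) [1..<n + 1] (1\<^sub>m N)) h h =
      (\<Sum>v\<in>{1..N}. \<Sum>j\<in>tuples n N. F (j(0 := v)))"
    unfolding entry_foldr_mult[where m = 0, OF assms(1,2,2)] F_def[symmetric] eq
    by (rule sum_PiE_insert) simp
  also have "\<dots> = (\<Sum>v\<in>{1..N}. if v = h then \<Sum>j\<in>tuples n N. G j else 0)"
    unfolding upd by (intro sum.cong refl) simp
  also have "\<dots> = (\<Sum>j\<in>tuples n N. G j)"
    using assms(2) by simp
  finally show ?thesis
    unfolding G_def .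
qed

text \<open>On a closed path the last vertex repeats the initial one and can be dropped.\<close>

lemma entry_foldr_mult_closed_first:
  assumes "\<And>k. A k \<in> carrier_mat N N" "h \<in> {1..N}" "n \<ge> 1"
  shows "entry (foldr (\<lambda>k B. A k * B) [1..<n + 1] (1\<^sub>m N)) h h =
    (\<Sum>i\<in>tuples n N. of_bool (i 1 = h) * (\<Prod>k=1..n. entry (A k) (i k) (i (cyc_succ n k))))"
proof -
  define F where "F w = of_bool (w 1 = h \<and> w (1 + n) = h) *
    (\<Prod>k=1..n. entry (A k) (w (1 + k - 1)) (w (1 + k)))" for w :: "nat \<Rightarrow> nat"
  define G where "G i = of_bool (i 1 = h) * (\<Prod>k=1..n. entry (A k) (i k) (i (cyc_succ n k)))" for i
  have eq: "{1..1 + n} = insert (1 + n) {1..n}"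
    by auto
  have upd: "F (i(1 + n := v)) = (if v = h then G i else 0)" for i v
    using assms(3) by (auto intro!: prod.cong simp: F_def G_def cyc_succ_def)
  have "entry (foldr (\<lambda>k B. A k * B) [1..<n + 1] (1\<^sub>m N)) h h =
      (\<Sum>v\<in>{1..N}. \<Sum>i\<in>tuples n N. F (i(1 + n := v)))"
    unfolding entry_foldr_mult[where m = 1, OF assms(1,2,2)] F_def[symmetric] eq
    by (rule sum_PiE_insert) simp
  also have "\<dots> = (\<Sum>v\<in>{1..N}. if v = h then \<Sum>i\<in>tuples n N. G i else 0)"
    unfolding upd by (intro sum.cong refl) simp
  also have "\<dots> = (\<Sum>i\<in>tuples n N. G i)"
    using assms(2) by simp
  finally show ?thesis
    unfolding G_def .
qed

section \<open>Mixed moments of independent Haar variables\<close>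

lemma cis_moment:
  "(LINT x:{0..1}|lborel. cis (2 * pi * x) ^ a * cnj (cis (2 * pi * x)) ^ b) = of_bool (a = b)"
proof -
  define c where "c = real a - real b"
  have eq: "cis (2 * pi * x) ^ a * cnj (cis (2 * pi * x)) ^ b = cis (2 * pi * c * x)" for x
    unfolding cis_cnj Complex.DeMoivre cis_mult by (simp add: c_def algebra_simps)
  show ?thesis
  proof (cases "a = b")
    case True
    then have "c = 0"
      by (simp add: c_def)
    then show ?thesis
      unfolding eq using True by (simp add: set_lebesgue_integral_def)
  next
    case False
    then have c: "c \<noteq> 0"
      by (simp add: c_def)
    define F where "F x = cis (2 * pi * c * x) / (\<i> * of_real (2 * pi * c))" for x
    have der: "(F has_vector_derivative cis (2 * pi * c * x)) (at x within {0..1})" for x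
    proof -
      have "((\<lambda>x. 2 * pi * c * x) has_real_derivative (2 * pi * c)) (at x within {0..1})"
        by (auto intro!: derivative_eq_intros)
      then have "((\<lambda>x. 2 * pi * c * x) has_derivative (\<lambda>t. 2 * pi * c * t)) (at x within {0..1})"
        by (simp add: has_field_derivative_def)
      from has_derivative_cis[OF this]
      have "((\<lambda>x. cis (2 * pi * c * x)) has_vector_derivative
          (2 * pi * c) *\<^sub>R (\<i> * cis (2 * pi * c * x))) (at x within {0..1})"
        by (simp add: has_vector_derivative_def mult_ac)
      then have "(F has_vector_derivative
          (2 * pi * c) *\<^sub>R (\<i> * cis (2 * pi * c * x)) / (\<i> * of_real (2 * pi * c))) (at x within {0..1})"
        unfolding F_def by (rule has_vector_derivative_divide)
      also have "(2 * pi * c) *\<^sub>R (\<i> * cis (2 * pi * c * x)) / (\<i> * of_real (2 * pi * c)) = cis (2 * pi * c * x)"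
        using c by (simp add: scaleR_conv_of_real)
      finally show ?thesis .
    qed
    have "cis (2 * pi * c) = 1"
      using cis_multiple_2pi[of c] by (simp add: c_def mult_ac)
    then have "F 1 = F 0"
      by (simp add: F_def)
    moreover have "(LINT x:{0..1}|lborel. cis (2 * pi * c * x)) = F 1 - F 0"
      unfolding set_lebesgue_integral_def
      by (rule integral_FTC_atLeastAtMost) (auto intro!: der continuous_intros)
    ultimately show ?thesis
      unfolding eq using False by simp
  qed
qed

lemma uniform_unit_interval:
  "uniform_measure lborel {0..1::real} = density lborel (\<lambda>x. ennreal (indicator {0..1} x))"
  by (simp add: uniform_measure_def ennreal_indicator divide_ennreal_def)

lemma haar_circle_moment:
  "integrable haar_circle (\<lambda>z. z ^ a * cnj z ^ b)"
  "(LINT z|haar_circle. z ^ a * cnj z ^ b) = of_bool (a = b)"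
proof -
  have [measurable]: "(\<lambda>x. cis (2 * pi * x)) \<in> borel_measurable borel"
    by (intro borel_measurable_continuous_onI continuous_intros)
  have [measurable]: "(\<lambda>z::complex. z ^ a * cnj z ^ b) \<in> borel_measurable borel"
    by (intro borel_measurable_continuous_onI continuous_intros)
  have m: "(\<lambda>x. cis (2 * pi * x) ^ a * cnj (cis (2 * pi * x)) ^ b) \<in> borel_measurable lborel"
    by measurable
  have prob: "prob_space (uniform_measure lborel {0..1::real})"
    by (rule prob_space_uniform_measure) auto
  then interpret U: prob_space "uniform_measure lborel {0..1::real}" .
  have "integrable (uniform_measure lborel {0..1}) (\<lambda>x. cis (2 * pi * x) ^ a * cnj (cis (2 * pi * x)) ^ b)"
    by (rule U.integrable_const_bound[where B = 1]) (auto simp: norm_mult norm_power)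
  then show "integrable haar_circle (\<lambda>z. z ^ a * cnj z ^ b)"
    unfolding haar_circle_def by (subst integrable_distr_eq) auto
  have "(LINT z|haar_circle. z ^ a * cnj z ^ b) =
      (LINT x|uniform_measure lborel {0..1}. cis (2 * pi * x) ^ a * cnj (cis (2 * pi * x)) ^ b)"
    unfolding haar_circle_def by (subst integral_distr) auto
  also have "\<dots> = (LINT x:{0..1}|lborel. cis (2 * pi * x) ^ a * cnj (cis (2 * pi * x)) ^ b)"
    unfolding uniform_unit_interval set_lebesgue_integral_def
    by (rule integral_density) (use m in auto)
  finally show "(LINT z|haar_circle. z ^ a * cnj z ^ b) = of_bool (a = b)"
    by (simp add: cis_moment)
qed

definition ker_part :: "nat \<Rightarrow> (nat \<Rightarrow> nat) \<Rightarrow> nat set set" where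
  "ker_part n i = (\<lambda>v. {k \<in> {1..n}. i k = v}) ` i ` {1..n}"

text \<open>The powers of each variable cancel: with cyclic indices, the increments \<open>j\<^sub>k
  - j\<^sub>k\<^sub>-\<^sub>1\<close> sum to zero over every block. Writing it without subtraction
  keeps the exponents natural numbers.\<close>

definition balanced :: "nat \<Rightarrow> nat set set \<Rightarrow> (nat \<Rightarrow> nat) \<Rightarrow> bool" where
  "balanced n \<pi> j \<longleftrightarrow> (\<forall>S\<in>\<pi>. (\<Sum>k\<in>S. j k) = (\<Sum>k\<in>S. j (cyc_pred n k)))"

text \<open>The random factor that a closed path of positions contributes to an entry.\<close>

definition phase :: "nat \<Rightarrow> (nat \<Rightarrow> complex) \<Rightarrow> (nat \<Rightarrow> nat) \<Rightarrow> (nat \<Rightarrow> nat) \<Rightarrow> complex" where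
  "phase n z i j = (\<Prod>k=1..n. z (i k) ^ j k * cnj (z (i k)) ^ j (cyc_pred n k))"

text \<open>The factors belonging to one variable combine to \<open>z\<^sup>a
  cnj(z)\<^sup>b\<close>, where \<open>a\<close> and \<open>b\<close> are the sums of
  \<open>j\<^sub>k\<close> and of \<open>j\<^sub>k\<^sub>-\<^sub>1\<close> over a fibre of
  \<open>i\<close>, and these powers are independent for different variables. Variables outside the
  range of \<open>i\<close> contribute the trivial condition \<open>0 = 0\<close>.\<close>

lemma haar_product_moment:
  assumes "iid_haar M N \<zeta>" "i ` {1..n} \<subseteq> {1..N}"
  shows "integrable M (\<lambda>w. phase n (\<lambda>v. \<zeta> v w) i j)"
    "(LINT w|M. phase n (\<lambda>v. \<zeta> v w) i j) =
       of_bool (balanced n (ker_part n i) j)"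
proof -
  interpret prob_space M
    using assms(1) by (simp add: iid_haar_def)
  define a where "a v = (\<Sum>k | k \<in> {1..n} \<and> i k = v. j k)" for v
  define b where "b v = (\<Sum>k | k \<in> {1..n} \<and> i k = v. j (cyc_pred n k))" for v
  \<comment> \<open>All factors of the product that involve the variable with index \<open>v\<close>.\<close>
  define Z where "Z v w = \<zeta> v w ^ a v * cnj (\<zeta> v w) ^ b v" for v w
  have prod_eq: "phase n (\<lambda>v. \<zeta> v w) i j = (\<Prod>v=1..N. Z v w)" for w
  proof -
    have "phase n (\<lambda>v. \<zeta> v w) i j =
      (\<Prod>v=1..N. \<Prod>k | k \<in> {1..n} \<and> i k = v. \<zeta> (i k) w ^ j k * cnj (\<zeta> (i k) w) ^ j (cyc_pred n k))"
      unfolding phase_def by (rule prod.group[symmetric]) (use assms(2) in auto)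
    also have "\<dots> = (\<Prod>v=1..N. Z v w)"
      by (rule prod.cong) (auto simp: Z_def a_def b_def power_sum prod.distrib)
    finally show ?thesis .
  qed
  have rv: "\<zeta> v \<in> borel_measurable M" if "v \<in> {1..N}" for v
    using assms(1) that by (auto simp: iid_haar_def indep_vars_def)
  have meas [measurable]: "(\<lambda>z::complex. z ^ c * cnj z ^ d) \<in> borel_measurable borel" for c d
    by (intro borel_measurable_continuous_onI continuous_intros)
  have distr: "distr M borel (\<zeta> v) = haar_circle" if "v \<in> {1..N}" for v
    using assms(1) that by (auto simp: iid_haar_def)
  have int: "integrable M (Z v)" if "v \<in> {1..N}" for v
    using haar_circle_moment(1)[of "a v" "b v"] rv[OF that]
    unfolding distr[OF that, symmetric] Z_def by (subst (asm) integrable_distr_eq) auto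
  have mom: "(LINT w|M. Z v w) = of_bool (a v = b v)" if "v \<in> {1..N}" for v
    using haar_circle_moment(2)[of "a v" "b v"] rv[OF that]
    unfolding distr[OF that, symmetric] Z_def by (subst (asm) integral_distr) auto
  have ind: "indep_vars (\<lambda>_. borel) Z {1..N}"
  proof -
    have "indep_vars (\<lambda>_. borel) \<zeta> {1..N}"
      using assms(1) by (simp add: iid_haar_def)
    then show ?thesis
      unfolding Z_def by (rule indep_vars_compose2) measurable
  qed
  show "integrable M (\<lambda>w. phase n (\<lambda>v. \<zeta> v w) i j)"
    unfolding prod_eq by (rule indep_vars_integrable) (use ind int in auto)
  have "(LINT w|M. phase n (\<lambda>v. \<zeta> v w) i j) =
      (\<Prod>v=1..N. LINT w|M. Z v w)"
    unfolding prod_eq by (rule indep_vars_lebesgue_integral) (use ind int in auto)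
  also have "\<dots> = (\<Prod>v=1..N. of_bool (a v = b v))"
    by (rule prod.cong) (auto simp: mom)
  also have "\<dots> = of_bool (\<forall>v\<in>{1..N}. a v = b v)"
  proof -
    have *: "(\<Prod>v\<in>T. of_bool (Q v)) = (of_bool (\<forall>v\<in>T. Q v) :: complex)" if "finite T" for T :: "nat set" and Q
      using that by (induction T) auto
    show ?thesis
      by (rule *) simp
  qed
  also have "(\<forall>v\<in>{1..N}. a v = b v) \<longleftrightarrow> (\<forall>v\<in>i ` {1..n}. a v = b v)"
  proof -
    have "a v = b v" if "v \<notin> i ` {1..n}" for v
    proof -
      have "{k. k \<in> {1..n} \<and> i k = v} = {}"
        using that by auto
      then show ?thesis
        by (simp only: a_def b_def) simp
    qed
    then show ?thesis
      using assms(2) by blast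
  qed
  also have "\<dots> \<longleftrightarrow> balanced n (ker_part n i) j"
    by (auto simp: balanced_def ker_part_def a_def b_def)
  finally show "(LINT w|M. phase n (\<lambda>v. \<zeta> v w) i j) =
       of_bool (balanced n (ker_part n i) j)" .
qed

section \<open>Entries of the two words\<close>

lemma sample_diag_carrier [simp]: "sample_diag N f \<in> carrier_mat N N"
  by (simp add: sample_diag_def)

lemma vandermonde_carrier [simp]: "vandermonde N z \<in> carrier_mat N N"
  by (simp add: vandermonde_def)

lemma mat_adjoint_carrier [simp]:
  "X \<in> carrier_mat N N \<Longrightarrow> mat_adjoint X \<in> carrier_mat N N"
  by (rule carrier_matI) (auto simp: mat_adjoint_def)

lemma entry_sample_diag_left:
  assumes "B \<in> carrier_mat N N" "u \<in> {1..N}" "v \<in> {1..N}"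
  shows "entry (sample_diag N f * B) u v = f (real u / real N) * entry B u v"
  using assms by (auto simp: entry_def sample_diag_def mat_diag_mult_left)

lemma entry_sample_diag_right:
  assumes "B \<in> carrier_mat N N" "u \<in> {1..N}" "v \<in> {1..N}"
  shows "entry (B * sample_diag N f) u v = entry B u v * f (real v / real N)"
  using assms by (auto simp: entry_def sample_diag_def mat_diag_mult_right)

lemma entry_mat_adjoint:
  assumes "X \<in> carrier_mat N N" "u \<in> {1..N}" "v \<in> {1..N}"
  shows "entry (mat_adjoint X) u v = cnj (entry X v u)"
proof -
  have "u - 1 < N" "v - 1 < N"
    using assms by auto
  then show ?thesis
    using assms(1) by (simp add: entry_def mat_adjoint_def mat_of_rows_index conjugate_complex_def)
qed

lemma entry_vandermonde:
  assumes "u \<in> {1..N}" "v \<in> {1..N}"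
  shows "entry (vandermonde N z) u v = z u ^ v / of_real (sqrt (real N))"
  using assms by (cases u; cases v) (auto simp: entry_def vandermonde_def)

lemma sandwich_carrier:
  assumes "X \<in> carrier_mat N N" "Y \<in> carrier_mat N N"
  shows "sample_diag N e * X \<in> carrier_mat N N" "sample_diag N e * X * sample_diag N f \<in> carrier_mat N N"
    "sample_diag N e * X * sample_diag N f * Y \<in> carrier_mat N N"
  using assms by (auto intro!: mult_carrier_mat[of _ N N _ N])

lemma entry_diag_sandwich:
  assumes "X \<in> carrier_mat N N" "Y \<in> carrier_mat N N" "u \<in> {1..N}" "v \<in> {1..N}"
  shows "entry (sample_diag N e * X * sample_diag N f * Y) u v =
    e (real u / real N) * (\<Sum>w\<in>{1..N}. f (real w / real N) * (entry X u w * entry Y w v))"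
proof -
  note c = sandwich_carrier(1,2)[OF assms(1,2)]
  have "entry (sample_diag N e * X * sample_diag N f * Y) u v =
      (\<Sum>w\<in>{1..N}. entry (sample_diag N e * X * sample_diag N f) u w * entry Y w v)"
    by (rule entry_mult) (use assms c in auto)
  also have "\<dots> = (\<Sum>w\<in>{1..N}. e (real u / real N) * (f (real w / real N) * (entry X u w * entry Y w v)))"
    by (intro sum.cong refl)
       (simp add: entry_sample_diag_right[OF c(1) assms(3)] entry_sample_diag_left[OF assms(1) assms(3)])
  finally show ?thesis
    by (simp add: sum_distrib_left)
qed

lemma of_real_sqrt_mult_self:
  "(of_real (sqrt (real N)) :: complex) * of_real (sqrt (real N)) = of_nat N"
  by (simp flip: of_real_mult)

lemma bij_betw_cyc_succ:
  assumes "n \<ge> 1"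
  shows "bij_betw (cyc_succ n) {1..n} {1..n}"
  by (rule bij_betw_byWitness[where f' = "cyc_pred n"]) (use assms in \<open>auto simp: cyc_succ_def cyc_pred_def\<close>)

lemma entry_word_adj_first:
  assumes "n \<ge> 1" "h \<in> {1..N}"
  shows "entry (word_adj_first N n g (vandermonde N z)) h h =
    (\<Sum>i\<in>tuples n N. \<Sum>j\<in>tuples n N.
       of_bool (j n = h) / of_nat N ^ n *
       ((\<Prod>k=1..n. g (2 * k) (real (i k) / real N)) * (\<Prod>k=1..n. g (2 * k - 1) (real (j (cyc_pred n k)) / real N))) *
       phase n z i j)"
proof -
  define X where "X = vandermonde N z"
  define A where "A k = sample_diag N (g (2 * k - 1)) * mat_adjoint X * sample_diag N (g (2 * k)) * X" for k
  define V where "V = tuples n N"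
  have X: "X \<in> carrier_mat N N"
    by (simp add: X_def)
  have A: "A k \<in> carrier_mat N N" for k
    unfolding A_def by (rule sandwich_carrier) (simp_all add: X)
  have eA: "entry (A k) u v = (\<Sum>w\<in>{1..N}. 1 / of_nat N * (g (2 * k) (real w / real N) *
       g (2 * k - 1) (real u / real N) * (z w ^ v * cnj (z w) ^ u)))" if "u \<in> {1..N}" "v \<in> {1..N}" for k u v
  proof -
    have "cnj (entry X w u) * entry X w v = 1 / of_nat N * (z w ^ v * cnj (z w) ^ u)" if "w \<in> {1..N}" for w
      using that \<open>u \<in> {1..N}\<close> \<open>v \<in> {1..N}\<close> by (simp add: X_def entry_vandermonde of_real_sqrt_mult_self)
    then show ?thesis
      using that unfolding A_def sum_distrib_left
      by (subst entry_diag_sandwich)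
         (auto intro!: sum.cong simp: X entry_mat_adjoint[OF X] sum_distrib_left)
  qed
  have jV: "j k \<in> {1..N}" if "j \<in> V" "k \<in> {1..n}" for j k
    using that by (auto simp: V_def PiE_iff)
  have pred: "cyc_pred n k \<in> {1..n}" if "k \<in> {1..n}" for k
    using that by (auto simp: cyc_pred_def)
  have "entry (word_adj_first N n g (vandermonde N z)) h h =
      (\<Sum>j\<in>V. of_bool (j n = h) * (\<Prod>k=1..n. entry (A k) (j (cyc_pred n k)) (j k)))"
    unfolding word_adj_first_def V_def A_def[symmetric] X_def[symmetric]
    by (rule entry_foldr_mult_closed_last) (use A assms in auto)
  also have "\<dots> = (\<Sum>j\<in>V. \<Sum>i\<in>V. of_bool (j n = h) / of_nat N ^ n *
       ((\<Prod>k=1..n. g (2 * k) (real (i k) / real N)) * (\<Prod>k=1..n. g (2 * k - 1) (real (j (cyc_pred n k)) / real N))) *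
       phase n z i j)"
  proof (intro sum.cong refl)
    fix j assume j: "j \<in> V"
    have "(\<Prod>k=1..n. entry (A k) (j (cyc_pred n k)) (j k)) =
       (\<Prod>k=1..n. \<Sum>w\<in>{1..N}. 1 / of_nat N * (g (2 * k) (real w / real N) *
       g (2 * k - 1) (real (j (cyc_pred n k)) / real N) * (z w ^ j k * cnj (z w) ^ j (cyc_pred n k))))"
      by (intro prod.cong refl eA jV[OF j] pred)
    also have "\<dots> = (\<Sum>i\<in>V. \<Prod>k=1..n. 1 / of_nat N * (g (2 * k) (real (i k) / real N) *
       g (2 * k - 1) (real (j (cyc_pred n k)) / real N) * (z (i k) ^ j k * cnj (z (i k)) ^ j (cyc_pred n k))))"
      unfolding V_def by (rule prod_sum_PiE) auto
    finally show "of_bool (j n = h) * (\<Prod>k=1..n. entry (A k) (j (cyc_pred n k)) (j k)) =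
      (\<Sum>i\<in>V. of_bool (j n = h) / of_nat N ^ n *
       ((\<Prod>k=1..n. g (2 * k) (real (i k) / real N)) * (\<Prod>k=1..n. g (2 * k - 1) (real (j (cyc_pred n k)) / real N))) *
       phase n z i j)"
      by (simp add: sum_distrib_left prod.distrib prod_dividef phase_def mult_ac)
  qed
  finally show ?thesis
    unfolding V_def by (subst sum.swap)
qed

text \<open>The conjugated powers are attached to \<open>i\<^sub>k\<^sub>+\<^sub>1\<close>; a cyclic
  shift of the product moves them to \<open>i\<^sub>k\<close> and brings the entry into the same
  form as for the other word.\<close>

lemma entry_word_adj_last:
  assumes "n \<ge> 1" "h \<in> {1..N}"
  shows "entry (word_adj_last N n g (vandermonde N z)) h h =
    (\<Sum>i\<in>tuples n N. \<Sum>j\<in>tuples n N.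
       of_bool (i 1 = h) / of_nat N ^ n *
       ((\<Prod>k=1..n. g (2 * k - 1) (real (i k) / real N)) * (\<Prod>k=1..n. g (2 * k) (real (j k) / real N))) *
       phase n z i j)"
proof -
  define X where "X = vandermonde N z"
  define A where "A k = sample_diag N (g (2 * k - 1)) * X * sample_diag N (g (2 * k)) * mat_adjoint X" for k
  define V where "V = tuples n N"
  have X: "X \<in> carrier_mat N N"
    by (simp add: X_def)
  have A: "A k \<in> carrier_mat N N" for k
    unfolding A_def by (rule sandwich_carrier) (simp_all add: X)
  have eA: "entry (A k) u v = (\<Sum>w\<in>{1..N}. 1 / of_nat N * (g (2 * k - 1) (real u / real N) *
       g (2 * k) (real w / real N) * (z u ^ w * cnj (z v) ^ w)))" if "u \<in> {1..N}" "v \<in> {1..N}" for k u v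
  proof -
    have "entry X u w * cnj (entry X v w) = 1 / of_nat N * (z u ^ w * cnj (z v) ^ w)" if "w \<in> {1..N}" for w
      using that \<open>u \<in> {1..N}\<close> \<open>v \<in> {1..N}\<close> by (simp add: X_def entry_vandermonde of_real_sqrt_mult_self)
    then show ?thesis
      using that unfolding A_def sum_distrib_left
      by (subst entry_diag_sandwich)
         (auto intro!: sum.cong simp: X entry_mat_adjoint[OF X] sum_distrib_left)
  qed
  have iV: "i k \<in> {1..N}" if "i \<in> V" "k \<in> {1..n}" for i k
    using that by (auto simp: V_def PiE_iff)
  have succ: "cyc_succ n k \<in> {1..n}" if "k \<in> {1..n}" for k
    using that by (auto simp: cyc_succ_def)
  have "entry (word_adj_last N n g (vandermonde N z)) h h =
      (\<Sum>i\<in>V. of_bool (i 1 = h) * (\<Prod>k=1..n. entry (A k) (i k) (i (cyc_succ n k))))"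
    unfolding word_adj_last_def V_def A_def[symmetric] X_def[symmetric]
    by (rule entry_foldr_mult_closed_first) (use A assms in auto)
  also have "\<dots> = (\<Sum>i\<in>V. \<Sum>j\<in>V. of_bool (i 1 = h) / of_nat N ^ n *
       ((\<Prod>k=1..n. g (2 * k - 1) (real (i k) / real N)) * (\<Prod>k=1..n. g (2 * k) (real (j k) / real N))) *
       phase n z i j)"
  proof (intro sum.cong refl)
    fix i assume i: "i \<in> V"
    have "(\<Prod>k=1..n. entry (A k) (i k) (i (cyc_succ n k))) =
       (\<Prod>k=1..n. \<Sum>w\<in>{1..N}. 1 / of_nat N * (g (2 * k - 1) (real (i k) / real N) *
       g (2 * k) (real w / real N) * (z (i k) ^ w * cnj (z (i (cyc_succ n k))) ^ w)))"
      by (intro prod.cong refl eA iV[OF i] succ)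
    also have "\<dots> = (\<Sum>j\<in>V. \<Prod>k=1..n. 1 / of_nat N * (g (2 * k - 1) (real (i k) / real N) *
       g (2 * k) (real (j k) / real N) * (z (i k) ^ j k * cnj (z (i (cyc_succ n k))) ^ j k)))"
      unfolding V_def by (rule prod_sum_PiE) auto
    finally have *: "(\<Prod>k=1..n. entry (A k) (i k) (i (cyc_succ n k))) = \<dots>" .
    have **: "(\<Prod>k=1..n. cnj (z (i (cyc_succ n k))) ^ j k) = (\<Prod>k=1..n. cnj (z (i k)) ^ j (cyc_pred n k))" for j
    proof -
      have "(\<Prod>k=1..n. cnj (z (i k)) ^ j (cyc_pred n k)) =
          (\<Prod>k=1..n. cnj (z (i (cyc_succ n k))) ^ j (cyc_pred n (cyc_succ n k)))"
        by (rule prod.reindex_bij_betw[OF bij_betw_cyc_succ[OF assms(1)], symmetric])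
      also have "\<dots> = (\<Prod>k=1..n. cnj (z (i (cyc_succ n k))) ^ j k)"
        by (intro prod.cong refl) (auto simp: cyc_succ_def cyc_pred_def)
      finally show ?thesis ..
    qed
    show "of_bool (i 1 = h) * (\<Prod>k=1..n. entry (A k) (i k) (i (cyc_succ n k))) =
      (\<Sum>j\<in>V. of_bool (i 1 = h) / of_nat N ^ n *
       ((\<Prod>k=1..n. g (2 * k - 1) (real (i k) / real N)) * (\<Prod>k=1..n. g (2 * k) (real (j k) / real N))) *
       phase n z i j)"
      unfolding * by (simp add: sum_distrib_left prod.distrib prod_dividef phase_def mult_ac ** del: One_nat_def)
  qed
  finally show ?thesis
    unfolding V_def .
qed

section \<open>Grouping the expectation by kernels\<close>

lemma expectation_balanced_sum:
  assumes "iid_haar M N \<zeta>"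
  shows "(LINT w|M. (\<Sum>i\<in>tuples n N. \<Sum>j\<in>W.
       c i j * phase n (\<lambda>v. \<zeta> v w) i j)) =
     (\<Sum>i\<in>tuples n N. \<Sum>j\<in>W. c i j * of_bool (balanced n (ker_part n i) j))"
proof -
  have *: "i ` {1..n} \<subseteq> {1..N}" if "i \<in> tuples n N" for i
    using that by (auto simp: PiE_iff)
  note int = haar_product_moment(1)[OF assms *] and mom = haar_product_moment(2)[OF assms *]
  have "(LINT w|M. (\<Sum>i\<in>tuples n N. \<Sum>j\<in>W. c i j * phase n (\<lambda>v. \<zeta> v w) i j)) =
      (\<Sum>i\<in>tuples n N. \<Sum>j\<in>W. LINT w|M. c i j * phase n (\<lambda>v. \<zeta> v w) i j)"
    using int by (simp add: Bochner_Integration.integral_sum)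
  also have "\<dots> = (\<Sum>i\<in>tuples n N. \<Sum>j\<in>W. c i j * of_bool (balanced n (ker_part n i) j))"
    by (intro sum.cong refl) (simp add: mom)
  finally show ?thesis .
qed

lemma sample_index_props:
  assumes "N \<ge> 1" "t \<in> {0..1}"
  shows "sample_index N t \<in> {1..N}" "t \<le> real (sample_index N t) / real N"
    "real (sample_index N t) / real N \<le> t + 1 / real N"
proof -
  have ex: "\<exists>h. h \<in> {1..N} \<and> t \<le> real h / real N"
    using assms by (intro exI[of _ N]) auto
  from LeastI_ex[OF ex] show *: "sample_index N t \<in> {1..N}" "t \<le> real (sample_index N t) / real N"
    by (auto simp: sample_index_def)
  show "real (sample_index N t) / real N \<le> t + 1 / real N"
  proof (cases "sample_index N t = 1")
    case True
    then show ?thesis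
      using assms by simp
  next
    case False
    then have "sample_index N t - 1 \<in> {1..N}" "sample_index N t - 1 < sample_index N t"
      using *(1) by auto
    then have "\<not> t \<le> real (sample_index N t - 1) / real N"
      using not_less_Least[of "sample_index N t - 1" "\<lambda>h. h \<in> {1..N} \<and> t \<le> real h / real N"]
      by (auto simp: sample_index_def)
    then show ?thesis
      using *(1) assms(1) by (auto simp: field_simps of_nat_diff)
  qed
qed

lemma ker_part_partition: "partition_on {1..n} (ker_part n i)"
  by (auto simp: partition_on_def ker_part_def disjoint_def)

lemma finite_set_partitions: "finite (set_partitions n)"
  unfolding set_partitions_def by (rule finitely_many_partition_on) simp

lemma partition_block_finite:
  assumes "partition_on {1..n::nat} \<pi>" "S \<in> \<pi>"
  shows "finite S" "S \<noteq> {}" "S \<subseteq> {1..n}"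
  using assms by (auto simp: partition_on_def intro: finite_subset)

lemma partition_Max_in:
  assumes "partition_on {1..n::nat} \<pi>" "S \<in> \<pi>"
  shows "Max S \<in> S"
  using partition_block_finite[OF assms] by (intro Max_in)

lemma partition_block_unique:
  assumes "partition_on A \<pi>" "S \<in> \<pi>" "T \<in> \<pi>" "k \<in> S" "k \<in> T"
  shows "S = T"
  using assms by (auto simp: partition_on_def disjoint_def)

lemma inj_on_Max_partition:
  assumes "partition_on {1..n::nat} \<pi>"
  shows "inj_on Max \<pi>"
proof (rule inj_onI)
  fix S T assume "S \<in> \<pi>" "T \<in> \<pi>" "Max S = Max T"
  then show "S = T"
    using partition_block_unique[OF assms] partition_Max_in[OF assms] by metis
qed

text \<open>\<open>J_part\<close> removes from each block its maximum. Since different blocks have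
  different maxima, its cardinality is \<open>n - card \<pi>\<close>, the number of degrees of
  freedom left by the balance conditions.\<close>

lemma J_part_eq:
  assumes "partition_on {1..n} \<pi>"
  shows "J_part \<pi> = {1..n} - Max ` \<pi>"
proof (intro equalityI subsetI)
  fix k assume "k \<in> J_part \<pi>"
  then obtain S where S: "S \<in> \<pi>" "k \<in> S" "k \<noteq> Max S"
    by (auto simp: J_part_def)
  have "k \<noteq> Max T" if "T \<in> \<pi>" for T
    using partition_block_unique[OF assms S(1) that S(2)] partition_Max_in[OF assms that] S(3) by metis
  then show "k \<in> {1..n} - Max ` \<pi>"
    using S partition_block_finite(3)[OF assms S(1)] by auto
next
  fix k assume k: "k \<in> {1..n} - Max ` \<pi>"
  then obtain S where "S \<in> \<pi>" "k \<in> S"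
    using partition_onD1[OF assms] by blast
  then show "k \<in> J_part \<pi>"
    using k by (auto simp: J_part_def)
qed

lemma card_J_part:
  assumes "partition_on {1..n} \<pi>"
  shows "card (J_part \<pi>) + card \<pi> = n"
proof -
  have "Max ` \<pi> \<subseteq> {1..n}"
    using partition_Max_in[OF assms] partition_block_finite(3)[OF assms] by blast
  then have "card (Max ` \<pi>) \<le> n" "card ({1..n} - Max ` \<pi>) = n - card (Max ` \<pi>)"
    using card_mono[of "{1..n}" "Max ` \<pi>"] by (auto simp: card_Diff_subset finite_subset)
  then show ?thesis
    using card_image[OF inj_on_Max_partition[OF assms]] by (simp add: J_part_eq[OF assms])
qed

lemma card_partition_pos:
  assumes "partition_on {1..n::nat} \<pi>" "n \<ge> 1"
  shows "card \<pi> \<ge> 1"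
proof -
  have "finite \<pi>" "\<pi> \<noteq> {}"
    using assms finite_elements[of "{1..n}" \<pi>] by (auto simp: partition_on_def)
  then show ?thesis
    by (simp add: Suc_le_eq card_gt_0_iff)
qed

definition avg :: "nat \<Rightarrow> (nat \<Rightarrow> complex) \<Rightarrow> complex" where
  "avg N a = (\<Sum>v=1..N. a v) / of_nat N"

text \<open>The exponent \<open>card \<pi> - 1\<close> counts the blocks whose label is not fixed by
  \<open>i 1 = h\<close>.\<close>

definition Gamma_disc :: "nat \<Rightarrow> nat \<Rightarrow> nat set set \<Rightarrow> (nat \<Rightarrow> real \<Rightarrow> complex) \<Rightarrow> nat \<Rightarrow> complex" where
  "Gamma_disc N n \<pi> f h =
     (\<Sum>i | i \<in> tuples n N \<and> ker_part n i = \<pi> \<and> i 1 = h. \<Prod>k=1..n. f k (real (i k) / real N)) /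
     of_nat N ^ (card \<pi> - 1)"

text \<open>The exponent \<open>card (J_part \<pi>)\<close> is the dimension of the lattice of
  balanced exponents with prescribed last entry.\<close>

definition Lambda_disc :: "nat \<Rightarrow> nat \<Rightarrow> nat set set \<Rightarrow> (nat \<Rightarrow> real \<Rightarrow> complex) \<Rightarrow> nat \<Rightarrow> complex" where
  "Lambda_disc N n \<pi> f h =
     (\<Sum>j | j \<in> tuples n N \<and> balanced n \<pi> j \<and> j n = h. \<Prod>p=1..n - 1. f p (real (j p) / real N)) /
     of_nat N ^ card (J_part \<pi>)"

text \<open>The expected diagonal entries, as functions of the grid position. The probability space
  has disappeared, which makes the rate independent of it.\<close>

definition disc_adj_first :: "nat \<Rightarrow> nat \<Rightarrow> (nat \<Rightarrow> real \<Rightarrow> complex) \<Rightarrow> nat \<Rightarrow> complex" where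
  "disc_adj_first N n g h = (\<Sum>\<pi>\<in>set_partitions n.
     g 1 (real h / real N) * Lambda_disc N n \<pi> (\<lambda>j. g (2 * j + 1)) h *
     avg N (Gamma_disc N n \<pi> (\<lambda>j. g (2 * j))))"

definition disc_adj_last :: "nat \<Rightarrow> nat \<Rightarrow> (nat \<Rightarrow> real \<Rightarrow> complex) \<Rightarrow> nat \<Rightarrow> complex" where
  "disc_adj_last N n g h = (\<Sum>\<pi>\<in>set_partitions n.
     Gamma_disc N n \<pi> (\<lambda>j. g (2 * j - 1)) h *
     avg N (\<lambda>v. Lambda_disc N n \<pi> (\<lambda>j. g (2 * j)) v * g (2 * n) (real v / real N)))"

lemma sum_over_kernels:
  "(\<Sum>i\<in>tuples n N. F i * G (ker_part n i)) =
   (\<Sum>\<pi>\<in>set_partitions n. (\<Sum>i | i \<in> tuples n N \<and> ker_part n i = \<pi>. F i) * G \<pi> :: complex)"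
proof -
  have "(\<Sum>i\<in>tuples n N. F i * G (ker_part n i)) =
    (\<Sum>\<pi>\<in>set_partitions n. \<Sum>i | i \<in> tuples n N \<and> ker_part n i = \<pi>. F i * G (ker_part n i))"
    by (rule sum.group[symmetric])
       (use finite_set_partitions ker_part_partition in \<open>auto simp: set_partitions_def finite_PiE simp del: One_nat_def\<close>)
  then show ?thesis
    by (simp add: sum_distrib_right)
qed

lemma sum_split_value:
  fixes N :: nat
  assumes "\<And>i. i \<in> V \<Longrightarrow> i k \<in> {1..N}" "finite V"
  shows "(\<Sum>i\<in>V. F i :: complex) = (\<Sum>v=1..N. \<Sum>i | i \<in> V \<and> i k = v. F i)"
  by (rule sum.group[symmetric]) (use assms in auto)

text \<open>The distinguished position fixes \<open>j\<^sub>n\<close>, so the sum over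
  \<open>i\<close> is unrestricted and becomes an average over the label \<open>i\<^sub>1\<close>.
  The powers of \<open>N\<close> match because \<open>card (J_part \<pi>) + card \<pi> =
  n\<close>.\<close>

lemma expect_diag_adj_first_eq:
  assumes "n \<ge> 1" "N \<ge> 1" "iid_haar M N \<zeta>" "t \<in> {0..1}"
  shows "expect_diag_adj_first M \<zeta> N n g t = disc_adj_first N n g (sample_index N t)"
proof -
  define h where "h = sample_index N t"
  have h: "h \<in> {1..N}"
    using sample_index_props(1)[OF assms(2,4)] by (simp add: h_def)
  define V where "V = tuples n N"
  have finV: "finite V"
    by (simp add: V_def finite_PiE)
  define F where "F i = (\<Prod>k=1..n. g (2 * k) (real (i k) / real N))" for i :: "nat \<Rightarrow> nat"
  define G where "G j = (\<Prod>p=1..n - 1. g (2 * p + 1) (real (j p) / real N))" for j :: "nat \<Rightarrow> nat"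
  have G: "(\<Prod>k=1..n. g (2 * k - 1) (real (j (cyc_pred n k)) / real N)) = g 1 (real (j n) / real N) * G j" for j
  proof -
    have "(\<Prod>k=1..n. g (2 * k - 1) (real (j (cyc_pred n k)) / real N)) =
       g 1 (real (j n) / real N) * (\<Prod>k=2..n. g (2 * k - 1) (real (j (cyc_pred n k)) / real N))"
      using assms(1) by (simp add: prod.atLeast_Suc_atMost cyc_pred_def numeral_2_eq_2)
    also have "(\<Prod>k=2..n. g (2 * k - 1) (real (j (cyc_pred n k)) / real N)) = G j"
      unfolding G_def
      by (rule prod.reindex_bij_witness[of _ "\<lambda>p. p + 1" "\<lambda>k. k - 1"]) (auto simp: cyc_pred_def intro!: arg_cong2[of _ _ _ _ g])
    finally show ?thesis .
  qed
  have "expect_diag_adj_first M \<zeta> N n g t =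
      (LINT w|M. entry (word_adj_first N n g (vandermonde N (\<lambda>i. \<zeta> i w))) h h)"
    by (simp add: expect_diag_adj_first_def entry_def h_def)
  also have "\<dots> = (\<Sum>i\<in>V. \<Sum>j\<in>V. of_bool (j n = h) / of_nat N ^ n *
       (F i * (g 1 (real (j n) / real N) * G j)) * of_bool (balanced n (ker_part n i) j))"
    unfolding entry_word_adj_first[OF assms(1) h] expectation_balanced_sum[OF assms(3)] G
    by (simp only: V_def F_def)
  also have "\<dots> = (\<Sum>i\<in>V. F i * (\<Sum>j | j \<in> V \<and> balanced n (ker_part n i) j \<and> j n = h.
       g 1 (real h / real N) * G j / of_nat N ^ n))"
    by (simp add: sum_distrib_left sum.inter_filter[OF finV] cong: conj_cong)
       (intro sum.cong refl, auto)
  also have "\<dots> = (\<Sum>\<pi>\<in>set_partitions n. (\<Sum>i | i \<in> V \<and> ker_part n i = \<pi>. F i) *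
      (\<Sum>j | j \<in> V \<and> balanced n \<pi> j \<and> j n = h. g 1 (real h / real N) * G j / of_nat N ^ n))"
    unfolding V_def by (rule sum_over_kernels)
  also have "\<dots> = disc_adj_first N n g h"
    unfolding disc_adj_first_def
  proof (intro sum.cong refl)
    fix \<pi> assume "\<pi> \<in> set_partitions n"
    then have p: "partition_on {1..n} \<pi>"
      by (simp add: set_partitions_def)
    have pow: "of_nat N ^ n = (of_nat N ^ card (J_part \<pi>) * of_nat N ^ card \<pi> :: complex)"
      by (simp add: card_J_part[OF p] flip: power_add)
    have fin: "finite {i. i \<in> V \<and> Q i}" for Q
      by (rule finite_subset[OF _ finV]) auto
    have "(\<Sum>i | i \<in> V \<and> ker_part n i = \<pi>. F i) =
        (\<Sum>v=1..N. \<Sum>i | i \<in> {i. i \<in> V \<and> ker_part n i = \<pi>} \<and> i 1 = v. F i)"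
      by (rule sum_split_value) (use assms(1) fin in \<open>auto simp: V_def dest: PiE_mem\<close>)
    also have "\<dots> = of_nat N ^ card \<pi> * avg N (Gamma_disc N n \<pi> (\<lambda>j. g (2 * j)))"
      using card_partition_pos[OF p assms(1)] assms(2)
      by (cases "card \<pi>") (simp_all add: avg_def Gamma_disc_def V_def F_def conj_assoc sum_divide_distrib[symmetric])
    finally have 1: "(\<Sum>i | i \<in> V \<and> ker_part n i = \<pi>. F i) = \<dots>" .
    have 2: "(\<Sum>j | j \<in> V \<and> balanced n \<pi> j \<and> j n = h. g 1 (real h / real N) * G j / of_nat N ^ n) =
        g 1 (real h / real N) * Lambda_disc N n \<pi> (\<lambda>j. g (2 * j + 1)) h / of_nat N ^ card \<pi>"
      using assms(2) pow
      by (simp add: Lambda_disc_def V_def G_def sum_divide_distrib sum_distrib_left mult_ac)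
    show "(\<Sum>i | i \<in> V \<and> ker_part n i = \<pi>. F i) *
      (\<Sum>j | j \<in> V \<and> balanced n \<pi> j \<and> j n = h. g 1 (real h / real N) * G j / of_nat N ^ n) =
      g 1 (real h / real N) *
     Lambda_disc N n \<pi> (\<lambda>j. g (2 * j + 1)) h * avg N (Gamma_disc N n \<pi> (\<lambda>j. g (2 * j)))"
      unfolding 1 2 using assms(2) by simp
  qed
  finally show ?thesis
    by (simp add: h_def)
qed

text \<open>Here the distinguished position fixes \<open>i\<^sub>1\<close>, so the sum over
  \<open>j\<close> is unrestricted and becomes an average over \<open>j\<^sub>n\<close>.\<close>

lemma expect_diag_adj_last_eq:
  assumes "n \<ge> 1" "N \<ge> 1" "iid_haar M N \<zeta>" "t \<in> {0..1}"
  shows "expect_diag_adj_last M \<zeta> N n g t = disc_adj_last N n g (sample_index N t)"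
proof -
  define h where "h = sample_index N t"
  have h: "h \<in> {1..N}"
    using sample_index_props(1)[OF assms(2,4)] by (simp add: h_def)
  define V where "V = tuples n N"
  have finV: "finite V"
    by (simp add: V_def finite_PiE)
  define F where "F i = (\<Prod>k=1..n. g (2 * k - 1) (real (i k) / real N))" for i :: "nat \<Rightarrow> nat"
  define G where "G j = (\<Prod>p=1..n - 1. g (2 * p) (real (j p) / real N))" for j :: "nat \<Rightarrow> nat"
  have G: "(\<Prod>k=1..n. g (2 * k) (real (j k) / real N)) = G j * g (2 * n) (real (j n) / real N)" for j
    unfolding G_def using assms(1) by (cases n) simp_all
  have "expect_diag_adj_last M \<zeta> N n g t =
      (LINT w|M. entry (word_adj_last N n g (vandermonde N (\<lambda>i. \<zeta> i w))) h h)"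
    by (simp add: expect_diag_adj_last_def entry_def h_def)
  also have "\<dots> = (\<Sum>i\<in>V. \<Sum>j\<in>V. of_bool (i 1 = h) / of_nat N ^ n *
       (F i * (G j * g (2 * n) (real (j n) / real N))) * of_bool (balanced n (ker_part n i) j))"
    unfolding entry_word_adj_last[OF assms(1) h] expectation_balanced_sum[OF assms(3)] G
    by (simp only: V_def F_def)
  also have "\<dots> = (\<Sum>i\<in>V. (of_bool (i 1 = h) * F i) * (\<Sum>j | j \<in> V \<and> balanced n (ker_part n i) j.
       G j * g (2 * n) (real (j n) / real N) / of_nat N ^ n))"
    by (simp add: sum_distrib_left sum.inter_filter[OF finV] cong: conj_cong)
       (intro sum.cong refl, auto)
  also have "\<dots> = (\<Sum>\<pi>\<in>set_partitions n. (\<Sum>i | i \<in> V \<and> ker_part n i = \<pi>. of_bool (i 1 = h) * F i) *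
      (\<Sum>j | j \<in> V \<and> balanced n \<pi> j. G j * g (2 * n) (real (j n) / real N) / of_nat N ^ n))"
    unfolding V_def by (rule sum_over_kernels)
  also have "\<dots> = disc_adj_last N n g h"
    unfolding disc_adj_last_def
  proof (intro sum.cong refl)
    fix \<pi> assume "\<pi> \<in> set_partitions n"
    then have p: "partition_on {1..n} \<pi>"
      by (simp add: set_partitions_def)
    have pow: "of_nat N ^ n = (of_nat N ^ card (J_part \<pi>) * of_nat N ^ card \<pi> :: complex)"
      by (simp add: card_J_part[OF p] flip: power_add)
    have fin: "finite {i. i \<in> V \<and> Q i}" for Q
      by (rule finite_subset[OF _ finV]) auto
    have "(\<Sum>i | i \<in> V \<and> ker_part n i = \<pi>. of_bool (i 1 = h) * F i) =
      (\<Sum>i | i \<in> V \<and> ker_part n i = \<pi> \<and> i 1 = h. F i)"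
      by (simp add: sum.inter_filter[OF finV] cong: conj_cong) (intro sum.cong refl, auto)
    also have "\<dots> = Gamma_disc N n \<pi> (\<lambda>j. g (2 * j - 1)) h * of_nat N ^ (card \<pi> - 1)"
      using assms(2) by (simp add: Gamma_disc_def V_def F_def)
    finally have 1: "(\<Sum>i | i \<in> V \<and> ker_part n i = \<pi>. of_bool (i 1 = h) * F i) = \<dots>" .
    have "(\<Sum>j | j \<in> V \<and> balanced n \<pi> j. G j * g (2 * n) (real (j n) / real N) / of_nat N ^ n) =
        (\<Sum>v=1..N. \<Sum>j | j \<in> {j. j \<in> V \<and> balanced n \<pi> j} \<and> j n = v. G j * g (2 * n) (real (j n) / real N) / of_nat N ^ n)"
      by (rule sum_split_value) (use assms(1) fin in \<open>auto simp: V_def dest: PiE_mem\<close>)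
    also have "\<dots> = (\<Sum>v=1..N. (\<Sum>j | j \<in> V \<and> balanced n \<pi> j \<and> j n = v. G j) * g (2 * n) (real v / real N) / of_nat N ^ n)"
      by (intro sum.cong refl) (simp add: sum_distrib_right sum_divide_distrib conj_assoc cong: conj_cong)
    also have "\<dots> = (\<Sum>v=1..N. Lambda_disc N n \<pi> (\<lambda>j. g (2 * j)) v * g (2 * n) (real v / real N) / of_nat N ^ card \<pi>)"
      using assms(2) pow
      by (intro sum.cong refl) (simp add: Lambda_disc_def V_def G_def)
    also have "\<dots> = avg N (\<lambda>v. Lambda_disc N n \<pi> (\<lambda>j. g (2 * j)) v * g (2 * n) (real v / real N)) / of_nat N ^ (card \<pi> - 1)"
      using card_partition_pos[OF p assms(1)] by (cases "card \<pi>") (simp_all add: avg_def sum_divide_distrib[symmetric])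
    finally have 2: "(\<Sum>j | j \<in> V \<and> balanced n \<pi> j. G j * g (2 * n) (real (j n) / real N) / of_nat N ^ n) = \<dots>" .
    show "(\<Sum>i | i \<in> V \<and> ker_part n i = \<pi>. of_bool (i 1 = h) * F i) *
      (\<Sum>j | j \<in> V \<and> balanced n \<pi> j. G j * g (2 * n) (real (j n) / real N) / of_nat N ^ n) =
      Gamma_disc N n \<pi> (\<lambda>j. g (2 * j - 1)) h *
     avg N (\<lambda>v. Lambda_disc N n \<pi> (\<lambda>j. g (2 * j)) v * g (2 * n) (real v / real N))"
      unfolding 1 2 using assms(2) by simp
  qed
  finally show ?thesis
    by (simp add: h_def)
qed

section \<open>Balanced exponents as lattice points of a polytope\<close>

lemma block_of_eq:
  assumes "partition_on A \<pi>" "S \<in> \<pi>" "k \<in> S"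
  shows "block_of \<pi> k = S"
  unfolding block_of_def
  by (rule the_equality) (use assms partition_block_unique[OF assms(1)] in auto)

lemma block_of_in:
  assumes "partition_on A \<pi>" "k \<in> A"
  shows "block_of \<pi> k \<in> \<pi>" "k \<in> block_of \<pi> k"
proof -
  obtain S where "S \<in> \<pi>" "k \<in> S"
    using assms partition_onD1[OF assms(1)] by blast
  then show "block_of \<pi> k \<in> \<pi>" "k \<in> block_of \<pi> k"
    using block_of_eq[OF assms(1)] by auto
qed

lemma subset_atMost_iff_Max:
  assumes "partition_on {1..n::nat} \<pi>" "S \<in> \<pi>"
  shows "S \<subseteq> {1..p} \<longleftrightarrow> Max S \<le> p"
proof
  assume "S \<subseteq> {1..p}"
  then show "Max S \<le> p"
    using partition_Max_in[OF assms] by auto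
next
  assume "Max S \<le> p"
  then show "S \<subseteq> {1..p}"
    using partition_block_finite[OF assms] Max_ge[of S] by (auto intro: order_trans)
qed

text \<open>\<open>I_part \<pi> p\<close> collects the indices up to \<open>p\<close> whose block is
  still open, that is, whose block has its maximum beyond \<open>p\<close>.\<close>

lemma I_part_iff:
  assumes "partition_on {1..n} \<pi>" "p \<le> n"
  shows "k \<in> I_part \<pi> p \<longleftrightarrow> k \<in> {1..p} \<and> p < Max (block_of \<pi> k)"
proof (cases "k \<in> {1..p}")
  case True
  then have "k \<in> {1..n}"
    using assms(2) by simp
  from subset_atMost_iff_Max[OF assms(1) block_of_in(1)[OF assms(1) this], of p] True show ?thesis
    unfolding I_part_def by (simp add: not_le)
qed (auto simp: I_part_def)

lemma I_part_ends:
  assumes "partition_on {1..n} \<pi>"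
  shows "I_part \<pi> 0 = {}" "I_part \<pi> n = {}"
proof -
  show "I_part \<pi> 0 = {}"
    by (simp add: I_part_def)
  have "block_of \<pi> k \<subseteq> {1..n}" if "k \<in> {1..n}" for k
    by (rule partition_block_finite(3)[OF assms block_of_in(1)[OF assms that]])
  then show "I_part \<pi> n = {}"
    unfolding I_part_def by blast
qed

lemma J_part_iff:
  assumes "partition_on {1..n} \<pi>" "k \<in> {1..n}"
  shows "k \<in> J_part \<pi> \<longleftrightarrow> k < Max (block_of \<pi> k)"
proof -
  note b = block_of_in[OF assms]
  have "k \<le> Max (block_of \<pi> k)"
    using partition_block_finite(1)[OF assms(1) b(1)] b(2) by simp
  moreover have "k \<in> J_part \<pi> \<longleftrightarrow> k \<noteq> Max (block_of \<pi> k)"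
  proof
    assume "k \<in> J_part \<pi>"
    then obtain S where S: "S \<in> \<pi>" "k \<in> S" "k \<noteq> Max S"
      by (auto simp: J_part_def)
    then show "k \<noteq> Max (block_of \<pi> k)"
      using block_of_eq[OF assms(1) S(1,2)] by simp
  next
    assume "k \<noteq> Max (block_of \<pi> k)"
    then show "k \<in> J_part \<pi>"
      using b by (auto simp: J_part_def)
  qed
  ultimately show ?thesis
    by linarith
qed

lemma I_part_subset_J_part:
  assumes "partition_on {1..n} \<pi>" "p \<le> n"
  shows "I_part \<pi> p \<subseteq> J_part \<pi>"
proof
  fix k assume "k \<in> I_part \<pi> p"
  then have "k \<in> {1..p}" "p < Max (block_of \<pi> k)"
    using I_part_iff[OF assms, of k] by simp_all
  then show "k \<in> J_part \<pi>"
    using J_part_iff[OF assms(1), of k] assms(2) by simp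
qed

lemma finite_I_part [simp]: "finite (I_part \<pi> p)"
  by (auto simp: I_part_def)

lemma finite_J_part:
  assumes "partition_on {1..n} \<pi>"
  shows "finite (J_part \<pi>)"
  unfolding J_part_eq[OF assms] by simp

text \<open>Passing an index that is not the maximum of its block only opens one more index.\<close>

lemma I_part_step_J:
  assumes "partition_on {1..n} \<pi>" "p \<in> {1..n}" "p \<in> J_part \<pi>"
  shows "I_part \<pi> p = insert p (I_part \<pi> (p - 1))" "p \<notin> I_part \<pi> (p - 1)"
proof -
  define q where "q = p - 1"
  have p: "p \<le> n" "q \<le> n" "p = Suc q"
    using assms(2) by (auto simp: q_def)
  note iff_p = I_part_iff[OF assms(1) p(1)] and iff_q = I_part_iff[OF assms(1) p(2)]
  have nomax: "Max (block_of \<pi> k) \<noteq> p" if "k \<in> {1..n}" for k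
    using assms(3) block_of_in(1)[OF assms(1) that] unfolding J_part_eq[OF assms(1)] by blast
  have pmax: "p < Max (block_of \<pi> p)"
    using J_part_iff[OF assms(1,2)] assms(3) by simp
  have "k \<in> I_part \<pi> p \<longleftrightarrow> k = p \<or> k \<in> I_part \<pi> q" for k
  proof (cases "k = p \<or> k \<notin> {1..p}")
    case True
    then show ?thesis
      using pmax p unfolding iff_p iff_q by auto
  next
    case False
    then have "Max (block_of \<pi> k) \<noteq> p"
      using nomax[of k] p(1) by simp
    then show ?thesis
      using False p(3) unfolding iff_p iff_q by auto
  qed
  then show "I_part \<pi> p = insert p (I_part \<pi> (p - 1))"
    by (auto simp: q_def)
  show "p \<notin> I_part \<pi> (p - 1)"
    using p(3) by (auto simp: I_part_def)
qed

text \<open>Passing the maximum of a block closes the block and removes its other members.\<close>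

lemma I_part_step_Max:
  assumes "partition_on {1..n} \<pi>" "p \<in> {1..n}" "p \<notin> J_part \<pi>"
  shows "I_part \<pi> (p - 1) = I_part \<pi> p \<union> (block_of \<pi> p - {p})" "I_part \<pi> p \<inter> (block_of \<pi> p - {p}) = {}"
proof -
  define q where "q = p - 1"
  have p: "p \<le> n" "q \<le> n" "p = Suc q"
    using assms(2) by (auto simp: q_def)
  note iff_p = I_part_iff[OF assms(1) p(1)] and iff_q = I_part_iff[OF assms(1) p(2)]
  define S where "S = block_of \<pi> p"
  note S = block_of_in[OF assms(1,2), folded S_def]
  have "p \<le> Max S"
    using partition_block_finite(1)[OF assms(1) S(1)] S(2) by (rule Max_ge)
  then have Max: "Max S = p"
    using J_part_iff[OF assms(1,2)] assms(3) by (simp add: S_def)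
  have S_sub: "S \<subseteq> {1..p}"
    using subset_atMost_iff_Max[OF assms(1) S(1)] Max by simp
  have blk: "block_of \<pi> k = S" if "k \<in> S" for k
    using block_of_eq[OF assms(1) S(1) that] .
  have eqS: "k \<in> S" if "k \<in> {1..n}" "Max (block_of \<pi> k) = p" for k
  proof -
    have "block_of \<pi> k = S"
      using inj_on_Max_partition[OF assms(1)] block_of_in(1)[OF assms(1) that(1)] S(1) that(2) Max
      by (auto dest: inj_onD)
    then show ?thesis
      using block_of_in(2)[OF assms(1) that(1)] by simp
  qed
  have notS: "k \<notin> S" if "k \<in> I_part \<pi> p" for k
    using that blk[of k] Max by (auto simp: iff_p)
  then show "I_part \<pi> p \<inter> (block_of \<pi> p - {p}) = {}"
    by (auto simp: S_def[symmetric])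
  have "I_part \<pi> q = I_part \<pi> p \<union> (S - {p})"
  proof (intro equalityI subsetI)
    fix k assume "k \<in> I_part \<pi> q"
    then have k: "k \<in> {1..q}" "q < Max (block_of \<pi> k)"
      by (simp_all add: iff_q)
    show "k \<in> I_part \<pi> p \<union> (S - {p})"
    proof (cases "Max (block_of \<pi> k) = p")
      case True
      then show ?thesis
        using eqS[of k] k p by simp
    next
      case False
      then have "k \<in> I_part \<pi> p"
        using k p unfolding iff_p by simp
      then show ?thesis ..
    qed
  next
    fix k assume k: "k \<in> I_part \<pi> p \<union> (S - {p})"
    show "k \<in> I_part \<pi> q"
    proof (cases "k \<in> S")
      case True
      then have "k \<noteq> p" "k \<in> {1..p}"
        using k notS S_sub by auto
      then show ?thesis
        using blk[OF True] Max p unfolding iff_q by simp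
    next
      case False
      then have "k \<in> {1..p}" "p < Max (block_of \<pi> k)" "k \<noteq> p"
        using k S(2) iff_p[of k] by auto
      then show ?thesis
        using p unfolding iff_q by simp
    qed
  qed
  then show "I_part \<pi> (p - 1) = I_part \<pi> p \<union> (block_of \<pi> p - {p})"
    by (simp only: q_def S_def)
qed

text \<open>The partial sums form a walk whose increments are the free coordinates on \<open>J_part
  \<pi>\<close> and, at the maximum of a block, minus the sum of the other coordinates of the block.
  This identity is what makes the walk balanced, and it is used over the integers and over the
  reals.\<close>

lemma I_part_sum_increment:
  fixes y :: "nat \<Rightarrow> 'a::ab_group_add"
  assumes "partition_on {1..n} \<pi>" "p \<in> {1..n}"
  shows "(\<Sum>k\<in>I_part \<pi> p. y k) - (\<Sum>k\<in>I_part \<pi> (p - 1). y k) =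
    (if p \<in> J_part \<pi> then y p else - (\<Sum>k\<in>block_of \<pi> p - {p}. y k))"
proof (cases "p \<in> J_part \<pi>")
  case True
  then show ?thesis
    using I_part_step_J[OF assms True] by simp
next
  case False
  have "finite (block_of \<pi> p - {p})"
    using partition_block_finite(1)[OF assms(1) block_of_in(1)[OF assms]] by simp
  then show ?thesis
    using I_part_step_Max[OF assms False] False by (simp add: sum.union_disjoint)
qed

text \<open>Increments of the walk \<open>h, j\<^sub>1, \<dots>, j\<^sub>n\<close> at the indices in
  \<open>J_part \<pi>\<close>; the walk with given increments is \<open>walk\<close> below.\<close>

definition steps :: "nat set set \<Rightarrow> nat \<Rightarrow> (nat \<Rightarrow> nat) \<Rightarrow> nat \<Rightarrow> int" where
  "steps \<pi> h j = (\<lambda>k\<in>J_part \<pi>. int (j k) - int (if k = 1 then h else j (k - 1)))"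

definition walk :: "nat \<Rightarrow> nat set set \<Rightarrow> nat \<Rightarrow> (nat \<Rightarrow> int) \<Rightarrow> nat \<Rightarrow> nat" where
  "walk n \<pi> h y = (\<lambda>p\<in>{1..n}. nat (int h + (\<Sum>k\<in>I_part \<pi> p. y k)))"

definition lattice_E :: "nat \<Rightarrow> nat set set \<Rightarrow> nat \<Rightarrow> nat \<Rightarrow> (nat \<Rightarrow> int) set" where
  "lattice_E n \<pi> N h = {y \<in> J_part \<pi> \<rightarrow>\<^sub>E UNIV. \<forall>p\<in>{1..n - 1}.
     1 \<le> int h + (\<Sum>k\<in>I_part \<pi> p. y k) \<and> int h + (\<Sum>k\<in>I_part \<pi> p. y k) \<le> int N}"

lemma block_not_J:
  assumes "partition_on {1..n} \<pi>" "S \<in> \<pi>" "k \<in> S" "k \<notin> J_part \<pi>"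
  shows "Max S = k"
proof -
  have "k \<in> {1..n}"
    using partition_block_finite(3)[OF assms(1,2)] assms(3) by blast
  then have "\<not> k < Max S"
    using J_part_iff[OF assms(1)] block_of_eq[OF assms(1-3)] assms(4) by simp
  moreover have "k \<le> Max S"
    using partition_block_finite(1)[OF assms(1,2)] assms(3) by simp
  ultimately show ?thesis
    by simp
qed

text \<open>A balanced walk is determined by its increments on \<open>J_part \<pi>\<close>, because
  balance forces the increment at the maximum of each block; conversely the walk built from
  arbitrary increments on \<open>J_part \<pi>\<close> is balanced and returns to \<open>h\<close>.
  Only the condition that the walk stays in \<open>{1..N}\<close> remains.\<close>

lemma bij_betw_walk:
  assumes \<pi>: "partition_on {1..n} \<pi>" and n: "n \<ge> 1" and h: "h \<in> {1..N}"
  shows "bij_betw (walk n \<pi> h) (lattice_E n \<pi> N h)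
    {j \<in> tuples n N. balanced n \<pi> j \<and> j n = h}"
proof -
  define L where "L = {j \<in> tuples n N. balanced n \<pi> j \<and> j n = h}"
  define s where "s y p = int h + (\<Sum>k\<in>I_part \<pi> p. y k)" for y :: "nat \<Rightarrow> int" and p
  \<comment> \<open>The walk with its starting point put at time 0; this unrolls the cyclic index.\<close>
  define j0 where "j0 j k = (if k = 0 then int h else int (j k))" for j :: "nat \<Rightarrow> nat" and k
  have s_ends: "s y 0 = int h" "s y n = int h" for y
    by (simp_all add: s_def I_part_ends[OF \<pi>])
  have s_inc: "s y p - s y (p - 1) = (if p \<in> J_part \<pi> then y p else - (\<Sum>k\<in>block_of \<pi> p - {p}. y k))"
    if "p \<in> {1..n}" for y p
    using I_part_sum_increment[OF \<pi> that, of y] by (simp add: s_def)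
  have J_n: "J_part \<pi> \<subseteq> {1..n}"
    unfolding J_part_eq[OF \<pi>] by blast
  have s_range: "s y p \<in> {1..int N}" if "y \<in> lattice_E n \<pi> N h" "p \<le> n" for y p
  proof (cases "p \<in> {1..n - 1}")
    case True
    then show ?thesis
      using that by (auto simp: lattice_E_def s_def)
  next
    case False
    then have "p = 0 \<or> p = n"
      using that(2) by auto
    then show ?thesis
      using s_ends h by auto
  qed
  have walk_s: "int (walk n \<pi> h y p) = s y p" if "y \<in> lattice_E n \<pi> N h" "p \<in> {1..n}" for y p
    using s_range[OF that(1), of p] that(2) by (simp add: walk_def s_def)
  have j0_walk: "j0 (walk n \<pi> h y) p = s y p" if "y \<in> lattice_E n \<pi> N h" "p \<le> n" for y p
    using walk_s[OF that(1), of p] that(2) s_ends(1) by (cases p) (auto simp: j0_def)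
  have steps_j0: "steps \<pi> h j k = j0 j k - j0 j (k - 1)" if "k \<in> J_part \<pi>" for j k
    using that J_n by (auto simp: steps_def j0_def)
  have bal: "balanced n \<pi> j \<longleftrightarrow> (\<forall>S\<in>\<pi>. (\<Sum>k\<in>S. j0 j k - j0 j (k - 1)) = 0)" if "j n = h" for j
  proof -
    have "(\<Sum>k\<in>S. j0 j k - j0 j (k - 1)) = int (\<Sum>k\<in>S. j k) - int (\<Sum>k\<in>S. j (cyc_pred n k))" if "S \<in> \<pi>" for S
    proof -
      have "j0 j k - j0 j (k - 1) = int (j k) - int (j (cyc_pred n k))" if "k \<in> S" for k
      proof -
        have "k \<ge> 1"
          using partition_block_finite(3)[OF \<pi> \<open>S \<in> \<pi>\<close>] that by auto
        then show ?thesis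
          using \<open>j n = h\<close> by (auto simp: j0_def cyc_pred_def)
      qed
      then show ?thesis
        by (simp add: sum_subtractf)
    qed
    then show ?thesis
      by (simp add: balanced_def del: of_nat_sum)
  qed
  have s_steps: "s (steps \<pi> h j) p = j0 j p" if j: "j \<in> L" and "p \<le> n" for j p
    using that(2)
  proof (induction p)
    case 0
    then show ?case
      by (simp add: s_ends j0_def)
  next
    case (Suc p)
    then have p: "Suc p \<in> {1..n}"
      by simp
    have "s (steps \<pi> h j) (Suc p) - s (steps \<pi> h j) p = j0 j (Suc p) - j0 j p"
    proof (cases "Suc p \<in> J_part \<pi>")
      case True
      then show ?thesis
        using s_inc[OF p, of "steps \<pi> h j"] steps_j0[OF True, of j] by simp
    next
      case False
      define S where "S = block_of \<pi> (Suc p)"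
      note S = block_of_in[OF \<pi> p, folded S_def]
      have fin: "finite S"
        by (rule partition_block_finite(1)[OF \<pi> S(1)])
      have "k \<in> J_part \<pi>" if "k \<in> S - {Suc p}" for k
        using block_not_J[OF \<pi> S(1)] S(2) False that by auto
      then have "(\<Sum>k\<in>S - {Suc p}. steps \<pi> h j k) = (\<Sum>k\<in>S - {Suc p}. j0 j k - j0 j (k - 1))"
        by (intro sum.cong refl steps_j0)
      moreover have "(\<Sum>k\<in>S. j0 j k - j0 j (k - 1)) = 0"
        using j bal[of j] S(1) by (simp add: L_def)
      ultimately show ?thesis
        using s_inc[OF p, of "steps \<pi> h j"] False fin S(2)
        by (simp add: S_def[symmetric] sum.remove[of S "Suc p"])
    qed
    then show ?case
      using Suc by simp
  qed
  have j0_range: "j0 j p \<in> {1..int N}" if "j \<in> L" "p \<le> n" for j p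
  proof (cases "p = 0")
    case True
    then show ?thesis
      using h by (simp add: j0_def)
  next
    case False
    then have "j p \<in> {1..N}"
      using that by (auto simp: L_def dest: PiE_mem)
    then show ?thesis
      using False by (simp add: j0_def)
  qed
  have "bij_betw (walk n \<pi> h) (lattice_E n \<pi> N h) L"
  proof (rule bij_betw_byWitness[where f' = "steps \<pi> h"])
    show "\<forall>y\<in>lattice_E n \<pi> N h. steps \<pi> h (walk n \<pi> h y) = y"
    proof (intro ballI ext)
      fix y k assume y: "y \<in> lattice_E n \<pi> N h"
      show "steps \<pi> h (walk n \<pi> h y) k = y k"
      proof (cases "k \<in> J_part \<pi>")
        case True
        then have k: "k \<in> {1..n}" "k \<le> n" "k - 1 \<le> n"
          using subsetD[OF J_n True] by auto
        show ?thesis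
          using steps_j0[OF True, of "walk n \<pi> h y"] j0_walk[OF y k(2)] j0_walk[OF y k(3)]
            s_inc[OF k(1), of y] True by simp
      next
        case False
        have "y \<in> J_part \<pi> \<rightarrow>\<^sub>E UNIV"
          using y unfolding lattice_E_def by blast
        from PiE_arb[OF this False] show ?thesis
          using False by (simp add: steps_def)
      qed
    qed
    show "\<forall>j\<in>L. walk n \<pi> h (steps \<pi> h j) = j"
    proof (intro ballI ext)
      fix j p assume j: "j \<in> L"
      show "walk n \<pi> h (steps \<pi> h j) p = j p"
      proof (cases "p \<in> {1..n}")
        case True
        then show ?thesis
          using s_steps[OF j, of p] by (simp add: walk_def s_def j0_def)
      next
        case False
        have "j \<in> tuples n N"
          using j unfolding L_def by blast
        from PiE_arb[OF this False] show ?thesis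
          using False unfolding walk_def restrict_def by (simp only: if_False)
      qed
    qed
    show "walk n \<pi> h ` lattice_E n \<pi> N h \<subseteq> L"
    proof (rule image_subsetI)
      fix y assume y: "y \<in> lattice_E n \<pi> N h"
      define j where "j = walk n \<pi> h y"
      have "j \<in> tuples n N"
      proof (rule PiE_I)
        fix p assume "p \<in> {1..n}"
        then show "j p \<in> {1..N}"
          using walk_s[OF y, of p] s_range[OF y, of p] by (simp add: j_def)
      next
        fix p assume "p \<notin> {1..n}"
        then show "j p = undefined"
          unfolding j_def walk_def restrict_def by (simp only: if_False)
      qed
      moreover have jn: "j n = h"
        using walk_s[OF y, of n] s_ends(2) n by (simp add: j_def)
      moreover have "(\<Sum>k\<in>S. j0 j k - j0 j (k - 1)) = 0" if S: "S \<in> \<pi>" for S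
      proof -
        define m where "m = Max S"
        have m: "m \<in> S"
          using partition_Max_in[OF \<pi> S] by (simp add: m_def)
        have sub: "k \<in> {1..n}" if "k \<in> S" for k
          using partition_block_finite(3)[OF \<pi> S] that by blast
        have inc: "j0 j k - j0 j (k - 1) = s y k - s y (k - 1)" if "k \<in> S" for k
        proof -
          have "k \<le> n" "k - 1 \<le> n"
            using sub[OF that] by auto
          then show ?thesis
            unfolding j_def by (simp only: j0_walk[OF y])
        qed
        have J: "k \<in> J_part \<pi>" if "k \<in> S - {m}" for k
          using block_not_J[OF \<pi> S] that by (auto simp: m_def)
        have "m \<notin> J_part \<pi>"
          using J_part_iff[OF \<pi> sub[OF m]] block_of_eq[OF \<pi> S m] by (simp add: m_def)
        then have "s y m - s y (m - 1) = - (\<Sum>k\<in>S - {m}. y k)"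
          using s_inc[OF sub[OF m], of y] block_of_eq[OF \<pi> S m] by simp
        moreover have "(\<Sum>k\<in>S - {m}. s y k - s y (k - 1)) = (\<Sum>k\<in>S - {m}. y k)"
          using s_inc sub J by (intro sum.cong refl) auto
        ultimately have "(\<Sum>k\<in>S. s y k - s y (k - 1)) = 0"
          using sum.remove[OF partition_block_finite(1)[OF \<pi> S] m, of "\<lambda>k. s y k - s y (k - 1)"] by simp
        then show ?thesis
          using inc by simp
      qed
      ultimately show "walk n \<pi> h y \<in> L"
        using bal[of j] by (simp add: L_def j_def)
    qed
    show "steps \<pi> h ` L \<subseteq> lattice_E n \<pi> N h"
    proof (rule image_subsetI)
      fix j assume j: "j \<in> L"
      have "1 \<le> s (steps \<pi> h j) p \<and> s (steps \<pi> h j) p \<le> int N" if "p \<in> {1..n - 1}" for p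
        using s_steps[OF j, of p] j0_range[OF j, of p] that by auto
      then show "steps \<pi> h j \<in> lattice_E n \<pi> N h"
        by (auto simp: lattice_E_def s_def steps_def)
    qed
  qed
  then show ?thesis
    unfolding L_def .
qed

lemma Lambda_disc_lattice:
  assumes \<pi>: "partition_on {1..n} \<pi>" and n: "n \<ge> 1" and h: "h \<in> {1..N}"
  shows "finite (lattice_E n \<pi> N h)"
    "Lambda_disc N n \<pi> f h = (\<Sum>y\<in>lattice_E n \<pi> N h. \<Prod>p=1..n - 1.
       f p (real_of_int (int h + (\<Sum>k\<in>I_part \<pi> p. y k)) / real N)) / of_nat N ^ card (J_part \<pi>)"
proof -
  note bij = bij_betw_walk[OF assms]
  have "finite {j \<in> tuples n N. balanced n \<pi> j \<and> j n = h}"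
    by (rule finite_subset[of _ "tuples n N"]) (auto intro: finite_PiE)
  then show "finite (lattice_E n \<pi> N h)"
    using bij_betw_finite[OF bij] by simp
  have "(\<Sum>j | j \<in> tuples n N \<and> balanced n \<pi> j \<and> j n = h. \<Prod>p=1..n - 1. f p (real (j p) / real N)) =
      (\<Sum>y\<in>lattice_E n \<pi> N h. \<Prod>p=1..n - 1. f p (real (walk n \<pi> h y p) / real N))"
    by (rule sum.reindex_bij_betw[OF bij, symmetric])
  also have "\<dots> = (\<Sum>y\<in>lattice_E n \<pi> N h. \<Prod>p=1..n - 1.
       f p (real_of_int (int h + (\<Sum>k\<in>I_part \<pi> p. y k)) / real N))"
  proof (intro sum.cong prod.cong refl)
    fix y p assume "y \<in> lattice_E n \<pi> N h" "p \<in> {1..n - 1}"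
    then have "1 \<le> int h + (\<Sum>k\<in>I_part \<pi> p. y k)" "p \<in> {1..n}"
      unfolding lattice_E_def by auto
    then have "int (walk n \<pi> h y p) = int h + (\<Sum>k\<in>I_part \<pi> p. y k)"
      by (simp add: walk_def)
    then show "f p (real (walk n \<pi> h y p) / real N) = f p (real_of_int (int h + (\<Sum>k\<in>I_part \<pi> p. y k)) / real N)"
      by (metis of_int_of_nat_eq)
  qed
  finally show "Lambda_disc N n \<pi> f h = (\<Sum>y\<in>lattice_E n \<pi> N h. \<Prod>p=1..n - 1.
       f p (real_of_int (int h + (\<Sum>k\<in>I_part \<pi> p. y k)) / real N)) / of_nat N ^ card (J_part \<pi>)"
    by (simp only: Lambda_disc_def)
qed

definition equicts :: "nat \<Rightarrow> (nat \<Rightarrow> real \<Rightarrow> complex) set \<Rightarrow> bool" where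
  "equicts m S \<longleftrightarrow>
     (\<exists>K. \<forall>f\<in>S. \<forall>j\<in>{1..m}. \<forall>s\<in>{0..1}. norm (f j s) \<le> K) \<and>
     (\<forall>e>0. \<exists>d>0. \<forall>f\<in>S. \<forall>j\<in>{1..m}. \<forall>s\<in>{0..1}. \<forall>u\<in>{0..1}.
        \<bar>s - u\<bar> < d \<longrightarrow> norm (f j s - f j u) < e)"

lemma equicts_bound:
  assumes "equicts m S"
  obtains K where "K \<ge> 1" "\<And>f j s. f \<in> S \<Longrightarrow> j \<in> {1..m} \<Longrightarrow> s \<in> {0..1} \<Longrightarrow> norm (f j s) \<le> K"
proof -
  obtain K where K: "\<forall>f\<in>S. \<forall>j\<in>{1..m}. \<forall>s\<in>{0..1}. norm (f j s) \<le> K"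
    using assms unfolding equicts_def by blast
  show ?thesis
    by (rule that[of "max 1 K"]) (use K in \<open>auto simp: le_max_iff_disj\<close>)
qed

lemma equicts_modulus:
  assumes "equicts m S" "e > 0"
  obtains d where "d > 0" "\<And>f j s u. f \<in> S \<Longrightarrow> j \<in> {1..m} \<Longrightarrow> s \<in> {0..1} \<Longrightarrow> u \<in> {0..1} \<Longrightarrow>
    \<bar>s - u\<bar> < d \<Longrightarrow> norm (f j s - f j u) < e"
  using assms unfolding equicts_def by meson

lemma equicts_continuous:
  assumes "equicts m S" "f \<in> S" "j \<in> {1..m}"
  shows "continuous_on {0..1} (f j)"
  unfolding continuous_on_iff
proof (intro ballI allI impI)
  fix s e :: real assume s: "s \<in> {0..1}" and e: "e > 0"
  obtain d where d: "d > 0" "\<And>f j s u. f \<in> S \<Longrightarrow> j \<in> {1..m} \<Longrightarrow> s \<in> {0..1} \<Longrightarrow> u \<in> {0..1} \<Longrightarrow>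
    \<bar>s - u\<bar> < d \<Longrightarrow> norm (f j s - f j u) < e"
    using equicts_modulus[OF assms(1) e] by blast
  show "\<exists>d>0. \<forall>u\<in>{0..1}. dist u s < d \<longrightarrow> dist (f j u) (f j s) < e"
  proof (intro exI[of _ d] conjI ballI impI)
    fix u assume "u \<in> {0..1}" "dist u s < d"
    then show "dist (f j u) (f j s) < e"
      using d(2)[OF assms(2,3), of u s] s by (simp add: dist_norm)
  qed (rule d(1))
qed

abbreviation sample_close ::
    "nat \<Rightarrow> 'f set \<Rightarrow> ('f \<Rightarrow> nat \<Rightarrow> complex) \<Rightarrow> ('f \<Rightarrow> real \<Rightarrow> complex) \<Rightarrow> real \<Rightarrow> bool" where
  "sample_close N S b l e \<equiv> \<forall>f\<in>S. \<forall>t\<in>{0..1}. norm (b f (sample_index N t) - l f t) < e"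

text \<open>The index \<open>h\<close> of \<open>a N f h\<close> is the grid position
  \<open>sample_index N t\<close> of the point \<open>t\<close>. The limit is uniform in the family
  and in \<open>t\<close>; boundedness of the limit is included so that products of such limits are
  again of this kind.\<close>

definition sampled_limit ::
    "'f set \<Rightarrow> (nat \<Rightarrow> 'f \<Rightarrow> nat \<Rightarrow> complex) \<Rightarrow> ('f \<Rightarrow> real \<Rightarrow> complex) \<Rightarrow> bool" where
  "sampled_limit S a l \<longleftrightarrow>
     bounded ((\<lambda>x. l (fst x) (snd x)) ` (S \<times> {0..1})) \<and>
     uniform_limit (S \<times> {0..1}) (\<lambda>N x. a N (fst x) (sample_index N (snd x)))
       (\<lambda>x. l (fst x) (snd x)) sequentially"

lemma sampled_limitD:
  assumes "sampled_limit S a l" "e > 0"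
  shows "\<forall>\<^sub>F N in sequentially. sample_close N S (a N) l e"
proof -
  have "\<forall>\<^sub>F N in sequentially. \<forall>x\<in>S \<times> {0..1}. dist (a N (fst x) (sample_index N (snd x))) (l (fst x) (snd x)) < e"
    using assms unfolding sampled_limit_def uniform_limit_iff by blast
  then show ?thesis
    by eventually_elim (auto simp: dist_norm)
qed

lemma sampled_limit_bound:
  assumes "sampled_limit S a l"
  obtains B where "B > 0" "\<And>f t. f \<in> S \<Longrightarrow> t \<in> {0..1} \<Longrightarrow> norm (l f t) \<le> B"
proof -
  obtain B where "B > 0" "\<forall>y\<in>(\<lambda>x. l (fst x) (snd x)) ` (S \<times> {0..1}). norm y \<le> B"
    using assms unfolding sampled_limit_def bounded_pos by blast
  then show ?thesis
    by (intro that[of B]) auto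
qed

lemma sampled_limitI:
  assumes "\<And>f t. f \<in> S \<Longrightarrow> t \<in> {0..1} \<Longrightarrow> norm (l f t) \<le> B"
    and "\<And>e. e > 0 \<Longrightarrow>
      \<forall>\<^sub>F N in sequentially. sample_close N S (a N) l e"
  shows "sampled_limit S a l"
proof -
  have "uniform_limit (S \<times> {0..1}) (\<lambda>N x. a N (fst x) (sample_index N (snd x)))
       (\<lambda>x. l (fst x) (snd x)) sequentially"
  proof (rule uniform_limitI)
    fix e :: real assume "e > 0"
    from assms(2)[OF this]
    show "\<forall>\<^sub>F N in sequentially. \<forall>x\<in>S \<times> {0..1}. dist (a N (fst x) (sample_index N (snd x))) (l (fst x) (snd x)) < e"
      by eventually_elim (auto simp: dist_norm)
  qed
  moreover have "bounded ((\<lambda>x. l (fst x) (snd x)) ` (S \<times> {0..1}))"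
    by (rule boundedI[of _ B]) (use assms(1) in auto)
  ultimately show ?thesis
    by (simp add: sampled_limit_def)
qed

lemma sampled_limit_mult:
  assumes "sampled_limit S a l" "sampled_limit S b m"
  shows "sampled_limit S (\<lambda>N f h. a N f h * b N f h) (\<lambda>f t. l f t * m f t)"
proof -
  obtain B C where BC: "B > 0" "\<And>f t. f \<in> S \<Longrightarrow> t \<in> {0..1} \<Longrightarrow> norm (l f t) \<le> B"
    "C > 0" "\<And>f t. f \<in> S \<Longrightarrow> t \<in> {0..1} \<Longrightarrow> norm (m f t) \<le> C"
    using sampled_limit_bound[OF assms(1)] sampled_limit_bound[OF assms(2)] by metis
  have "norm (l f t * m f t) \<le> B * C" if "f \<in> S" "t \<in> {0..1}" for f t
    unfolding norm_mult using BC that by (intro mult_mono) auto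
  then have "bounded ((\<lambda>x. l (fst x) (snd x) * m (fst x) (snd x)) ` (S \<times> {0..1}))"
    by (intro boundedI[of _ "B * C"]) auto
  moreover have "uniform_limit (S \<times> {0..1})
      (\<lambda>N x. a N (fst x) (sample_index N (snd x)) * b N (fst x) (sample_index N (snd x)))
      (\<lambda>x. l (fst x) (snd x) * m (fst x) (snd x)) sequentially"
    using assms unfolding sampled_limit_def by (intro uniform_lim_mult) auto
  ultimately show ?thesis
    by (simp add: sampled_limit_def)
qed

lemma sampled_limit_add:
  assumes "sampled_limit S a l" "sampled_limit S b m"
  shows "sampled_limit S (\<lambda>N f h. a N f h + b N f h) (\<lambda>f t. l f t + m f t)"
  using assms unfolding sampled_limit_def by (auto intro!: uniform_limit_add bounded_plus_comp)

lemma sampled_limit_const: "sampled_limit S (\<lambda>N f h. c) (\<lambda>f t. c)"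
  by (rule sampled_limitI[where B = "norm c"]) auto

lemma sampled_limit_sum:
  assumes "finite I" "\<And>i. i \<in> I \<Longrightarrow> sampled_limit S (a i) (l i)"
  shows "sampled_limit S (\<lambda>N f h. \<Sum>i\<in>I. a i N f h) (\<lambda>f t. \<Sum>i\<in>I. l i f t)"
  using assms by (induction I) (auto intro: sampled_limit_const sampled_limit_add)

lemma sampled_limit_prod:
  assumes "finite I" "\<And>i. i \<in> I \<Longrightarrow> sampled_limit S (a i) (l i)"
  shows "sampled_limit S (\<lambda>N f h. \<Prod>i\<in>I. a i N f h) (\<lambda>f t. \<Prod>i\<in>I. l i f t)"
  using assms by (induction I) (auto intro: sampled_limit_const sampled_limit_mult)

lemma sampled_limit_compose:
  assumes "sampled_limit S a l" "\<phi> ` R \<subseteq> S"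
  shows "sampled_limit R (\<lambda>N f. a N (\<phi> f)) (\<lambda>f. l (\<phi> f))"
proof -
  obtain B where "B > 0" "\<And>f t. f \<in> S \<Longrightarrow> t \<in> {0..1} \<Longrightarrow> norm (l f t) \<le> B"
    using sampled_limit_bound[OF assms(1)] by blast
  then show ?thesis
  proof (intro sampled_limitI[where B = B])
    fix e :: real assume "e > 0"
    from sampled_limitD[OF assms(1) this]
    show "\<forall>\<^sub>F N in sequentially. \<forall>f\<in>R. \<forall>t\<in>{0..1}. norm (a N (\<phi> f) (sample_index N t) - l (\<phi> f) t) < e"
      by eventually_elim (use assms(2) in blast)
  qed (use assms(2) in blast)
qed

text \<open>Errors of order \<open>1/N\<close> that are uniform in the family and in the position do
  not affect the limit.\<close>

lemma sampled_limit_perturb: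
  assumes "sampled_limit S a l"
    and "\<And>N f h. N \<ge> 1 \<Longrightarrow> f \<in> S \<Longrightarrow> h \<in> {1..N} \<Longrightarrow> norm (b N f h - a N f h) \<le> C / real N"
  shows "sampled_limit S b l"
proof -
  obtain B where B: "B > 0" "\<And>f t. f \<in> S \<Longrightarrow> t \<in> {0..1} \<Longrightarrow> norm (l f t) \<le> B"
    using sampled_limit_bound[OF assms(1)] by blast
  show ?thesis
  proof (rule sampled_limitI[where B = B])
    fix e :: real assume e: "e > 0"
    have "(\<lambda>N. C / real N) \<longlonglongrightarrow> 0"
      by (rule lim_const_over_n)
    then have "\<forall>\<^sub>F N in sequentially. C / real N < e / 2"
      using e by (intro order_tendstoD(2)) auto
    moreover have "\<forall>\<^sub>F N in sequentially. sample_close N S (a N) l (e / 2)"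
      using e by (intro sampled_limitD[OF assms(1)]) auto
    ultimately show "\<forall>\<^sub>F N in sequentially. sample_close N S (b N) l e"
      using eventually_ge_at_top[of 1]
    proof eventually_elim
      case (elim N)
      show ?case
      proof (intro ballI)
        fix f t assume ft: "f \<in> S" "t \<in> {0..1::real}"
        define h where "h = sample_index N t"
        have "norm (b N f h - a N f h) \<le> C / real N"
          using assms(2)[OF elim(3) ft(1) sample_index_props(1)[OF elim(3) ft(2)]] by (simp add: h_def)
        moreover have "norm (a N f h - l f t) < e / 2"
          using elim(2) ft by (simp add: h_def)
        moreover have "norm (b N f h - l f t) \<le> norm (b N f h - a N f h) + norm (a N f h - l f t)"
          by (rule norm_diff_triangle_le) auto
        ultimately show "norm (b N f (sample_index N t) - l f t) < e"
          using elim(1) unfolding h_def by linarith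
      qed
    qed
  qed (rule B(2))
qed

lemma sampled_limit_eval:
  assumes "equicts m S" "j \<in> {1..m}"
  shows "sampled_limit S (\<lambda>N f h. f j (real h / real N)) (\<lambda>f. f j)"
proof -
  obtain K where K: "K \<ge> 1" "\<And>f j s. f \<in> S \<Longrightarrow> j \<in> {1..m} \<Longrightarrow> s \<in> {0..1} \<Longrightarrow> norm (f j s) \<le> K"
    using equicts_bound[OF assms(1)] by blast
  show ?thesis
  proof (rule sampled_limitI[where B = K])
    fix e :: real assume e: "e > 0"
    obtain d where d: "d > 0" "\<And>f j s u. f \<in> S \<Longrightarrow> j \<in> {1..m} \<Longrightarrow> s \<in> {0..1} \<Longrightarrow> u \<in> {0..1} \<Longrightarrow>
      \<bar>s - u\<bar> < d \<Longrightarrow> norm (f j s - f j u) < e"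
      using equicts_modulus[OF assms(1) e] by blast
    have "(\<lambda>N. 1 / real N) \<longlonglongrightarrow> 0"
      by (rule lim_const_over_n)
    then have "\<forall>\<^sub>F N in sequentially. 1 / real N < d"
      using d by (intro order_tendstoD(2)) auto
    then show "\<forall>\<^sub>F N in sequentially. \<forall>f\<in>S. \<forall>t\<in>{0..1}. norm (f j (real (sample_index N t) / real N) - f j t) < e"
      using eventually_ge_at_top[of 1]
    proof eventually_elim
      case (elim N)
      show ?case
      proof (intro ballI)
        fix f t assume ft: "f \<in> S" "t \<in> {0..1::real}"
        note h = sample_index_props[OF elim(2) ft(2)]
        show "norm (f j (real (sample_index N t) / real N) - f j t) < e"
        proof (rule d(2)[OF ft(1) assms(2) _ ft(2)])
          show "real (sample_index N t) / real N \<in> {0..1}"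
            using h(1) by auto
          show "\<bar>real (sample_index N t) / real N - t\<bar> < d"
            using h(2,3) elim(1) by linarith
        qed
      qed
    qed
  qed (use K(2) assms(2) in blast)
qed

text \<open>The points with a given grid position form an interval of length \<open>1/N\<close>; the
  first one is closed on the left because it contains 0.\<close>

lemma sample_index_eq_iff:
  assumes "N \<ge> 1" "t \<in> {0..1}" "v \<in> {1..N}"
  shows "sample_index N t = v \<longleftrightarrow> t \<in> (if v = 1 then {0..1 / real N} else {real (v - 1) / real N<..real v / real N})"
proof
  assume v: "sample_index N t = v"
  note h = sample_index_props[OF assms(1,2), unfolded v]
  have "real (v - 1) / real N < t" if "v \<noteq> 1"
  proof -
    have "v - 1 \<in> {1..N}" "v - 1 < sample_index N t"
      using that assms(3) v by auto
    then have "\<not> t \<le> real (v - 1) / real N"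
      using not_less_Least[of "v - 1" "\<lambda>h. h \<in> {1..N} \<and> t \<le> real h / real N"]
      unfolding sample_index_def by blast
    then show ?thesis
      by simp
  qed
  then show "t \<in> (if v = 1 then {0..1 / real N} else {real (v - 1) / real N<..real v / real N})"
    using h assms(2) by auto
next
  assume *: "t \<in> (if v = 1 then {0..1 / real N} else {real (v - 1) / real N<..real v / real N})"
  show "sample_index N t = v"
    unfolding sample_index_def
  proof (rule Least_equality)
    show "v \<in> {1..N} \<and> t \<le> real v / real N"
      using * assms(3) by (auto split: if_splits)
    fix y assume y: "y \<in> {1..N} \<and> t \<le> real y / real N"
    show "v \<le> y"
    proof (rule ccontr)
      assume "\<not> v \<le> y"
      then have "v \<noteq> 1" "real y \<le> real (v - 1)"
        using y by auto
      then have "real (v - 1) / real N < t" "real y / real N \<le> real (v - 1) / real N"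
        using * assms(1) by (auto simp: divide_right_mono)
      then show False
        using y by simp
    qed
  qed
qed

text \<open>An average over grid positions is the integral of the step function obtained by
  sampling, since every position is taken on an interval of length \<open>1/N\<close>.\<close>

lemma avg_eq_integral:
  assumes "N \<ge> 1"
  shows "set_integrable lborel {0..1} (\<lambda>t. a (sample_index N t))"
    "avg N a = (LINT t:{0..1}|lborel. a (sample_index N t))"
proof -
  define cell where "cell v = (if v = 1 then {0..1 / real N} else {real (v - 1) / real N<..real v / real N})" for v
  have cell_sets [measurable]: "cell v \<in> sets borel" for v
    by (simp add: cell_def)
  have cell_meas: "emeasure lborel (cell v) = ennreal (1 / real N)" if "v \<in> {1..N}" for v
  proof (cases "v = 1")
    case False
    then have "real (v - 1) = real v - 1"
      using that by (simp add: of_nat_diff)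
    then have eq: "real v / real N - real (v - 1) / real N = 1 / real N" and le: "real (v - 1) / real N \<le> real v / real N"
      using assms by (simp_all add: divide_right_mono flip: diff_divide_distrib)
    then show ?thesis
      using False emeasure_lborel_Ioc[OF le] unfolding cell_def eq by (simp only: if_False)
  qed (use assms in \<open>simp add: cell_def\<close>)
  have cell_sub: "cell v \<subseteq> {0..1}" if "v \<in> {1..N}" for v
  proof -
    have "real v / real N \<le> 1" "1 / real N \<le> 1"
      using that assms by auto
    moreover have "0 \<le> x" if "real (v - 1) / real N < x" for x
      by (rule order_trans[OF _ less_imp_le[OF that]]) simp
    ultimately show ?thesis
      unfolding cell_def by (auto split: if_splits)
  qed
  have eq: "indicator {0..1} t *\<^sub>R a (sample_index N t) = (\<Sum>v=1..N. indicator (cell v) t *\<^sub>R a v)" for t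
  proof (cases "t \<in> {0..1}")
    case True
    have "(\<Sum>v=1..N. indicator (cell v) t *\<^sub>R a v) = (\<Sum>v=1..N. if v = sample_index N t then a v else 0)"
    proof (intro sum.cong refl)
      fix v assume "v \<in> {1..N}"
      from sample_index_eq_iff[OF assms True this]
      show "indicator (cell v) t *\<^sub>R a v = (if v = sample_index N t then a v else 0)"
        unfolding cell_def[symmetric] by (auto simp: indicator_def)
    qed
    then show ?thesis
      using True sample_index_props(1)[OF assms True] by simp
  next
    case False
    have "(\<Sum>v=1..N. indicator (cell v) t *\<^sub>R a v) = 0"
    proof (intro sum.neutral ballI)
      fix v assume "v \<in> {1..N}"
      then have "t \<notin> cell v"
        using cell_sub False by blast
      then show "indicator (cell v) t *\<^sub>R a v = 0"
        by simp
    qed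
    then show ?thesis
      using False by simp
  qed
  have int: "integrable lborel (\<lambda>t. indicator (cell v) t *\<^sub>R a v)" if "v \<in> {1..N}" for v
    using cell_meas[OF that] by (intro integrable_scaleR_left integrable_real_indicator) auto
  show "set_integrable lborel {0..1} (\<lambda>t. a (sample_index N t))"
    unfolding set_integrable_def eq using int by (intro Bochner_Integration.integrable_sum) auto
  have "(LINT t:{0..1}|lborel. a (sample_index N t)) = (\<Sum>v=1..N. LINT t|lborel. indicator (cell v) t *\<^sub>R a v)"
    unfolding set_lebesgue_integral_def eq using int by (intro Bochner_Integration.integral_sum) auto
  also have "\<dots> = (\<Sum>v=1..N. (1 / real N) *\<^sub>R a v)"
  proof (intro sum.cong refl)
    fix v assume "v \<in> {1..N}"
    from cell_meas[OF this] have "measure lborel (cell v) = 1 / real N" "emeasure lborel (cell v) < \<infinity>"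
      by (simp_all add: measure_def)
    then show "(LINT t|lborel. indicator (cell v) t *\<^sub>R a v) = (1 / real N) *\<^sub>R a v"
      by (subst integral_scaleR_left) auto
  qed
  also have "\<dots> = avg N a"
    by (simp add: avg_def scaleR_conv_of_real sum_divide_distrib)
  finally show "avg N a = (LINT t:{0..1}|lborel. a (sample_index N t))" ..
qed

text \<open>The limit is a pointwise limit of step functions and hence measurable; in this way
  \<open>\<Lambda>\<^sub>\<pi>\<close> becomes integrable in \<open>t\<close> without a continuity
  argument.\<close>

lemma sampled_limit_integrable:
  assumes "sampled_limit S a l" "f \<in> S"
  shows "set_integrable lborel {0..1} (l f)"
proof -
  obtain B where B: "B > 0" "\<And>f t. f \<in> S \<Longrightarrow> t \<in> {0..1} \<Longrightarrow> norm (l f t) \<le> B"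
    using sampled_limit_bound[OF assms(1)] by blast
  have m: "(\<lambda>t. indicator {0..1} t *\<^sub>R l f t) \<in> borel_measurable lborel"
  proof (rule borel_measurable_LIMSEQ_metric)
    fix N :: nat
    show "(\<lambda>t. indicator {0..1} t *\<^sub>R a (Suc N) f (sample_index (Suc N) t)) \<in> borel_measurable lborel"
      using avg_eq_integral(1)[of "Suc N" "a (Suc N) f"] by (simp add: set_integrable_def)
  next
    fix t :: real
    show "(\<lambda>N. indicator {0..1} t *\<^sub>R a (Suc N) f (sample_index (Suc N) t)) \<longlonglongrightarrow> indicator {0..1} t *\<^sub>R l f t"
    proof (cases "t \<in> {0..1}")
      case True
      have "(\<lambda>N. a N f (sample_index N t)) \<longlonglongrightarrow> l f t"
      proof (rule tendstoI)
        fix e :: real assume "e > 0"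
        from sampled_limitD[OF assms(1) this]
        show "\<forall>\<^sub>F N in sequentially. dist (a N f (sample_index N t)) (l f t) < e"
          by eventually_elim (use assms(2) True in \<open>simp add: dist_norm\<close>)
      qed
      then have "(\<lambda>N. a (Suc N) f (sample_index (Suc N) t)) \<longlonglongrightarrow> l f t"
        by (rule LIMSEQ_Suc)
      then show ?thesis
        using True by simp
    qed simp
  qed
  have i: "integrable lborel (\<lambda>t. indicator {0..1::real} t *\<^sub>R B)"
    by (intro integrable_scaleR_left integrable_real_indicator) auto
  show ?thesis
    unfolding set_integrable_def
  proof (rule Bochner_Integration.integrable_bound[OF i m])
    show "AE t in lborel. norm (indicator {0..1} t *\<^sub>R l f t) \<le> norm (indicator {0..1::real} t *\<^sub>R B)"
    proof (rule AE_I2)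
      fix t :: real
      have "norm (l f t) \<le> \<bar>B\<bar>" if "t \<in> {0..1}"
        using B(2)[OF assms(2) that] by simp
      then show "norm (indicator {0..1} t *\<^sub>R l f t) \<le> norm (indicator {0..1::real} t *\<^sub>R B)"
        by (simp add: indicator_def)
    qed
  qed
qed

lemma norm_unit_integral_le:
  fixes F :: "real \<Rightarrow> complex"
  assumes "\<And>t. t \<in> {0..1} \<Longrightarrow> norm (F t) \<le> B" "B \<ge> 0"
  shows "norm (LINT t:{0..1}|lborel. F t) \<le> B"
proof (cases "set_integrable lborel {0..1} F")
  case True
  have int: "integrable lborel (\<lambda>t. indicator {0..1} t *\<^sub>R F t)"
    using True by (simp add: set_integrable_def)
  have "norm (LINT t:{0..1}|lborel. F t) \<le> (LINT t|lborel. norm (indicator {0..1} t *\<^sub>R F t))"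
    unfolding set_lebesgue_integral_def by (rule integral_norm_bound)
  also have "\<dots> \<le> (LINT t|lborel. indicator {0..1::real} t *\<^sub>R B)"
  proof (rule integral_mono)
    show "integrable lborel (\<lambda>t. norm (indicator {0..1} t *\<^sub>R F t))"
      by (rule integrable_norm[OF int])
    show "integrable lborel (\<lambda>t. indicator {0..1::real} t *\<^sub>R B)"
      by (intro integrable_scaleR_left integrable_real_indicator) auto
    show "norm (indicator {0..1} t *\<^sub>R F t) \<le> indicator {0..1::real} t *\<^sub>R B" for t
      using assms by (auto simp: indicator_def)
  qed
  finally show ?thesis
    by simp
next
  case False
  then show ?thesis
    using assms(2) by (simp add: set_lebesgue_integral_def set_integrable_def not_integrable_integral_eq)
qed

text \<open>Averages are integrals of step functions that converge uniformly to the limit, so they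
  converge to its integral.\<close>

lemma sampled_limit_avg:
  assumes "sampled_limit S a l"
  shows "sampled_limit S (\<lambda>N f h. avg N (a N f)) (\<lambda>f t. tau (l f))"
proof -
  obtain B where B: "B > 0" "\<And>f t. f \<in> S \<Longrightarrow> t \<in> {0..1} \<Longrightarrow> norm (l f t) \<le> B"
    using sampled_limit_bound[OF assms(1)] by blast
  show ?thesis
  proof (rule sampled_limitI[where B = B])
    fix e :: real assume "e > 0"
    then have "\<forall>\<^sub>F N in sequentially. sample_close N S (a N) l (e / 2)"
      by (intro sampled_limitD[OF assms]) auto
    then show "\<forall>\<^sub>F N in sequentially. \<forall>f\<in>S. \<forall>t::real\<in>{0..1}. norm (avg N (a N f) - tau (l f)) < e"
      using eventually_ge_at_top[of 1]
    proof eventually_elim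
      case (elim N)
      show ?case
      proof (intro ballI)
        fix f and t :: real assume f: "f \<in> S"
        have "avg N (a N f) - tau (l f) = (LINT t:{0..1}|lborel. a N f (sample_index N t) - l f t)"
          unfolding tau_def avg_eq_integral(2)[OF elim(2)]
          by (rule set_integral_diff(2)[symmetric]) (intro avg_eq_integral(1)[OF elim(2)] sampled_limit_integrable[OF assms f])+
        also have "norm \<dots> \<le> e / 2"
          by (rule norm_unit_integral_le) (use elim f \<open>e > 0\<close> in \<open>auto intro: less_imp_le\<close>)
        finally show "norm (avg N (a N f) - tau (l f)) < e"
          using \<open>e > 0\<close> by simp
      qed
    qed
  next
    fix f and t :: real assume "f \<in> S"
    then show "norm (tau (l f)) \<le> B"
      unfolding tau_def using B by (intro norm_unit_integral_le) auto
  qed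
qed

section \<open>The factor indexed by labellings of the blocks\<close>

lemma partition_prod:
  assumes "partition_on {1..n::nat} \<pi>"
  shows "(\<Prod>k=1..n. F k) = (\<Prod>T\<in>\<pi>. \<Prod>k\<in>T. F k :: complex)"
proof -
  have "(\<Prod>k\<in>\<Union>\<pi>. F k) = (\<Prod>T\<in>\<pi>. \<Prod>k\<in>T. F k)"
    using partition_block_finite(1)[OF assms] partition_block_unique[OF assms]
    by (subst prod.Union_disjoint) auto
  then show ?thesis
    by (simp only: partition_onD1[OF assms, symmetric])
qed

definition block_fun :: "nat \<Rightarrow> nat set set \<Rightarrow> (nat set \<Rightarrow> nat) \<Rightarrow> nat \<Rightarrow> nat" where
  "block_fun n \<pi> \<phi> = (\<lambda>k\<in>{1..n}. \<phi> (block_of \<pi> k))"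

lemma ker_part_block_fun:
  assumes \<pi>: "partition_on {1..n} \<pi>" and inj: "inj_on \<phi> \<pi>"
  shows "ker_part n (block_fun n \<pi> \<phi>) = \<pi>"
proof -
  have cell: "{k \<in> {1..n}. block_fun n \<pi> \<phi> k = \<phi> T} = T" if T: "T \<in> \<pi>" for T
  proof (intro equalityI subsetI)
    fix k assume "k \<in> {k \<in> {1..n}. block_fun n \<pi> \<phi> k = \<phi> T}"
    then have k: "k \<in> {1..n}" "\<phi> (block_of \<pi> k) = \<phi> T"
      by (auto simp: block_fun_def)
    then have "block_of \<pi> k = T"
      using inj_onD[OF inj k(2) block_of_in(1)[OF \<pi> k(1)] T] by simp
    then show "k \<in> T"
      using block_of_in(2)[OF \<pi> k(1)] by simp
  next
    fix k assume k: "k \<in> T"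
    then have "k \<in> {1..n}"
      using partition_block_finite(3)[OF \<pi> T] by blast
    then show "k \<in> {k \<in> {1..n}. block_fun n \<pi> \<phi> k = \<phi> T}"
      using block_of_eq[OF \<pi> T k] by (simp add: block_fun_def)
  qed
  have img: "block_fun n \<pi> \<phi> ` {1..n} = \<phi> ` \<pi>"
  proof (intro equalityI subsetI)
    fix v assume "v \<in> block_fun n \<pi> \<phi> ` {1..n}"
    then obtain k where k: "k \<in> {1..n}" "v = block_fun n \<pi> \<phi> k"
      by blast
    then show "v \<in> \<phi> ` \<pi>"
      using block_of_in(1)[OF \<pi> k(1)] by (auto simp: block_fun_def)
  next
    fix v assume "v \<in> \<phi> ` \<pi>"
    then obtain T where T: "T \<in> \<pi>" "v = \<phi> T"
      by blast
    have M: "Max T \<in> {1..n}" "Max T \<in> T"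
      using partition_Max_in[OF \<pi> T(1)] partition_block_finite(3)[OF \<pi> T(1)] by auto
    then have "v = block_fun n \<pi> \<phi> (Max T)"
      using block_of_eq[OF \<pi> T(1) M(2)] T(2) by (simp add: block_fun_def)
    then show "v \<in> block_fun n \<pi> \<phi> ` {1..n}"
      using M(1) by blast
  qed
  show ?thesis
    unfolding ker_part_def img using cell by (auto simp: image_image)
qed

text \<open>A tuple with kernel \<open>\<pi>\<close> takes one value on each block and different
  values on different blocks. Prescribing \<open>i 1\<close> prescribes the label of the block of
  1.\<close>

lemma bij_betw_block_fun:
  assumes \<pi>: "partition_on {1..n} \<pi>" and n: "n \<ge> 1" and h: "h \<in> {1..N}"
  shows "bij_betw (block_fun n \<pi>)
    {\<phi> \<in> PiE \<pi> (\<lambda>T. if T = block_of \<pi> 1 then {h} else {1..N}). inj_on \<phi> \<pi>}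
    {i \<in> tuples n N. ker_part n i = \<pi> \<and> i 1 = h}"
proof -
  define A where "A T = (if T = block_of \<pi> 1 then {h} else {1..N})" for T
  define X where "X = {\<phi> \<in> PiE \<pi> A. inj_on \<phi> \<pi>}"
  define Y where "Y = {i \<in> tuples n N. ker_part n i = \<pi> \<and> i 1 = h}"
  have one: "1 \<in> {1..n}"
    using n by simp
  have A_sub: "A T \<subseteq> {1..N}" for T
    using h by (simp add: A_def)
  have M: "Max T \<in> {1..n}" "Max T \<in> T" if "T \<in> \<pi>" for T
    using partition_Max_in[OF \<pi> that] partition_block_finite(3)[OF \<pi> that] by auto
  have ker: "i k = i m" if "ker_part n i = \<pi>" "T \<in> \<pi>" "k \<in> T" "m \<in> T" for i T k m
  proof -
    have "T \<in> ker_part n i"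
      using that by simp
    then obtain v where "T = {k \<in> {1..n}. i k = v}"
      unfolding ker_part_def by blast
    then show ?thesis
      using that(3,4) by simp
  qed
  have "bij_betw (block_fun n \<pi>) X Y"
  proof (rule bij_betw_byWitness[where f' = "\<lambda>i. \<lambda>T\<in>\<pi>. i (Max T)"])
    show "\<forall>\<phi>\<in>X. (\<lambda>T\<in>\<pi>. block_fun n \<pi> \<phi> (Max T)) = \<phi>"
    proof
      fix \<phi> assume "\<phi> \<in> X"
      then have \<phi>: "\<phi> \<in> PiE \<pi> A"
        unfolding X_def by blast
      show "(\<lambda>T\<in>\<pi>. block_fun n \<pi> \<phi> (Max T)) = \<phi>"
      proof
        fix T
        show "(\<lambda>T\<in>\<pi>. block_fun n \<pi> \<phi> (Max T)) T = \<phi> T"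
        proof (cases "T \<in> \<pi>")
          case True
          then show ?thesis
            using M[OF True] block_of_eq[OF \<pi> True M(2)[OF True]] by (simp add: block_fun_def)
        next
          case False
          then show ?thesis
            using PiE_arb[OF \<phi> False] by simp
        qed
      qed
    qed
    show "\<forall>i\<in>Y. block_fun n \<pi> (\<lambda>T\<in>\<pi>. i (Max T)) = i"
    proof
      fix i assume "i \<in> Y"
      then have i: "i \<in> tuples n N" "ker_part n i = \<pi>"
        unfolding Y_def by blast+
      show "block_fun n \<pi> (\<lambda>T\<in>\<pi>. i (Max T)) = i"
      proof
        fix k
        show "block_fun n \<pi> (\<lambda>T\<in>\<pi>. i (Max T)) k = i k"
        proof (cases "k \<in> {1..n}")
          case True
          note b = block_of_in[OF \<pi> True]
          show ?thesis
            using True b(1) ker[OF i(2) b(1) b(2) M(2)[OF b(1)]] by (simp add: block_fun_def)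
        next
          case False
          then show ?thesis
            unfolding block_fun_def restrict_def using PiE_arb[OF i(1) False] by (simp only: if_False)
        qed
      qed
    qed
    show "block_fun n \<pi> ` X \<subseteq> Y"
    proof (rule image_subsetI)
      fix \<phi> assume "\<phi> \<in> X"
      then have \<phi>: "\<phi> \<in> PiE \<pi> A" "inj_on \<phi> \<pi>"
        unfolding X_def by blast+
      have mem: "\<phi> (block_of \<pi> k) \<in> A (block_of \<pi> k)" if "k \<in> {1..n}" for k
        using PiE_mem[OF \<phi>(1) block_of_in(1)[OF \<pi> that]] .
      have "block_fun n \<pi> \<phi> \<in> tuples n N"
        unfolding block_fun_def restrict_PiE_iff using mem A_sub by blast
      moreover have "block_fun n \<pi> \<phi> 1 \<in> A (block_of \<pi> 1)"
        using mem[OF one] one by (simp add: block_fun_def)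
      ultimately show "block_fun n \<pi> \<phi> \<in> Y"
        using ker_part_block_fun[OF \<pi> \<phi>(2)] by (simp add: A_def Y_def)
    qed
    show "(\<lambda>i. \<lambda>T\<in>\<pi>. i (Max T)) ` Y \<subseteq> X"
    proof (rule image_subsetI)
      fix i assume "i \<in> Y"
      then have i: "i \<in> tuples n N" "ker_part n i = \<pi>" "i 1 = h"
        unfolding Y_def by blast+
      have "i (Max T) \<in> A T" if T: "T \<in> \<pi>" for T
      proof (cases "T = block_of \<pi> 1")
        case True
        then show ?thesis
          using ker[OF i(2) T M(2)[OF T], of 1] block_of_in(2)[OF \<pi> one] i(3) by (simp add: A_def)
      next
        case False
        then show ?thesis
          using PiE_mem[OF i(1) M(1)[OF T]] by (simp add: A_def)
      qed
      moreover have "inj_on (\<lambda>T\<in>\<pi>. i (Max T)) \<pi>"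
      proof (rule inj_onI)
        fix T U assume T: "T \<in> \<pi>" and U: "U \<in> \<pi>" and eq: "(\<lambda>T\<in>\<pi>. i (Max T)) T = (\<lambda>T\<in>\<pi>. i (Max T)) U"
        define C where "C = {k \<in> {1..n}. i k = i (Max T)}"
        have "C \<in> \<pi>"
          using M(1)[OF T] unfolding i(2)[symmetric] ker_part_def C_def by blast
        moreover have "Max T \<in> C" "Max U \<in> C"
          using M(1)[OF T] M(1)[OF U] eq T U by (simp_all add: C_def)
        ultimately show "T = U"
          using partition_block_unique[OF \<pi> T, of C "Max T"] partition_block_unique[OF \<pi> U, of C "Max U"] M(2)[OF T] M(2)[OF U]
          by simp
      qed
      ultimately show "(\<lambda>T\<in>\<pi>. i (Max T)) \<in> X"
        by (simp add: X_def)
    qed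
  qed
  then show ?thesis
    unfolding X_def Y_def A_def .
qed

text \<open>If two labels agree, one of the two blocks is different from \<open>S1\<close>, and its
  label is determined by the rest of the labelling. This costs a factor \<open>N\<close>, and there
  are at most \<open>(card P)\<^sup>2\<close> pairs of blocks.\<close>

lemma card_noninjective:
  assumes fin: "finite P" and S1: "S1 \<in> P" and A: "\<And>T. T \<in> P \<Longrightarrow> T \<noteq> S1 \<Longrightarrow> card (A T) = N" "card (A S1) = 1"
    and finA: "\<And>T. T \<in> P \<Longrightarrow> finite (A T)"
  shows "card {\<phi> \<in> PiE P A. \<not> inj_on \<phi> P} * N \<le> (card P)\<^sup>2 * N ^ (card P - 1)"
proof -
  define B where "B T U = {\<phi> \<in> PiE P A. \<phi> T = \<phi> U}" for T U
  define I where "I = (SIGMA T:P - {S1}. P - {T})"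
  have finI: "finite I"
    using fin by (simp add: I_def)
  have finP: "finite (PiE P A)"
    using fin finA by (rule finite_PiE)
  have sub: "{\<phi> \<in> PiE P A. \<not> inj_on \<phi> P} \<subseteq> (\<Union>p\<in>I. B (fst p) (snd p))"
  proof
    fix \<phi> assume "\<phi> \<in> {\<phi> \<in> PiE P A. \<not> inj_on \<phi> P}"
    then obtain T U where TU: "\<phi> \<in> PiE P A" "T \<in> P" "U \<in> P" "T \<noteq> U" "\<phi> T = \<phi> U"
      unfolding inj_on_def by blast
    show "\<phi> \<in> (\<Union>p\<in>I. B (fst p) (snd p))"
    proof (cases "T = S1")
      case True
      then have "(U, T) \<in> I" "\<phi> \<in> B U T"
        using TU by (auto simp: I_def B_def)
      then show ?thesis
        by force
    next
      case False
      then have "(T, U) \<in> I" "\<phi> \<in> B T U"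
        using TU by (auto simp: I_def B_def)
      then show ?thesis
        by force
    qed
  qed
  have cardB: "card (B T U) * N \<le> N ^ (card P - 1)" if "(T, U) \<in> I" for T U
  proof -
    have TU: "T \<in> P" "T \<noteq> S1" "U \<in> P - {T}"
      using that by (auto simp: I_def)
    have "inj_on (\<lambda>\<phi>. restrict \<phi> (P - {T})) (B T U)"
    proof (rule inj_onI)
      fix \<phi> \<psi> assume *: "\<phi> \<in> B T U" "\<psi> \<in> B T U" and eq: "restrict \<phi> (P - {T}) = restrict \<psi> (P - {T})"
      have "\<phi> V = \<psi> V" if "V \<in> P - {T}" for V
        using fun_cong[OF eq, of V] that by simp
      then have "\<phi> V = \<psi> V" if "V \<in> P" for V
        using that TU(3) * by (cases "V = T") (auto simp: B_def)
      then show "\<phi> = \<psi>"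
        using * by (intro PiE_ext[of \<phi> P A \<psi>]) (auto simp: B_def)
    qed
    moreover have "(\<lambda>\<phi>. restrict \<phi> (P - {T})) ` B T U \<subseteq> PiE (P - {T}) A"
    proof (rule image_subsetI)
      fix \<phi> assume "\<phi> \<in> B T U"
      then have "\<phi> V \<in> A V" if "V \<in> P" for V
        using that unfolding B_def by (blast dest: PiE_mem)
      then show "restrict \<phi> (P - {T}) \<in> PiE (P - {T}) A"
        by simp
    qed
    moreover have "finite (PiE (P - {T}) A)"
      using fin finA by (intro finite_PiE) auto
    ultimately have "card (B T U) \<le> card (PiE (P - {T}) A)"
      by (rule card_inj_on_le)
    also have "\<dots> = (\<Prod>V\<in>P - {T}. card (A V))"
      using fin by (intro card_PiE) auto
    finally have "card (B T U) * N \<le> card (A T) * (\<Prod>V\<in>P - {T}. card (A V))"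
      using A(1)[OF TU(1,2)] by simp
    also have "\<dots> = (\<Prod>V\<in>P. card (A V))"
      using fin TU(1) by (rule prod.remove[symmetric])
    also have "\<dots> = card (A S1) * (\<Prod>V\<in>P - {S1}. card (A V))"
      using fin S1 by (rule prod.remove)
    also have "\<dots> = N ^ (card P - 1)"
      using A fin S1 by simp
    finally show ?thesis .
  qed
  have "card {\<phi> \<in> PiE P A. \<not> inj_on \<phi> P} \<le> card (\<Union>p\<in>I. B (fst p) (snd p))"
    by (rule card_mono[OF _ sub]) (use finI finP in \<open>auto simp: B_def\<close>)
  also have "\<dots> \<le> (\<Sum>p\<in>I. card (B (fst p) (snd p)))"
    by (rule card_UN_le[OF finI])
  finally have "card {\<phi> \<in> PiE P A. \<not> inj_on \<phi> P} * N \<le> (\<Sum>p\<in>I. card (B (fst p) (snd p))) * N"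
    by (rule mult_le_mono1)
  also have "\<dots> = (\<Sum>p\<in>I. card (B (fst p) (snd p)) * N)"
    by (rule sum_distrib_right)
  also have "\<dots> \<le> (\<Sum>p\<in>I. N ^ (card P - 1))"
    using cardB by (intro sum_mono) auto
  also have "\<dots> \<le> (card P)\<^sup>2 * N ^ (card P - 1)"
  proof -
    have "card I \<le> card (P \<times> P)"
      by (rule card_mono) (use fin in \<open>auto simp: I_def\<close>)
    then show ?thesis
      by (simp add: power2_eq_square card_cartesian_product mult_le_mono1)
  qed
  finally show ?thesis .
qed

lemma norm_prod_le_power:
  fixes F :: "'i \<Rightarrow> complex"
  assumes "\<And>i. i \<in> I \<Longrightarrow> norm (F i) \<le> K"
  shows "norm (\<Prod>i\<in>I. F i) \<le> K ^ card I"
proof -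
  have "norm (\<Prod>i\<in>I. F i) \<le> (\<Prod>i\<in>I. K)"
    unfolding prod_norm[symmetric] using assms by (intro prod_mono) auto
  then show ?thesis
    by simp
qed

text \<open>Over all labellings with prescribed label \<open>h\<close> of the block of 1 the sum
  factorises into one averaged sum per remaining block and tends to
  \<open>\<Gamma>\<^sub>\<pi>\<close>; the labellings that are not injective contribute
  \<open>O(1/N)\<close>.\<close>

lemma sampled_limit_Gamma:
  assumes S: "equicts n S" and \<pi>: "partition_on {1..n} \<pi>" and n: "n \<ge> 1"
  shows "sampled_limit S (\<lambda>N f. Gamma_disc N n \<pi> f) (Gamma_part \<pi>)"
proof -
  define S1 where "S1 = block_of \<pi> 1"
  have S1: "S1 \<in> \<pi>"
    unfolding S1_def by (rule block_of_in(1)[OF \<pi>]) (use n in auto)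
  have fin: "finite \<pi>"
    by (rule finite_elements[OF _ \<pi>]) simp
  define c where "c N f T v = (\<Prod>k\<in>T. f k (real v / real N))" for N and f :: "nat \<Rightarrow> real \<Rightarrow> complex" and T :: "nat set" and v :: nat
  \<comment> \<open>The normalised sum over all labellings, injective or not.\<close>
  define G where "G N f h = c N f S1 h * (\<Prod>T\<in>\<pi> - {S1}. avg N (c N f T))" for N f h
  obtain K where K: "K \<ge> 1" "\<And>f j s. f \<in> S \<Longrightarrow> j \<in> {1..n} \<Longrightarrow> s \<in> {0..1} \<Longrightarrow> norm (f j s) \<le> K"
    using equicts_bound[OF S] by blast
  have lim_c: "sampled_limit S (\<lambda>N f h. c N f T h) (\<lambda>f t. \<Prod>k\<in>T. f k t)" if T: "T \<in> \<pi>" for T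
    unfolding c_def using partition_block_finite[OF \<pi> T]
    by (intro sampled_limit_prod sampled_limit_eval[OF S]) auto
  have "sampled_limit S (\<lambda>N f h. c N f S1 h * (\<Prod>T\<in>\<pi> - {S1}. avg N (c N f T))) (Gamma_part \<pi>)"
    unfolding Gamma_part_def S1_def[symmetric]
    using fin S1 by (intro sampled_limit_mult sampled_limit_prod sampled_limit_avg lim_c) auto
  then have lim_G: "sampled_limit S G (Gamma_part \<pi>)"
    unfolding G_def .
  show ?thesis
  proof (rule sampled_limit_perturb[OF lim_G, where C = "(real (card \<pi>))\<^sup>2 * K ^ n"])
    fix N f h assume N: "N \<ge> 1" and f: "f \<in> S" and h: "h \<in> {1..N::nat}"
    define A where "A T = (if T = S1 then {h} else {1..N})" for T
    define X where "X = {\<phi> \<in> PiE \<pi> A. inj_on \<phi> \<pi>}"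
    define Y where "Y = {\<phi> \<in> PiE \<pi> A. \<not> inj_on \<phi> \<pi>}"
    have finA: "finite (PiE \<pi> A)"
      using fin by (intro finite_PiE) (auto simp: A_def)
    have A_sub: "A T \<subseteq> {1..N}" for T
      using h by (simp add: A_def)
    have A1: "A S1 = {h}"
      by (simp add: A_def)
    define w where "w \<phi> = (\<Prod>T\<in>\<pi>. c N f T (\<phi> T))" for \<phi>
    have prod_block: "(\<Prod>k=1..n. f k (real (block_fun n \<pi> \<phi> k) / real N)) = w \<phi>" for \<phi>
      unfolding partition_prod[OF \<pi>] w_def c_def
    proof (intro prod.cong refl)
      fix T k assume T: "T \<in> \<pi>" and k: "k \<in> T"
      then have "k \<in> {1..n}"
        using partition_block_finite(3)[OF \<pi> T] by blast
      then show "f k (real (block_fun n \<pi> \<phi> k) / real N) = f k (real (\<phi> T) / real N)"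
        using block_of_eq[OF \<pi> T k] by (simp add: block_fun_def)
    qed
    have "(\<Sum>i | i \<in> tuples n N \<and> ker_part n i = \<pi> \<and> i 1 = h. \<Prod>k=1..n. f k (real (i k) / real N)) = (\<Sum>\<phi>\<in>X. w \<phi>)"
      unfolding prod_block[symmetric] X_def A_def S1_def
      by (rule sum.reindex_bij_betw[OF bij_betw_block_fun[OF \<pi> n h], symmetric])
    then have disc: "Gamma_disc N n \<pi> f h = (\<Sum>\<phi>\<in>X. w \<phi>) / of_nat N ^ (card \<pi> - 1)"
      by (simp only: Gamma_disc_def)
    have "(\<Sum>\<phi>\<in>PiE \<pi> A. w \<phi>) = (\<Prod>T\<in>\<pi>. \<Sum>v\<in>A T. c N f T v)"
      unfolding w_def by (rule prod_sum_PiE[symmetric]) (use fin in \<open>auto simp: A_def\<close>)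
    also have "\<dots> = (\<Sum>v\<in>A S1. c N f S1 v) * (\<Prod>T\<in>\<pi> - {S1}. \<Sum>v\<in>A T. c N f T v)"
      using fin S1 by (rule prod.remove)
    also have "(\<Prod>T\<in>\<pi> - {S1}. \<Sum>v\<in>A T. c N f T v) = (\<Prod>T\<in>\<pi> - {S1}. of_nat N * avg N (c N f T))"
      using N by (intro prod.cong refl) (simp add: A_def avg_def)
    also have "\<dots> = of_nat N ^ (card \<pi> - 1) * (\<Prod>T\<in>\<pi> - {S1}. avg N (c N f T))"
      using fin S1 by (simp add: prod.distrib)
    finally have full: "(\<Sum>\<phi>\<in>PiE \<pi> A. w \<phi>) = of_nat N ^ (card \<pi> - 1) * G N f h"
      by (simp add: G_def A1)
    have split: "(\<Sum>\<phi>\<in>PiE \<pi> A. w \<phi>) = (\<Sum>\<phi>\<in>X. w \<phi>) + (\<Sum>\<phi>\<in>Y. w \<phi>)"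
    proof -
      have "PiE \<pi> A = X \<union> Y" "X \<inter> Y = {}"
        by (auto simp: X_def Y_def)
      moreover have "finite X" "finite Y"
        using finA by (auto simp: X_def Y_def)
      ultimately show ?thesis
        by (simp add: sum.union_disjoint)
    qed
    have X: "(\<Sum>\<phi>\<in>X. w \<phi>) = of_nat N ^ (card \<pi> - 1) * G N f h - (\<Sum>\<phi>\<in>Y. w \<phi>)"
      using full split by (simp add: algebra_simps)
    have "Gamma_disc N n \<pi> f h - G N f h = - (\<Sum>\<phi>\<in>Y. w \<phi>) / of_nat N ^ (card \<pi> - 1)"
      using N unfolding disc X by (simp add: diff_divide_distrib)
    then have "norm (Gamma_disc N n \<pi> f h - G N f h) = norm (\<Sum>\<phi>\<in>Y. w \<phi>) / real N ^ (card \<pi> - 1)"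
      by (simp add: norm_divide norm_power)
    also have "norm (\<Sum>\<phi>\<in>Y. w \<phi>) \<le> (\<Sum>\<phi>\<in>Y. K ^ n)"
    proof (rule sum_norm_le)
      fix \<phi> assume "\<phi> \<in> Y"
      then have "\<phi> \<in> PiE \<pi> A"
        by (simp add: Y_def)
      have "norm (f k (real (block_fun n \<pi> \<phi> k) / real N)) \<le> K" if k: "k \<in> {1..n}" for k
      proof (rule K(2)[OF f k])
        have "\<phi> (block_of \<pi> k) \<in> {1..N}"
          using PiE_mem[OF \<open>\<phi> \<in> PiE \<pi> A\<close> block_of_in(1)[OF \<pi> k]] A_sub by blast
        then show "real (block_fun n \<pi> \<phi> k) / real N \<in> {0..1}"
          using k by (simp add: block_fun_def)
      qed
      then have "norm (w \<phi>) \<le> K ^ card {1..n}"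
        unfolding prod_block[symmetric] by (rule norm_prod_le_power)
      then show "norm (w \<phi>) \<le> K ^ n"
        by simp
    qed
    also have "(\<Sum>\<phi>\<in>Y. K ^ n) = real (card Y) * K ^ n"
      by simp
    also have "real (card Y) \<le> (real (card \<pi>))\<^sup>2 * real N ^ (card \<pi> - 1) / real N"
    proof -
      have "card Y * N \<le> (card \<pi>)\<^sup>2 * N ^ (card \<pi> - 1)"
        unfolding Y_def by (rule card_noninjective[OF fin S1]) (auto simp: A_def)
      then have "real (card Y) * real N \<le> (real (card \<pi>))\<^sup>2 * real N ^ (card \<pi> - 1)"
        by (simp flip: of_nat_mult of_nat_power)
      then show ?thesis
        using N by (simp add: field_simps)
    qed
    finally show "norm (Gamma_disc N n \<pi> f h - G N f h) \<le> (real (card \<pi>))\<^sup>2 * K ^ n / real N"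
      using N K(1) by (simp add: field_simps divide_right_mono mult_right_mono)
  qed
qed

section \<open>Thin slabs in the cube\<close>

interpretation lborel_prod: product_sigma_finite "\<lambda>_::nat. lborel :: real measure"
  by standard

abbreviation leb :: "nat set \<Rightarrow> (nat \<Rightarrow> real) measure" where
  "leb J \<equiv> PiM J (\<lambda>_. lborel)"

lemma emeasure_box:
  assumes "finite J" "\<And>k. k \<in> J \<Longrightarrow> emeasure lborel (B k) = ennreal c" "\<And>k. B k \<in> sets borel" "c \<ge> 0"
  shows "emeasure (leb J) (PiE J B) = ennreal (c ^ card J)"
proof -
  have "emeasure (leb J) (PiE J B) = (\<Prod>k\<in>J. emeasure lborel (B k))"
    by (rule lborel_prod.emeasure_PiM) (use assms in auto)
  also have "\<dots> = (\<Prod>k\<in>J. ennreal c)"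
    using assms(2) by (intro prod.cong refl)
  also have "\<dots> = ennreal (c ^ card J)"
    using assms(4) by (simp add: ennreal_power)
  finally show ?thesis .
qed

lemma sum_measurable_PiM [measurable (raw)]:
  assumes "I \<subseteq> J"
  shows "(\<lambda>x. \<Sum>k\<in>I. x k) \<in> borel_measurable (leb J)"
proof (rule borel_measurable_sum)
  fix k assume "k \<in> I"
  then have "k \<in> J"
    using assms by blast
  then have "(\<lambda>x. x k) \<in> measurable (leb J) lborel"
    by (rule measurable_component_singleton)
  then show "(\<lambda>x. x k) \<in> borel_measurable (leb J)"
    by simp
qed

text \<open>Contains \<open>E(\<pi>, t)\<close>, whose coordinates lie in \<open>[-1,1]\<close>, and
  also the points that rounding, which moves a coordinate by at most 1, takes into it.\<close>

definition cube :: "nat set \<Rightarrow> (nat \<Rightarrow> real) set" where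
  "cube J = PiE J (\<lambda>_. {-2..2})"

definition slab :: "nat set \<Rightarrow> nat set \<Rightarrow> real \<Rightarrow> real \<Rightarrow> (nat \<Rightarrow> real) set" where
  "slab J I a b = {x \<in> cube J. a \<le> (\<Sum>k\<in>I. x k) \<and> (\<Sum>k\<in>I. x k) \<le> b}"

lemma cube_sets [measurable]: "finite J \<Longrightarrow> cube J \<in> sets (leb J)"
  unfolding cube_def by (rule sets_PiM_I_finite) auto

lemma emeasure_cube: "finite J \<Longrightarrow> emeasure (leb J) (cube J) = ennreal (4 ^ card J)"
  unfolding cube_def by (rule emeasure_box) auto

lemma slab_sets:
  assumes "finite J" "I \<subseteq> J"
  shows "slab J I a b \<in> sets (leb J)"
proof -
  note [measurable] = sum_measurable_PiM[OF assms(2)] cube_sets[OF assms(1)]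
  have "slab J I a b = cube J \<inter> {x \<in> space (leb J). a \<le> (\<Sum>k\<in>I. x k) \<and> (\<Sum>k\<in>I. x k) \<le> b}"
    using sets.sets_into_space[OF cube_sets[OF assms(1)]] by (auto simp: slab_def)
  also have "\<dots> \<in> sets (leb J)"
    by measurable
  finally show ?thesis .
qed

text \<open>By Fubini: fixing all coordinates except one in \<open>I\<close>, the slab condition
  confines the remaining coordinate to an interval of length \<open>b - a\<close>.\<close>

lemma emeasure_slab_le:
  assumes "finite J" "I \<subseteq> J" "I \<noteq> {}" "a \<le> b"
  shows "emeasure (leb J) (slab J I a b) \<le> ennreal (4 ^ card J * (b - a))"
proof -
  obtain m where m: "m \<in> I"
    using assms(3) by blast
  define J' where "J' = J - {m}"
  have J: "J = insert m J'" "m \<notin> J'" "finite J'"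
    using m assms by (auto simp: J'_def)
  have finI: "finite I"
    using assms finite_subset by blast
  define c where "c x = (\<Sum>k\<in>I - {m}. x k)" for x :: "nat \<Rightarrow> real"
  have sum_upd: "(\<Sum>k\<in>I. (x(m := y)) k) = y + c x" for x y
  proof -
    have "(\<Sum>k\<in>I. (x(m := y)) k) = (x(m := y)) m + (\<Sum>k\<in>I - {m}. (x(m := y)) k)"
      using finI m by (rule sum.remove)
    also have "(\<Sum>k\<in>I - {m}. (x(m := y)) k) = c x"
      unfolding c_def by (intro sum.cong refl) auto
    finally show ?thesis
      by simp
  qed
  have meas: "(indicator (slab J I a b) :: _ \<Rightarrow> ennreal) \<in> borel_measurable (leb (insert m J'))"
    using slab_sets[OF assms(1,2)] unfolding J(1)[symmetric] by simp
  have "emeasure (leb J) (slab J I a b) = (\<integral>\<^sup>+ x. indicator (slab J I a b) x \<partial>leb J)"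
    by (rule nn_integral_indicator[symmetric]) (rule slab_sets[OF assms(1,2)])
  also have "\<dots> = (\<integral>\<^sup>+ x. (\<integral>\<^sup>+ y. indicator (slab J I a b) (x(m := y)) \<partial>lborel) \<partial>leb J')"
    using lborel_prod.product_nn_integral_insert[OF J(3,2) meas] by (simp only: J(1)[symmetric])
  also have "\<dots> \<le> (\<integral>\<^sup>+ x. ennreal (b - a) * indicator (cube J') x \<partial>leb J')"
  proof (rule nn_integral_mono)
    fix x assume x: "x \<in> space (leb J')"
    have *: "indicator (slab J I a b) (x(m := y)) \<le> (indicator (cube J') x * indicator {a - c x..b - c x} y :: ennreal)" for y
    proof (cases "x(m := y) \<in> slab J I a b")
      case True
      then have cube: "x(m := y) \<in> cube J"
        and *: "a \<le> (\<Sum>k\<in>I. (x(m := y)) k)" "(\<Sum>k\<in>I. (x(m := y)) k) \<le> b"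
        unfolding slab_def by blast+
      from * have "a \<le> y + c x" "y + c x \<le> b"
        by (simp_all only: sum_upd)
      moreover have "x \<in> cube J'"
        unfolding cube_def
      proof (rule PiE_I)
        fix k assume "k \<in> J'"
        then have "k \<noteq> m" "k \<in> J"
          using J by auto
        then show "x k \<in> {-2..2}"
          using PiE_mem[OF cube[unfolded cube_def], of k] by simp
      next
        fix k assume k: "k \<notin> J'"
        have "x \<in> PiE J' (\<lambda>_. UNIV)"
          using x by (simp add: space_PiM)
        then show "x k = undefined"
          using k by (rule PiE_arb)
      qed
      ultimately show ?thesis
        by (simp add: indicator_def)
    qed simp
    have "(\<integral>\<^sup>+ y. indicator (slab J I a b) (x(m := y)) \<partial>lborel) \<le>
        (\<integral>\<^sup>+ y. indicator (cube J') x * indicator {a - c x..b - c x} y \<partial>lborel)"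
      by (rule nn_integral_mono) (rule *)
    also have "\<dots> = indicator (cube J') x * ennreal (b - a)"
      using assms(4) by (subst nn_integral_cmult) auto
    finally show "(\<integral>\<^sup>+ y. indicator (slab J I a b) (x(m := y)) \<partial>lborel) \<le> ennreal (b - a) * indicator (cube J') x"
      by (simp add: mult.commute)
  qed
  also have "\<dots> = ennreal (b - a) * ennreal (4 ^ card J')"
    using cube_sets[OF J(3)] emeasure_cube[OF J(3)] by (subst nn_integral_cmult) auto
  also have "\<dots> \<le> ennreal (4 ^ card J * (b - a))"
  proof -
    have "(b - a) * 4 ^ card J' \<le> (b - a) * 4 ^ card J"
      using assms(4) J by (intro mult_left_mono power_increasing) auto
    then show ?thesis
      using assms(4) by (simp add: ennreal_mult[symmetric] mult.commute ennreal_leI)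
  qed
  finally show ?thesis .
qed

lemma measure_slab_le:
  assumes "finite J" "I \<subseteq> J" "I \<noteq> {}" "a \<le> b"
  shows "integrable (leb J) (indicator (slab J I a b) :: _ \<Rightarrow> real)"
    "measure (leb J) (slab J I a b) \<le> 4 ^ card J * (b - a)"
proof -
  note le = emeasure_slab_le[OF assms]
  then have "emeasure (leb J) (slab J I a b) < \<infinity>"
    by (rule le_less_trans) simp
  then show "integrable (leb J) (indicator (slab J I a b) :: _ \<Rightarrow> real)"
    using slab_sets[OF assms(1,2)] by (intro integrable_real_indicator)
  show "measure (leb J) (slab J I a b) \<le> 4 ^ card J * (b - a)"
    unfolding measure_def using le assms(4) by (intro enn2real_leI) auto
qed

lemma measure_cube:
  assumes "finite J"
  shows "integrable (leb J) (indicator (cube J) :: _ \<Rightarrow> real)"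
    "measure (leb J) (cube J) = 4 ^ card J"
  using cube_sets[OF assms] emeasure_cube[OF assms]
  by (auto intro!: integrable_real_indicator simp: measure_def)

section \<open>The factor indexed by lattice points\<close>

definition site :: "nat set set \<Rightarrow> real \<Rightarrow> (nat \<Rightarrow> real) \<Rightarrow> nat \<Rightarrow> real" where
  "site \<pi> t x p = t + (\<Sum>k\<in>I_part \<pi> p. x k)"

text \<open>The partial sums after rounding every coordinate up to the grid \<open>\<int>/N\<close>
  and replacing \<open>t\<close> by \<open>h/N\<close>.\<close>

definition grid_site :: "nat set set \<Rightarrow> nat \<Rightarrow> nat \<Rightarrow> (nat \<Rightarrow> real) \<Rightarrow> nat \<Rightarrow> real" where
  "grid_site \<pi> N h x p = real_of_int (int h + (\<Sum>k\<in>I_part \<pi> p. \<lceil>real N * x k\<rceil>)) / real N"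

abbreviation admissible :: "nat \<Rightarrow> (nat \<Rightarrow> real) \<Rightarrow> bool" where
  "admissible n s \<equiv> \<forall>p\<in>{1..n - 1}. 0 < s p \<and> s p \<le> 1"

definition grid_integrand ::
    "nat \<Rightarrow> nat set set \<Rightarrow> nat \<Rightarrow> (nat \<Rightarrow> real \<Rightarrow> complex) \<Rightarrow> nat \<Rightarrow> (nat \<Rightarrow> real) \<Rightarrow> complex" where
  "grid_integrand n \<pi> N f h x =
     (if admissible n (grid_site \<pi> N h x)
      then \<Prod>p=1..n - 1. f p (grid_site \<pi> N h x p) else 0)"

definition limit_integrand ::
    "nat \<Rightarrow> nat set set \<Rightarrow> (nat \<Rightarrow> real \<Rightarrow> complex) \<Rightarrow> real \<Rightarrow> (nat \<Rightarrow> real) \<Rightarrow> complex" where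
  "limit_integrand n \<pi> f t x = indicator (E_part n \<pi> t) x *\<^sub>R (\<Prod>p=1..n - 1. f p (site \<pi> t x p))"

text \<open>The points that are rounded up to a given lattice point form a box of measure
  \<open>N\<close> to the power \<open>- card (J_part \<pi>)\<close>, which is the normalisation of
  the sum over lattice points.\<close>

lemma Lambda_disc_integral:
  assumes \<pi>: "partition_on {1..n} \<pi>" and n: "n \<ge> 1" and h: "h \<in> {1..N}"
  shows "integrable (leb (J_part \<pi>)) (grid_integrand n \<pi> N f h)"
    "Lambda_disc N n \<pi> f h = (LINT x|leb (J_part \<pi>). grid_integrand n \<pi> N f h x)"
proof -
  define J where "J = J_part \<pi>"
  define Y where "Y = lattice_E n \<pi> N h"
  have N: "N \<ge> 1"
    using h by auto
  have finJ: "finite J"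
    using finite_J_part[OF \<pi>] by (simp add: J_def)
  have finY: "finite Y"
    unfolding Y_def by (rule Lambda_disc_lattice(1)[OF assms])
  define G where "G y = (\<Prod>p=1..n - 1. f p (real_of_int (int h + (\<Sum>k\<in>I_part \<pi> p. y k)) / real N))" for y :: "nat \<Rightarrow> int"
  define box where "box y = PiE J (\<lambda>k. {(real_of_int (y k) - 1) / real N<..real_of_int (y k) / real N})" for y
  have box_sets: "box y \<in> sets (leb J)" for y
    unfolding box_def using finJ by (intro sets_PiM_I_finite) auto
  have box_meas: "emeasure (leb J) (box y) = ennreal ((1 / real N) ^ card J)" for y
    unfolding box_def
  proof (rule emeasure_box[OF finJ])
    fix k
    have "real_of_int (y k) / real N - (real_of_int (y k) - 1) / real N = 1 / real N"
      by (simp add: diff_divide_distrib)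
    moreover have "(real_of_int (y k) - 1) / real N \<le> real_of_int (y k) / real N"
      by (simp add: divide_right_mono)
    ultimately show "emeasure lborel {(real_of_int (y k) - 1) / real N<..real_of_int (y k) / real N} = ennreal (1 / real N)"
      by (simp only: emeasure_lborel_Ioc)
  qed auto
  define cl where "cl x = (\<lambda>k\<in>J. \<lceil>real N * x k\<rceil>)" for x :: "nat \<Rightarrow> real"
  have cl_box: "x \<in> box y \<longleftrightarrow> cl x = y" if x: "x \<in> PiE J (\<lambda>_. UNIV)" and y: "y \<in> PiE J (\<lambda>_. UNIV)" for x y
  proof -
    have "x k \<in> {(real_of_int (y k) - 1) / real N<..real_of_int (y k) / real N} \<longleftrightarrow> \<lceil>real N * x k\<rceil> = y k" for k
      unfolding ceiling_eq_iff using N by (auto simp: field_simps)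
    then have "x \<in> box y \<longleftrightarrow> (\<forall>k\<in>J. \<lceil>real N * x k\<rceil> = y k)"
      unfolding box_def using x by (simp add: PiE_iff)
    also have "\<dots> \<longleftrightarrow> cl x = y"
    proof
      assume *: "\<forall>k\<in>J. \<lceil>real N * x k\<rceil> = y k"
      show "cl x = y"
        by (rule PiE_ext[OF _ y]) (use * in \<open>auto simp: cl_def\<close>)
    qed (auto simp: cl_def)
    finally show ?thesis .
  qed
  have cl_sum: "(\<Sum>k\<in>I_part \<pi> p. cl x k) = (\<Sum>k\<in>I_part \<pi> p. \<lceil>real N * x k\<rceil>)" if "p \<in> {1..n - 1}" for x p
  proof -
    have "p \<le> n"
      using that by auto
    from I_part_subset_J_part[OF \<pi> this] show ?thesis
      by (intro sum.cong refl) (auto simp: cl_def J_def)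
  qed
  have eq: "grid_integrand n \<pi> N f h x = (\<Sum>y\<in>Y. indicator (box y) x *\<^sub>R G y)" if "x \<in> space (leb J)" for x
  proof -
    have x: "x \<in> PiE J (\<lambda>_. UNIV)"
      using that by (simp add: space_PiM)
    have "(\<Sum>y\<in>Y. indicator (box y) x *\<^sub>R G y) = (\<Sum>y\<in>Y. if cl x = y then G y else 0)"
    proof (intro sum.cong refl)
      fix y assume "y \<in> Y"
      then have "y \<in> PiE J (\<lambda>_. UNIV)"
        unfolding Y_def lattice_E_def J_def by blast
      from cl_box[OF x this] show "indicator (box y) x *\<^sub>R G y = (if cl x = y then G y else 0)"
        by (simp add: indicator_def)
    qed
    also have "\<dots> = (if cl x \<in> Y then G (cl x) else 0)"
      using finY by simp
    also have "cl x \<in> Y \<longleftrightarrow> (admissible n (grid_site \<pi> N h x))"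
    proof -
      have "cl x \<in> Y \<longleftrightarrow> (\<forall>p\<in>{1..n - 1}. 1 \<le> int h + (\<Sum>k\<in>I_part \<pi> p. cl x k) \<and> int h + (\<Sum>k\<in>I_part \<pi> p. cl x k) \<le> int N)"
        unfolding Y_def lattice_E_def by (auto simp: cl_def J_def)
      also have "\<dots> \<longleftrightarrow> (admissible n (grid_site \<pi> N h x))"
      proof (rule ball_cong[OF refl])
        fix p assume p: "p \<in> {1..n - 1}"
        define z where "z = int h + (\<Sum>k\<in>I_part \<pi> p. \<lceil>real N * x k\<rceil>)"
        have "1 \<le> z \<longleftrightarrow> 0 < real_of_int z / real N"
          using N by (simp add: zero_less_divide_iff) linarith
        moreover have "z \<le> int N \<longleftrightarrow> real_of_int z / real N \<le> 1"
          using N by (simp add: divide_le_eq_1) linarith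
        ultimately show "(1 \<le> int h + (\<Sum>k\<in>I_part \<pi> p. cl x k) \<and> int h + (\<Sum>k\<in>I_part \<pi> p. cl x k) \<le> int N) \<longleftrightarrow>
          (0 < grid_site \<pi> N h x p \<and> grid_site \<pi> N h x p \<le> 1)"
          unfolding cl_sum[OF p] grid_site_def z_def[symmetric] by blast
      qed
      finally show ?thesis .
    qed
    also have "G (cl x) = (\<Prod>p=1..n - 1. f p (grid_site \<pi> N h x p))"
      unfolding G_def grid_site_def using cl_sum by (intro prod.cong refl) simp
    finally show ?thesis
      by (simp only: grid_integrand_def)
  qed
  have int: "integrable (leb J) (\<lambda>x. indicator (box y) x *\<^sub>R G y)" for y
    using box_meas box_sets by (intro integrable_scaleR_left integrable_real_indicator) auto
  have "integrable (leb J) (\<lambda>x. \<Sum>y\<in>Y. indicator (box y) x *\<^sub>R G y)"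
    using int by (intro Bochner_Integration.integrable_sum)
  then show "integrable (leb (J_part \<pi>)) (grid_integrand n \<pi> N f h)"
    unfolding J_def[symmetric] by (subst Bochner_Integration.integrable_cong[OF refl eq])
  have "(LINT x|leb J. grid_integrand n \<pi> N f h x) = (LINT x|leb J. (\<Sum>y\<in>Y. indicator (box y) x *\<^sub>R G y))"
    by (rule Bochner_Integration.integral_cong[OF refl eq])
  also have "\<dots> = (\<Sum>y\<in>Y. LINT x|leb J. indicator (box y) x *\<^sub>R G y)"
    using int by (intro Bochner_Integration.integral_sum)
  also have "\<dots> = (\<Sum>y\<in>Y. (1 / real N) ^ card J *\<^sub>R G y)"
  proof (intro sum.cong refl)
    fix y
    have "measure (leb J) (box y) = (1 / real N) ^ card J" "emeasure (leb J) (box y) < \<infinity>"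
      using box_meas[of y] by (simp_all add: measure_def)
    then show "(LINT x|leb J. indicator (box y) x *\<^sub>R G y) = (1 / real N) ^ card J *\<^sub>R G y"
      using box_sets[of y] by (subst integral_scaleR_left) (auto simp: Int_absorb1 dest: sets.sets_into_space)
  qed
  also have "\<dots> = (\<Sum>y\<in>Y. G y) / of_nat N ^ card J"
    by (simp add: scaleR_conv_of_real sum_divide_distrib power_one_over divide_inverse power_inverse sum_distrib_right mult.commute)
  also have "\<dots> = Lambda_disc N n \<pi> f h"
    unfolding Lambda_disc_lattice(2)[OF assms] G_def Y_def J_def ..
  finally show "Lambda_disc N n \<pi> f h = (LINT x|leb (J_part \<pi>). grid_integrand n \<pi> N f h x)"
    unfolding J_def ..
qed

text \<open>If \<open>J_part \<pi>\<close> is empty, the product measure is the point mass on the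
  function that is undefined everywhere, so the integral formula also covers this case.\<close>

lemma Lambda_part_integral:
  assumes \<pi>: "partition_on {1..n} \<pi>" and t: "t \<in> {0..1}"
  shows "Lambda_part n \<pi> f t = (LINT x|leb (J_part \<pi>). limit_integrand n \<pi> f t x)"
proof (cases "J_part \<pi> = {}")
  case True
  have I: "I_part \<pi> p = {}" if "p \<in> {1..n - 1}" for p
  proof -
    have "p \<le> n"
      using that by auto
    from I_part_subset_J_part[OF \<pi> this] True show ?thesis
      by simp
  qed
  have "E_part n \<pi> t = PiE {} (\<lambda>_. UNIV)"
    unfolding E_part_def True using I t by auto
  moreover have "(\<Prod>p=1..n - 1. f p (site \<pi> t x p)) = (\<Prod>p=1..n - 1. f p t)" for x
    using I by (intro prod.cong refl) (simp add: site_def)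
  ultimately have "limit_integrand n \<pi> f t (\<lambda>_. undefined) = (\<Prod>p=1..n - 1. f p t)"
    by (simp add: limit_integrand_def)
  then show ?thesis
    using True by (simp add: Lambda_part_def PiM_empty lebesgue_integral_count_space_finite)
next
  case False
  then show ?thesis
    by (simp add: Lambda_part_def limit_integrand_def set_lebesgue_integral_def site_def)
qed

lemma norm_prod_diff_le:
  fixes z w :: "'i \<Rightarrow> complex"
  assumes "finite I" "K \<ge> 1" "\<And>i. i \<in> I \<Longrightarrow> norm (z i) \<le> K" "\<And>i. i \<in> I \<Longrightarrow> norm (w i) \<le> K"
    "\<And>i. i \<in> I \<Longrightarrow> norm (z i - w i) \<le> e" "e \<ge> 0"
  shows "norm ((\<Prod>i\<in>I. z i) - (\<Prod>i\<in>I. w i)) \<le> real (card I) * K ^ card I * e"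
  using assms(1,3-5)
proof (induction I)
  case empty
  then show ?case
    by simp
next
  case (insert i I)
  have "norm (\<Prod>i\<in>I. w i) \<le> K ^ card I"
    by (rule norm_prod_le_power) (use insert in auto)
  moreover have IH: "norm ((\<Prod>i\<in>I. z i) - (\<Prod>i\<in>I. w i)) \<le> real (card I) * K ^ card I * e"
    by (rule insert.IH) (use insert in auto)
  moreover have "norm (z i) \<le> K" "norm (z i - w i) \<le> e"
    using insert by auto
  ultimately have "norm (z i) * norm ((\<Prod>i\<in>I. z i) - (\<Prod>i\<in>I. w i)) + norm (z i - w i) * norm (\<Prod>i\<in>I. w i) \<le>
      K * (real (card I) * K ^ card I * e) + e * K ^ card I"
    using assms(2,6) by (intro add_mono mult_mono) auto
  also have "\<dots> \<le> K * (real (card I) * K ^ card I * e) + e * (K * K ^ card I)"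
    using assms(2,6) by (intro add_left_mono mult_left_mono) auto
  also have "\<dots> = real (card (insert i I)) * K ^ card (insert i I) * e"
    using insert by (simp add: algebra_simps)
  finally have *: "norm (z i) * norm ((\<Prod>i\<in>I. z i) - (\<Prod>i\<in>I. w i)) + norm (z i - w i) * norm (\<Prod>i\<in>I. w i) \<le> \<dots>" .
  have "(\<Prod>i\<in>insert i I. z i) - (\<Prod>i\<in>insert i I. w i) =
      z i * ((\<Prod>i\<in>I. z i) - (\<Prod>i\<in>I. w i)) + (z i - w i) * (\<Prod>i\<in>I. w i)"
    using insert by (simp add: algebra_simps)
  then show ?case
    using norm_triangle_ineq[of "z i * ((\<Prod>i\<in>I. z i) - (\<Prod>i\<in>I. w i))" "(z i - w i) * (\<Prod>i\<in>I. w i)"] *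
    by (simp add: norm_mult)
qed

text \<open>Each coordinate is the difference of two consecutive partial sums; hence partial sums in
  \<open>[0,1]\<close> bound all coordinates.\<close>

lemma site_increment:
  assumes "partition_on {1..n} \<pi>" "k \<in> J_part \<pi>"
  shows "k \<in> {1..n - 1}" "x k = site \<pi> t x k - site \<pi> t x (k - 1)"
proof -
  have k: "k \<in> {1..n}"
    using assms(2) unfolding J_part_eq[OF assms(1)] by blast
  have "Max (block_of \<pi> k) \<in> {1..n}"
    using partition_Max_in[OF assms(1)] partition_block_finite(3)[OF assms(1)] block_of_in(1)[OF assms(1) k] by blast
  then show "k \<in> {1..n - 1}"
    using J_part_iff[OF assms(1) k] assms(2) k by auto
  show "x k = site \<pi> t x k - site \<pi> t x (k - 1)"
    using I_part_sum_increment[OF assms(1) k, of x] assms(2) by (simp add: site_def)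
qed

lemma grid_site_increment:
  assumes "partition_on {1..n} \<pi>" "k \<in> J_part \<pi>"
  shows "real_of_int \<lceil>real N * x k\<rceil> / real N = grid_site \<pi> N h x k - grid_site \<pi> N h x (k - 1)"
proof -
  have k: "k \<in> {1..n}"
    using assms(2) unfolding J_part_eq[OF assms(1)] by blast
  have "\<lceil>real N * x k\<rceil> = (int h + (\<Sum>k\<in>I_part \<pi> k. \<lceil>real N * x k\<rceil>)) - (int h + (\<Sum>k\<in>I_part \<pi> (k - 1). \<lceil>real N * x k\<rceil>))"
    using I_part_sum_increment[OF assms(1) k, of "\<lambda>k. \<lceil>real N * x k\<rceil>"] assms(2) by simp
  then show ?thesis
    unfolding grid_site_def diff_divide_distrib[symmetric] by (metis of_int_diff)
qed

text \<open>Each of the at most \<open>n - 1\<close> coordinates in a partial sum, and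
  \<open>t\<close> itself, is rounded up by at most \<open>1/N\<close>.\<close>

lemma grid_site_close:
  assumes "p \<in> {1..n - 1}" "N \<ge> 1" "t \<le> real h / real N" "real h / real N \<le> t + 1 / real N"
  shows "site \<pi> t x p \<le> grid_site \<pi> N h x p" "grid_site \<pi> N h x p \<le> site \<pi> t x p + real n / real N"
proof -
  define C where "C = (\<Sum>k\<in>I_part \<pi> p. real_of_int \<lceil>real N * x k\<rceil> / real N)"
  have g: "grid_site \<pi> N h x p = real h / real N + C"
    by (simp add: grid_site_def C_def add_divide_distrib sum_divide_distrib)
  have lo: "x k \<le> real_of_int \<lceil>real N * x k\<rceil> / real N" for k
    using assms(2) by (simp add: pos_le_divide_eq mult.commute)
  have hi: "real_of_int \<lceil>real N * x k\<rceil> / real N \<le> x k + 1 / real N" for k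
  proof -
    have "real_of_int \<lceil>real N * x k\<rceil> \<le> real N * x k + 1"
      by linarith
    then show ?thesis
      using assms(2) by (simp add: field_simps)
  qed
  have "(\<Sum>k\<in>I_part \<pi> p. x k) \<le> C"
    unfolding C_def by (intro sum_mono lo)
  then show "site \<pi> t x p \<le> grid_site \<pi> N h x p"
    using assms(3) by (simp add: g site_def)
  have "C \<le> (\<Sum>k\<in>I_part \<pi> p. x k + 1 / real N)"
    unfolding C_def by (intro sum_mono hi)
  also have "\<dots> = (\<Sum>k\<in>I_part \<pi> p. x k) + real (card (I_part \<pi> p)) / real N"
    by (simp add: sum.distrib)
  finally have C: "C \<le> (\<Sum>k\<in>I_part \<pi> p. x k) + real (card (I_part \<pi> p)) / real N" .
  have "card (I_part \<pi> p) \<le> card {1..p}"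
    by (rule card_mono) (auto simp: I_part_def)
  then have "card (I_part \<pi> p) + 1 \<le> n"
    using assms(1) by auto
  then have "real (card (I_part \<pi> p)) + 1 \<le> real n"
    by linarith
  then have "(real (card (I_part \<pi> p)) + 1) / real N \<le> real n / real N"
    by (intro divide_right_mono) auto
  then show "grid_site \<pi> N h x p \<le> site \<pi> t x p + real n / real N"
    using C assms(4) by (simp add: g site_def add_divide_distrib)
qed

text \<open>At \<open>t = 0\<close> a partial sum over an empty index set equals 0, which explains
  the closed interval.\<close>

lemma E_part_cube:
  assumes \<pi>: "partition_on {1..n} \<pi>" and t: "t \<in> {0..1}" and x: "x \<in> E_part n \<pi> t"
  shows "p \<in> {1..n - 1} \<Longrightarrow> site \<pi> t x p \<in> {0..1}" "x \<in> cube (J_part \<pi>)"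
proof -
  have site: "site \<pi> t x p \<in> {0..1}" if "p \<in> {1..n - 1}" for p
  proof (cases "t \<noteq> 0 \<or> I_part \<pi> p \<noteq> {}")
    case True
    then have "0 < site \<pi> t x p \<and> site \<pi> t x p \<le> 1"
      using x that unfolding E_part_def site_def by blast
    then show ?thesis
      by simp
  next
    case False
    then show ?thesis
      by (simp add: site_def)
  qed
  then show "p \<in> {1..n - 1} \<Longrightarrow> site \<pi> t x p \<in> {0..1}" .
  have site0: "site \<pi> t x 0 \<in> {0..1}"
    using t by (simp add: site_def I_part_ends[OF \<pi>])
  have "x \<in> PiE (J_part \<pi>) (\<lambda>_. UNIV)"
    using x unfolding E_part_def by blast
  moreover have "x k \<in> {-2..2}" if k: "k \<in> J_part \<pi>" for k
  proof -
    have "k - 1 = 0 \<or> k - 1 \<in> {1..n - 1}"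
      using site_increment(1)[OF \<pi> k] by auto
    then have "site \<pi> t x (k - 1) \<in> {0..1}" "site \<pi> t x k \<in> {0..1}"
      using site site0 site_increment(1)[OF \<pi> k] by auto
    then show ?thesis
      using site_increment(2)[OF \<pi> k, of x t] by auto
  qed
  ultimately show "x \<in> cube (J_part \<pi>)"
    unfolding cube_def PiE_iff by blast
qed

lemma grid_cube:
  assumes \<pi>: "partition_on {1..n} \<pi>" and h: "h \<in> {1..N}" and x: "x \<in> PiE (J_part \<pi>) (\<lambda>_. UNIV)"
    and grid: "admissible n (grid_site \<pi> N h x)"
  shows "x \<in> cube (J_part \<pi>)"
proof -
  have N: "N \<ge> 1"
    using h by auto
  have site0: "0 < grid_site \<pi> N h x 0 \<and> grid_site \<pi> N h x 0 \<le> 1"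
    using h by (simp add: grid_site_def I_part_ends[OF \<pi>])
  have "x k \<in> {-2..2}" if k: "k \<in> J_part \<pi>" for k
  proof -
    define c where "c = real_of_int \<lceil>real N * x k\<rceil> / real N"
    have "k - 1 = 0 \<or> k - 1 \<in> {1..n - 1}"
      using site_increment(1)[OF \<pi> k] by auto
    then have "0 < grid_site \<pi> N h x (k - 1) \<and> grid_site \<pi> N h x (k - 1) \<le> 1"
      "0 < grid_site \<pi> N h x k \<and> grid_site \<pi> N h x k \<le> 1"
      using grid site0 site_increment(1)[OF \<pi> k] by auto
    then have "-1 \<le> c" "c \<le> 1"
      using grid_site_increment[OF \<pi> k, of N x h] by (auto simp: c_def)
    moreover have "x k \<le> c" "c - 1 / real N \<le> x k"
    proof -
      have "real N * x k \<le> real_of_int \<lceil>real N * x k\<rceil>" "real_of_int \<lceil>real N * x k\<rceil> - 1 \<le> real N * x k"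
        by linarith+
      then show "x k \<le> c" "c - 1 / real N \<le> x k"
        using N by (simp_all add: c_def field_simps)
    qed
    moreover have "1 / real N \<le> 1"
      using N by simp
    ultimately show ?thesis
      by simp
  qed
  then show ?thesis
    using x unfolding cube_def PiE_iff by blast
qed

text \<open>If the rounded and the original partial sums are all admissible, the products differ by
  the modulus of continuity. If only one of the two systems is admissible, some partial sum over a
  nonempty index set lies within \<open>n/N\<close> of the boundary of \<open>(0, 1]\<close>, so the
  point lies in one of the slabs; partial sums over an empty index set equal \<open>t\<close> or
  \<open>h/N\<close> and cannot violate the conditions.\<close>

lemma integrand_difference:
  assumes \<pi>: "partition_on {1..n} \<pi>" and t: "t \<in> {0..1}" and N: "N \<ge> 1" and h: "h = sample_index N t"
    and K: "K \<ge> 1" "\<And>p s. p \<in> {1..n - 1} \<Longrightarrow> s \<in> {0..1} \<Longrightarrow> norm (f p s) \<le> K"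
    and d: "\<And>p s u. p \<in> {1..n - 1} \<Longrightarrow> s \<in> {0..1} \<Longrightarrow> u \<in> {0..1} \<Longrightarrow> \<bar>s - u\<bar> < d \<Longrightarrow> norm (f p s - f p u) < e"
    and Nd: "real n / real N < d" and e: "e > 0"
    and x: "x \<in> PiE (J_part \<pi>) (\<lambda>_. UNIV)"
  shows "norm (grid_integrand n \<pi> N f h x - limit_integrand n \<pi> f t x) \<le>
    real n * K ^ n * e * indicator (cube (J_part \<pi>)) x +
    K ^ n * (\<Sum>p | p \<in> {1..n - 1} \<and> I_part \<pi> p \<noteq> {}.
      indicator (slab (J_part \<pi>) (I_part \<pi> p) (- t - real n / real N) (- t)) x +
      indicator (slab (J_part \<pi>) (I_part \<pi> p) (1 - t - real n / real N) (1 - t)) x)"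
    (is "_ \<le> ?A + K ^ n * (\<Sum>p\<in>?P. ?lo p + ?hi p)")
proof -
  define r where "r = real n / real N"
  note hp = sample_index_props[OF N t, folded h]
  have close: "site \<pi> t x p \<le> grid_site \<pi> N h x p" "grid_site \<pi> N h x p \<le> site \<pi> t x p + r"
    if "p \<in> {1..n - 1}" for p
    using grid_site_close[OF that N hp(2,3), of \<pi> x] by (auto simp: r_def)
  define C where "C \<longleftrightarrow> (admissible n (grid_site \<pi> N h x))"
  have grid_eq: "grid_integrand n \<pi> N f h x = (if C then \<Prod>p=1..n - 1. f p (grid_site \<pi> N h x p) else 0)"
    by (simp only: grid_integrand_def C_def)
  have E: "x \<in> E_part n \<pi> t \<longleftrightarrow> (\<forall>p\<in>{1..n - 1}. t \<noteq> 0 \<or> I_part \<pi> p \<noteq> {} \<longrightarrow> 0 < site \<pi> t x p \<and> site \<pi> t x p \<le> 1)"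
    using x unfolding E_part_def site_def by blast
  have finP: "finite ?P"
    by simp
  have A_nonneg: "0 \<le> ?A"
    using K(1) e by simp
  have S_nonneg: "0 \<le> K ^ n * (\<Sum>p\<in>?P. ?lo p + ?hi p)"
    using K(1) by (intro mult_nonneg_nonneg sum_nonneg) auto
  have Kn: "K ^ (n - 1) \<le> K ^ n"
    using K(1) by (intro power_increasing) auto
  have bd_grid: "norm (grid_integrand n \<pi> N f h x) \<le> K ^ n" if C
  proof -
    have "norm (\<Prod>p=1..n - 1. f p (grid_site \<pi> N h x p)) \<le> K ^ card {1..n - 1}"
    proof (rule norm_prod_le_power)
      fix p assume p: "p \<in> {1..n - 1}"
      then have "grid_site \<pi> N h x p \<in> {0..1}"
        using \<open>C\<close> unfolding C_def by fastforce
      with K(2)[OF p] show "norm (f p (grid_site \<pi> N h x p)) \<le> K" .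
    qed
    then show ?thesis
      using that Kn by (simp add: grid_eq)
  qed
  have bd_lim: "norm (limit_integrand n \<pi> f t x) \<le> K ^ n" if xE: "x \<in> E_part n \<pi> t"
  proof -
    have "norm (\<Prod>p=1..n - 1. f p (site \<pi> t x p)) \<le> K ^ card {1..n - 1}"
    proof (rule norm_prod_le_power)
      fix p assume p: "p \<in> {1..n - 1}"
      from K(2)[OF p E_part_cube(1)[OF \<pi> t xE p]] show "norm (f p (site \<pi> t x p)) \<le> K" .
    qed
    then show ?thesis
      using that Kn by (simp add: limit_integrand_def)
  qed
  have one_slab: "K ^ n \<le> K ^ n * (\<Sum>p\<in>?P. ?lo p + ?hi p)" if "p \<in> ?P" "1 \<le> ?lo p + ?hi p" for p
  proof -
    have "1 \<le> ?lo p + ?hi p"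
      by (rule that(2))
    also have "\<dots> \<le> (\<Sum>p\<in>?P. ?lo p + ?hi p)"
      by (rule member_le_sum[OF that(1)]) auto
    finally show ?thesis
      using K(1) by simp
  qed
  consider "C" "x \<in> E_part n \<pi> t" | "C" "x \<notin> E_part n \<pi> t" | "\<not> C" "x \<in> E_part n \<pi> t" | "\<not> C" "x \<notin> E_part n \<pi> t"
    by blast
  then show ?thesis
  proof cases
    case 1
    have cube: "x \<in> cube (J_part \<pi>)"
      by (rule E_part_cube(2)[OF \<pi> t 1(2)])
    have "norm ((\<Prod>p=1..n - 1. f p (grid_site \<pi> N h x p)) - (\<Prod>p=1..n - 1. f p (site \<pi> t x p))) \<le>
        real (card {1..n - 1}) * K ^ card {1..n - 1} * e"
    proof (rule norm_prod_diff_le[OF _ K(1)])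
      fix p assume p: "p \<in> {1..n - 1}"
      have g: "grid_site \<pi> N h x p \<in> {0..1}"
        using 1(1) p unfolding C_def by fastforce
      note s = E_part_cube(1)[OF \<pi> t 1(2) p]
      show "norm (f p (grid_site \<pi> N h x p)) \<le> K" "norm (f p (site \<pi> t x p)) \<le> K"
        using K(2)[OF p] g s by blast+
      have "\<bar>grid_site \<pi> N h x p - site \<pi> t x p\<bar> < d"
        using close[OF p] Nd by (simp add: r_def)
      from d[OF p g s this] show "norm (f p (grid_site \<pi> N h x p) - f p (site \<pi> t x p)) \<le> e"
        by simp
    qed (use e in auto)
    also have "\<dots> \<le> real n * K ^ n * e"
      using K(1) Kn e by (intro mult_right_mono mult_mono) auto
    finally have "norm (grid_integrand n \<pi> N f h x - limit_integrand n \<pi> f t x) \<le> ?A"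
      using 1 cube by (simp add: grid_eq limit_integrand_def)
    then show ?thesis
      using S_nonneg by linarith
  next
    case 2
    then obtain p where p: "p \<in> {1..n - 1}" "t \<noteq> 0 \<or> I_part \<pi> p \<noteq> {}" "\<not> (0 < site \<pi> t x p \<and> site \<pi> t x p \<le> 1)"
      unfolding E by blast
    have I: "I_part \<pi> p \<noteq> {}"
    proof
      assume "I_part \<pi> p = {}"
      then show False
        using p t by (simp add: site_def)
    qed
    have g: "0 < grid_site \<pi> N h x p" "grid_site \<pi> N h x p \<le> 1"
      using 2(1) p(1) unfolding C_def by auto
    then have "site \<pi> t x p \<le> 0" "- r \<le> site \<pi> t x p"
      using p(3) close[OF p(1)] by auto
    moreover have "x \<in> cube (J_part \<pi>)"
      using grid_cube[OF \<pi> hp(1) x] 2(1) unfolding C_def by blast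
    ultimately have "x \<in> slab (J_part \<pi>) (I_part \<pi> p) (- t - real n / real N) (- t)"
      by (simp add: slab_def site_def r_def)
    then have "K ^ n \<le> K ^ n * (\<Sum>p\<in>?P. ?lo p + ?hi p)"
      using p(1) I by (intro one_slab[of p]) auto
    moreover have eq: "grid_integrand n \<pi> N f h x - limit_integrand n \<pi> f t x = grid_integrand n \<pi> N f h x"
      using 2 by (simp add: limit_integrand_def)
    ultimately show ?thesis
      unfolding eq using bd_grid[OF 2(1)] A_nonneg by linarith
  next
    case 3
    then obtain p where p: "p \<in> {1..n - 1}" "\<not> (0 < grid_site \<pi> N h x p \<and> grid_site \<pi> N h x p \<le> 1)"
      unfolding C_def by blast
    have I: "I_part \<pi> p \<noteq> {}"
    proof
      assume "I_part \<pi> p = {}"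
      then show False
        using p(2) hp(1) N by (simp add: grid_site_def)
    qed
    then have s: "0 < site \<pi> t x p" "site \<pi> t x p \<le> 1"
      using 3(2) p(1) unfolding E by auto
    then have "1 - r \<le> site \<pi> t x p"
      using p(2) close[OF p(1)] by linarith
    then have "x \<in> slab (J_part \<pi>) (I_part \<pi> p) (1 - t - real n / real N) (1 - t)"
      using s(2) E_part_cube(2)[OF \<pi> t 3(2)] by (simp add: slab_def site_def r_def)
    then have "K ^ n \<le> K ^ n * (\<Sum>p\<in>?P. ?lo p + ?hi p)"
      using p(1) I by (intro one_slab[of p]) auto
    moreover have eq: "grid_integrand n \<pi> N f h x - limit_integrand n \<pi> f t x = - limit_integrand n \<pi> f t x"
      using 3(1) by (simp add: grid_eq)
    ultimately show ?thesis
      unfolding eq norm_minus_cancel using bd_lim[OF 3(2)] A_nonneg by linarith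
  next
    case 4
    then have eq: "grid_integrand n \<pi> N f h x - limit_integrand n \<pi> f t x = 0"
      by (simp add: grid_eq limit_integrand_def)
    show ?thesis
      unfolding eq norm_zero using A_nonneg S_nonneg by linarith
  qed
qed

text \<open>The functions are only continuous on \<open>[0,1]\<close>; on \<open>E_part n \<pi>
  t\<close> they may be replaced by their extensions by zero, which are Borel functions on the
  line.\<close>

lemma limit_integrand_integrable:
  assumes \<pi>: "partition_on {1..n} \<pi>" and t: "t \<in> {0..1}"
    and cont: "\<And>p. p \<in> {1..n - 1} \<Longrightarrow> continuous_on {0..1} (f p)"
    and K: "K \<ge> 1" "\<And>p s. p \<in> {1..n - 1} \<Longrightarrow> s \<in> {0..1} \<Longrightarrow> norm (f p s) \<le> K"
  shows "integrable (leb (J_part \<pi>)) (limit_integrand n \<pi> f t)"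
    "norm (LINT x|leb (J_part \<pi>). limit_integrand n \<pi> f t x) \<le> K ^ n * 4 ^ card (J_part \<pi>)"
proof -
  define J where "J = J_part \<pi>"
  have finJ: "finite J"
    using finite_J_part[OF \<pi>] by (simp add: J_def)
  have I_sub: "I_part \<pi> p \<subseteq> J" if "p \<in> {1..n - 1}" for p
  proof -
    have "p \<le> n"
      using that by auto
    from I_part_subset_J_part[OF \<pi> this] show ?thesis
      by (simp add: J_def)
  qed
  have site_meas: "(\<lambda>x. site \<pi> t x p) \<in> borel_measurable (leb J)" if "p \<in> {1..n - 1}" for p
    unfolding site_def using sum_measurable_PiM[OF I_sub[OF that]] by (intro borel_measurable_add) auto
  have E_sets: "E_part n \<pi> t \<in> sets (leb J)"
  proof -
    have "E_part n \<pi> t = {x \<in> space (leb J). \<forall>p\<in>{1..n - 1}. t \<noteq> 0 \<or> I_part \<pi> p \<noteq> {} \<longrightarrow>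
        0 < site \<pi> t x p \<and> site \<pi> t x p \<le> 1}"
      by (simp add: E_part_def site_def J_def space_PiM)
    also have "\<dots> \<in> sets (leb J)"
    proof (rule sets.sets_Collect_finite_All)
      fix p assume "p \<in> {1..n - 1}"
      note [measurable] = site_meas[OF this]
      show "{x \<in> space (leb J). t \<noteq> 0 \<or> I_part \<pi> p \<noteq> {} \<longrightarrow> 0 < site \<pi> t x p \<and> site \<pi> t x p \<le> 1} \<in> sets (leb J)"
        by measurable
    qed auto
    finally show ?thesis .
  qed
  define g where "g p = (\<lambda>s. indicator {0..1} s *\<^sub>R f p s)" for p
  have g_meas: "(\<lambda>x. g p (site \<pi> t x p)) \<in> borel_measurable (leb J)" if "p \<in> {1..n - 1}" for p
  proof -
    have "g p \<in> borel_measurable borel"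
      unfolding g_def by (rule borel_measurable_continuous_on_indicator) (use cont[OF that] in auto)
    then show ?thesis
      using site_meas[OF that] by (rule measurable_compose[rotated])
  qed
  have eq: "limit_integrand n \<pi> f t x = indicator (E_part n \<pi> t) x *\<^sub>R (\<Prod>p=1..n - 1. g p (site \<pi> t x p))" for x
  proof (cases "x \<in> E_part n \<pi> t")
    case True
    then have "(\<Prod>p=1..n - 1. g p (site \<pi> t x p)) = (\<Prod>p=1..n - 1. f p (site \<pi> t x p))"
      using E_part_cube(1)[OF \<pi> t True] by (intro prod.cong refl) (simp add: g_def)
    then show ?thesis
      by (simp only: limit_integrand_def)
  qed (simp add: limit_integrand_def)
  have prod_meas: "(\<lambda>x. \<Prod>p=1..n - 1. g p (site \<pi> t x p)) \<in> borel_measurable (leb J)"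
    using g_meas by (rule borel_measurable_prod)
  have meas: "limit_integrand n \<pi> f t \<in> borel_measurable (leb J)"
    unfolding eq[abs_def] by (rule borel_measurable_scaleR[OF borel_measurable_indicator[OF E_sets] prod_meas])
  have bound: "norm (limit_integrand n \<pi> f t x) \<le> indicator (cube J) x * K ^ n" for x
  proof (cases "x \<in> E_part n \<pi> t")
    case True
    have "norm (\<Prod>p=1..n - 1. f p (site \<pi> t x p)) \<le> K ^ card {1..n - 1}"
      by (rule norm_prod_le_power) (rule K(2)[OF _ E_part_cube(1)[OF \<pi> t True]])
    also have "\<dots> \<le> K ^ n"
      using K(1) by (intro power_increasing) auto
    finally show ?thesis
      using True E_part_cube(2)[OF \<pi> t True] by (simp add: limit_integrand_def J_def)
  next
    case False
    then show ?thesis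
      using K(1) by (simp add: limit_integrand_def)
  qed
  have int_bound: "integrable (leb J) (\<lambda>x. indicator (cube J) x * K ^ n)"
    by (intro integrable_mult_left measure_cube(1)[OF finJ])
  show int: "integrable (leb (J_part \<pi>)) (limit_integrand n \<pi> f t)"
    unfolding J_def[symmetric]
  proof (rule Bochner_Integration.integrable_bound[OF int_bound meas], rule AE_I2)
    fix x
    show "norm (limit_integrand n \<pi> f t x) \<le> norm (indicator (cube J) x * K ^ n)"
      using bound[of x] by simp
  qed
  have "norm (LINT x|leb J. limit_integrand n \<pi> f t x) \<le> (LINT x|leb J. norm (limit_integrand n \<pi> f t x))"
    by (rule integral_norm_bound)
  also have "\<dots> \<le> (LINT x|leb J. indicator (cube J) x * K ^ n)"
    using int unfolding J_def[symmetric] by (intro integral_mono integrable_norm int_bound bound)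
  also have "\<dots> = K ^ n * 4 ^ card J"
    using measure_cube(2)[OF finJ] cube_sets[OF finJ]
    by (simp add: Int_absorb1[OF sets.sets_into_space])
  finally show "norm (LINT x|leb (J_part \<pi>). limit_integrand n \<pi> f t x) \<le> K ^ n * 4 ^ card (J_part \<pi>)"
    by (simp add: J_def)
qed

text \<open>Integrating \<open>integrand_difference\<close> over the cube bounds the error by a
  multiple of the modulus of continuity plus \<open>O(1/N)\<close> for the slabs. The constants
  depend on \<open>n\<close>, \<open>\<pi>\<close> and the common bound only.\<close>

lemma sampled_limit_Lambda:
  assumes S: "equicts (n - 1) S" and \<pi>: "partition_on {1..n} \<pi>" and n: "n \<ge> 1"
  shows "sampled_limit S (\<lambda>N f. Lambda_disc N n \<pi> f) (Lambda_part n \<pi>)"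
proof -
  define J where "J = J_part \<pi>"
  define V where "V = (4::real) ^ card J"
  have finJ: "finite J"
    using finite_J_part[OF \<pi>] by (simp add: J_def)
  have V: "V > 0"
    by (simp add: V_def)
  obtain K where K: "K \<ge> 1" "\<And>f p s. f \<in> S \<Longrightarrow> p \<in> {1..n - 1} \<Longrightarrow> s \<in> {0..1} \<Longrightarrow> norm (f p s) \<le> K"
    using equicts_bound[OF S] by blast
  note cont = equicts_continuous[OF S]
  show ?thesis
  proof (rule sampled_limitI[where B = "K ^ n * V"])
    fix f t assume f: "f \<in> S" and t: "t \<in> {0..1::real}"
    show "norm (Lambda_part n \<pi> f t) \<le> K ^ n * V"
      unfolding Lambda_part_integral[OF \<pi> t] V_def J_def
      using limit_integrand_integrable(2)[OF \<pi> t cont[OF f] K(1) K(2)[OF f]] .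
  next
    fix e :: real assume e: "e > 0"
    \<comment> \<open>Chosen so that the contribution of the modulus, integrated over the cube, is \<open>e / 2\<close>.\<close>
    define e' where "e' = e / (2 * (real n * K ^ n * V))"
    have nKV: "real n * K ^ n * V > 0"
      using n K(1) V by simp
    have e': "e' > 0"
      using e nKV by (simp add: e'_def)
    obtain d where d: "d > 0" "\<And>f p s u. f \<in> S \<Longrightarrow> p \<in> {1..n - 1} \<Longrightarrow> s \<in> {0..1} \<Longrightarrow> u \<in> {0..1} \<Longrightarrow>
      \<bar>s - u\<bar> < d \<Longrightarrow> norm (f p s - f p u) < e'"
      using equicts_modulus[OF S e'] by blast
    define C where "C = K ^ n * (real n * (2 * (V * real n)))"
    have "\<forall>\<^sub>F N in sequentially. real n / real N < d"
      using d(1) lim_const_over_n by (intro order_tendstoD(2)) auto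
    moreover have "\<forall>\<^sub>F N in sequentially. C / real N < e / 2"
      using e lim_const_over_n by (intro order_tendstoD(2)) auto
    ultimately show "\<forall>\<^sub>F N in sequentially. \<forall>f\<in>S. \<forall>t\<in>{0..1}.
        norm (Lambda_disc N n \<pi> f (sample_index N t) - Lambda_part n \<pi> f t) < e"
      using eventually_ge_at_top[of 1]
    proof eventually_elim
      case (elim N)
      note N = elim(3)
      show ?case
      proof (intro ballI)
        fix f t assume f: "f \<in> S" and t: "t \<in> {0..1::real}"
        define h where "h = sample_index N t"
        note hp = sample_index_props[OF N t, folded h_def]
        define P where "P = {p \<in> {1..n - 1}. I_part \<pi> p \<noteq> {}}"
        define lo where "lo p = slab J (I_part \<pi> p) (- t - real n / real N) (- t)" for p
        define hi where "hi p = slab J (I_part \<pi> p) (1 - t - real n / real N) (1 - t)" for p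
        define T where "T = (\<Sum>p\<in>P. measure (leb J) (lo p) + measure (leb J) (hi p))"
        define D where "D x = real n * K ^ n * e' * indicator (cube J) x +
          K ^ n * (\<Sum>p\<in>P. indicator (lo p) x + indicator (hi p) x)" for x
        have I_sub: "I_part \<pi> p \<subseteq> J" if "p \<in> P" for p
        proof -
          have "p \<le> n"
            using that by (auto simp: P_def)
          from I_part_subset_J_part[OF \<pi> this] show ?thesis
            by (simp add: J_def)
        qed
        have slabs: "integrable (leb J) (indicator (lo p) :: _ \<Rightarrow> real)"
          "measure (leb J) (lo p) \<le> V * (real n / real N)"
          "integrable (leb J) (indicator (hi p) :: _ \<Rightarrow> real)"
          "measure (leb J) (hi p) \<le> V * (real n / real N)"
          "lo p \<in> sets (leb J)" "hi p \<in> sets (leb J)"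
          if p: "p \<in> P" for p
        proof -
          have I: "I_part \<pi> p \<noteq> {}"
            using p by (simp add: P_def)
          show "integrable (leb J) (indicator (lo p) :: _ \<Rightarrow> real)"
            "measure (leb J) (lo p) \<le> V * (real n / real N)"
            using measure_slab_le[OF finJ I_sub[OF p] I, of "- t - real n / real N" "- t"]
            by (simp_all add: lo_def V_def)
          show "integrable (leb J) (indicator (hi p) :: _ \<Rightarrow> real)"
            "measure (leb J) (hi p) \<le> V * (real n / real N)"
            using measure_slab_le[OF finJ I_sub[OF p] I, of "1 - t - real n / real N" "1 - t"]
            by (simp_all add: hi_def V_def)
          show "lo p \<in> sets (leb J)" "hi p \<in> sets (leb J)"
            unfolding lo_def hi_def by (rule slab_sets[OF finJ I_sub[OF p]])+
        qed
        have D_int: "integrable (leb J) D"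
          unfolding D_def using slabs(1,3) measure_cube(1)[OF finJ]
          by (intro Bochner_Integration.integrable_add integrable_mult_right Bochner_Integration.integrable_sum)
        have D_bound: "norm (grid_integrand n \<pi> N f h x - limit_integrand n \<pi> f t x) \<le> D x"
          if "x \<in> space (leb J)" for x
          unfolding D_def lo_def hi_def P_def J_def
          by (rule integrand_difference[OF \<pi> t N h_def K(1) K(2)[OF f] d(2)[OF f] elim(1) e'])
             (use that in \<open>simp_all add: space_PiM J_def\<close>)
        have int1: "integrable (leb J) (grid_integrand n \<pi> N f h)"
          unfolding J_def by (rule Lambda_disc_integral(1)[OF \<pi> n hp(1)])
        have int2: "integrable (leb J) (limit_integrand n \<pi> f t)"
          unfolding J_def by (rule limit_integrand_integrable(1)[OF \<pi> t cont[OF f] K(1) K(2)[OF f]])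
        have "Lambda_disc N n \<pi> f h - Lambda_part n \<pi> f t =
            (LINT x|leb J. grid_integrand n \<pi> N f h x - limit_integrand n \<pi> f t x)"
          unfolding Lambda_disc_integral(2)[OF \<pi> n hp(1)] Lambda_part_integral[OF \<pi> t]
          using int1 int2 unfolding J_def by (rule Bochner_Integration.integral_diff[symmetric])
        also have "norm \<dots> \<le> (LINT x|leb J. norm (grid_integrand n \<pi> N f h x - limit_integrand n \<pi> f t x))"
          by (rule integral_norm_bound)
        also have "\<dots> \<le> (LINT x|leb J. D x)"
          by (rule integral_mono[OF _ D_int D_bound]) (intro integrable_norm Bochner_Integration.integrable_diff int1 int2)
        also have "\<dots> = real n * K ^ n * e' * V + K ^ n * T"
        proof -
          have c: "(LINT x|leb J. real n * K ^ n * e' * indicator (cube J) x) = real n * K ^ n * e' * V"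
            using measure_cube(2)[OF finJ] cube_sets[OF finJ]
            by (simp add: Int_absorb1[OF sets.sets_into_space] V_def)
          have s: "(LINT x|leb J. (\<Sum>p\<in>P. indicator (lo p) x + indicator (hi p) x)) =
              T"
          proof -
            have "(LINT x|leb J. (\<Sum>p\<in>P. indicator (lo p) x + indicator (hi p) x :: real)) =
              (\<Sum>p\<in>P. LINT x|leb J. indicator (lo p) x + indicator (hi p) x)"
              using slabs(1,3) by (intro Bochner_Integration.integral_sum Bochner_Integration.integrable_add)
            also have "\<dots> = T"
              unfolding T_def
            proof (intro sum.cong refl)
              fix p assume p: "p \<in> P"
              show "(LINT x|leb J. indicator (lo p) x + indicator (hi p) x) = measure (leb J) (lo p) + measure (leb J) (hi p)"
                using slabs[OF p] by (simp add: Bochner_Integration.integral_add Int_absorb1[OF sets.sets_into_space])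
            qed
            finally show ?thesis .
          qed
          have i1: "integrable (leb J) (\<lambda>x. real n * K ^ n * e' * indicator (cube J) x)"
            by (intro integrable_mult_right measure_cube(1)[OF finJ])
          have i2: "integrable (leb J) (\<lambda>x. K ^ n * (\<Sum>p\<in>P. indicator (lo p) x + indicator (hi p) x))"
            using slabs(1,3)
            by (intro integrable_mult_right Bochner_Integration.integrable_sum Bochner_Integration.integrable_add)
          show ?thesis
            unfolding D_def Bochner_Integration.integral_add[OF i1 i2] c
            by (simp only: integral_mult_right_zero s)
        qed
        also have "\<dots> \<le> e / 2 + C / real N"
        proof (rule add_mono)
          show "real n * K ^ n * e' * V \<le> e / 2"
          proof -
            have "X * (e / (2 * X)) = e / 2" if "X > 0" for X
              using that by simp
            from this[OF nKV] show ?thesis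
              by (simp only: e'_def mult_ac order_refl)
          qed
          have "T \<le> (\<Sum>p\<in>P. 2 * (V * (real n / real N)))"
            unfolding T_def
          proof (rule sum_mono)
            fix p assume "p \<in> P"
            from slabs(2,4)[OF this]
            show "measure (leb J) (lo p) + measure (leb J) (hi p) \<le> 2 * (V * (real n / real N))"
              by simp
          qed
          also have "\<dots> \<le> real n * (2 * (V * (real n / real N)))"
          proof -
            have "card P \<le> card {1..n - 1}"
              by (rule card_mono) (auto simp: P_def)
            then have "real (card P) \<le> real n"
              by simp
            moreover have "0 \<le> 2 * (V * (real n / real N))"
              using V by simp
            ultimately have "real (card P) * (2 * (V * (real n / real N))) \<le> real n * (2 * (V * (real n / real N)))"
              by (rule mult_right_mono)
            then show ?thesis
              by simp
          qed
          finally have "K ^ n * T \<le>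
              K ^ n * (real n * (2 * (V * (real n / real N))))"
            using K(1) by (intro mult_left_mono) auto
          then show "K ^ n * T \<le> C / real N"
            by (simp add: C_def)
        qed
        finally show "norm (Lambda_disc N n \<pi> f (sample_index N t) - Lambda_part n \<pi> f t) < e"
          using elim(2) unfolding h_def by linarith
      qed
    qed
  qed
qed

section \<open>The limits and their rate\<close>

lemma equicts_reindex:
  assumes "equicts m S" "\<And>j. j \<in> {1..r} \<Longrightarrow> \<rho> j \<in> {1..m}"
  shows "equicts r ((\<lambda>g j. g (\<rho> j)) ` S)"
  unfolding equicts_def
proof (intro conjI allI impI)
  obtain K where "K \<ge> 1" "\<And>f j s. f \<in> S \<Longrightarrow> j \<in> {1..m} \<Longrightarrow> s \<in> {0..1} \<Longrightarrow> norm (f j s) \<le> K"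
    using equicts_bound[OF assms(1)] by blast
  then show "\<exists>K. \<forall>f\<in>(\<lambda>g j. g (\<rho> j)) ` S. \<forall>j\<in>{1..r}. \<forall>s\<in>{0..1}. norm (f j s) \<le> K"
    using assms(2) by (intro exI[of _ K]) blast
next
  fix e :: real assume "e > 0"
  then obtain d where "d > 0" "\<And>f j s u. f \<in> S \<Longrightarrow> j \<in> {1..m} \<Longrightarrow> s \<in> {0..1} \<Longrightarrow> u \<in> {0..1} \<Longrightarrow>
      \<bar>s - u\<bar> < d \<Longrightarrow> norm (f j s - f j u) < e"
    using equicts_modulus[OF assms(1)] by blast
  then show "\<exists>d>0. \<forall>f\<in>(\<lambda>g j. g (\<rho> j)) ` S. \<forall>j\<in>{1..r}. \<forall>s\<in>{0..1}. \<forall>u\<in>{0..1}.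
      \<bar>s - u\<bar> < d \<longrightarrow> norm (f j s - f j u) < e"
    using assms(2) by (intro exI[of _ d]) blast
qed

lemma sampled_limit_disc:
  assumes S: "equicts (2 * n) S" and n: "n \<ge> 1"
  shows "sampled_limit S (\<lambda>N g. disc_adj_first N n g) (limit_adj_first n)"
    "sampled_limit S (\<lambda>N g. disc_adj_last N n g) (limit_adj_last n)"
proof -
  have eval: "sampled_limit S (\<lambda>N g h. g j (real h / real N)) (\<lambda>g. g j)" if "j \<in> {1..2 * n}" for j
    by (rule sampled_limit_eval[OF S that])
  have Gam: "sampled_limit S (\<lambda>N g. Gamma_disc N n \<pi> (\<lambda>j. g (\<rho> j))) (\<lambda>g. Gamma_part \<pi> (\<lambda>j. g (\<rho> j)))"
    if "\<pi> \<in> set_partitions n" "\<And>j. j \<in> {1..n} \<Longrightarrow> \<rho> j \<in> {1..2 * n}" for \<pi> \<rho>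
    by (rule sampled_limit_compose[OF sampled_limit_Gamma[OF equicts_reindex[OF S that(2)]]])
       (use that(1) n in \<open>auto simp: set_partitions_def\<close>)
  have Lam: "sampled_limit S (\<lambda>N g. Lambda_disc N n \<pi> (\<lambda>j. g (\<rho> j))) (\<lambda>g. Lambda_part n \<pi> (\<lambda>j. g (\<rho> j)))"
    if "\<pi> \<in> set_partitions n" "\<And>j. j \<in> {1..n - 1} \<Longrightarrow> \<rho> j \<in> {1..2 * n}" for \<pi> \<rho>
    by (rule sampled_limit_compose[OF sampled_limit_Lambda[OF equicts_reindex[OF S that(2)]]])
       (use that(1) n in \<open>auto simp: set_partitions_def\<close>)
  show "sampled_limit S (\<lambda>N g. disc_adj_first N n g) (limit_adj_first n)"
    unfolding disc_adj_first_def limit_adj_first_def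
    by (intro sampled_limit_sum finite_set_partitions sampled_limit_mult sampled_limit_avg eval Gam Lam)
       (use n in auto)
  show "sampled_limit S (\<lambda>N g. disc_adj_last N n g) (limit_adj_last n)"
    unfolding disc_adj_last_def limit_adj_last_def
    by (intro sampled_limit_sum finite_set_partitions sampled_limit_mult sampled_limit_avg eval Gam Lam)
       (use n in auto)
qed

text \<open>Needed for the finitely many \<open>N\<close> for which the uniform limit gives no
  information: the supremum of the error has to be finite for every \<open>N\<close>.\<close>

lemma disc_bounded:
  assumes S: "equicts (2 * n) S" and n: "n \<ge> 1" and N: "N \<ge> 1"
  obtains B where "\<And>f h. f \<in> S \<Longrightarrow> h \<in> {1..N} \<Longrightarrow> norm (disc_adj_first N n f h) \<le> B"
    "\<And>f h. f \<in> S \<Longrightarrow> h \<in> {1..N} \<Longrightarrow> norm (disc_adj_last N n f h) \<le> B"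
proof -
  obtain K where K: "K \<ge> 1" "\<And>f j s. f \<in> S \<Longrightarrow> j \<in> {1..2 * n} \<Longrightarrow> s \<in> {0..1} \<Longrightarrow> norm (f j s) \<le> K"
    using equicts_bound[OF S] by blast
  define V where "V = tuples n N"
  have finV: "finite V"
    by (simp add: V_def finite_PiE)
  define C where "C = real (card V) * K ^ n"
  have val: "norm (f j (real v / real N)) \<le> K" if "f \<in> S" "j \<in> {1..2 * n}" "v \<in> {1..N}" for f j v
    by (rule K(2)[OF that(1,2)]) (use that(3) in auto)
  have sub: "norm (\<Sum>i\<in>W. \<Prod>k\<in>I. f (\<rho> k) (real (i k) / real N)) \<le> C"
    if f: "f \<in> S" and W: "W \<subseteq> V" and I: "I \<subseteq> {1..n}" and \<rho>: "\<And>k. k \<in> I \<Longrightarrow> \<rho> k \<in> {1..2 * n}" for f W I \<rho>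
  proof -
    have "norm (\<Sum>i\<in>W. \<Prod>k\<in>I. f (\<rho> k) (real (i k) / real N)) \<le> (\<Sum>i\<in>W. K ^ n)"
    proof (rule sum_norm_le)
      fix i assume "i \<in> W"
      then have i: "i k \<in> {1..N}" if "k \<in> I" for k
        using W I that unfolding V_def by (blast dest: PiE_mem)
      have "norm (\<Prod>k\<in>I. f (\<rho> k) (real (i k) / real N)) \<le> K ^ card I"
        by (rule norm_prod_le_power) (rule val[OF f \<rho> i])
      also have "\<dots> \<le> K ^ n"
        using K(1) card_mono[OF _ I] by (intro power_increasing) auto
      finally show "norm (\<Prod>k\<in>I. f (\<rho> k) (real (i k) / real N)) \<le> K ^ n" .
    qed
    also have "\<dots> \<le> C"
      using K(1) card_mono[OF finV W] by (simp add: C_def mult_right_mono)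
    finally show ?thesis .
  qed
  have div: "norm (z / of_nat N ^ m) \<le> norm z" for z :: complex and m
  proof -
    have "1 \<le> real N ^ m"
      using N by simp
    then have "norm z / real N ^ m \<le> norm z / 1"
      using N by (intro divide_left_mono) auto
    then show ?thesis
      by (simp add: norm_divide norm_power)
  qed
  have avg: "norm (avg N a) \<le> c" if "\<And>v. v \<in> {1..N} \<Longrightarrow> norm (a v) \<le> c" for a c
  proof -
    have "norm (\<Sum>v=1..N. a v) \<le> (\<Sum>v=1..N. c)"
      by (rule sum_norm_le) (rule that)
    then show ?thesis
      using N by (simp add: avg_def norm_divide field_simps)
  qed
  have Gam: "norm (Gamma_disc N n \<pi> (\<lambda>j. f (\<rho> j)) h) \<le> C" if "f \<in> S" "\<And>k. k \<in> {1..n} \<Longrightarrow> \<rho> k \<in> {1..2 * n}" for f \<rho> \<pi> h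
    unfolding Gamma_disc_def by (rule order_trans[OF div sub[OF that(1)]]) (use that(2) in \<open>auto simp: V_def\<close>)
  have Lam: "norm (Lambda_disc N n \<pi> (\<lambda>j. f (\<rho> j)) h) \<le> C" if "f \<in> S" "\<And>k. k \<in> {1..n - 1} \<Longrightarrow> \<rho> k \<in> {1..2 * n}" for f \<rho> \<pi> h
    unfolding Lambda_disc_def by (rule order_trans[OF div sub[OF that(1)]]) (use that(2) in \<open>auto simp: V_def\<close>)
  have C: "C \<ge> 0"
    using K(1) by (simp add: C_def)
  define B where "B = real (card (set_partitions n)) * (K * C * C)"
  have total: "norm (\<Sum>\<pi>\<in>set_partitions n. F \<pi>) \<le> B" if "\<And>\<pi>. norm (F \<pi>) \<le> K * C * C" for F :: "nat set set \<Rightarrow> complex"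
  proof -
    have "norm (\<Sum>\<pi>\<in>set_partitions n. F \<pi>) \<le> (\<Sum>\<pi>\<in>set_partitions n. K * C * C)"
      by (rule sum_norm_le) (rule that)
    then show ?thesis
      by (simp add: B_def)
  qed
  show ?thesis
  proof (rule that)
    fix f h assume f: "f \<in> S" and h: "h \<in> {1..N}"
    show "norm (disc_adj_first N n f h) \<le> B"
      unfolding disc_adj_first_def
    proof (rule total)
      fix \<pi>
      show "norm (f 1 (real h / real N) * Lambda_disc N n \<pi> (\<lambda>j. f (2 * j + 1)) h *
          avg N (Gamma_disc N n \<pi> (\<lambda>j. f (2 * j)))) \<le> K * C * C"
        unfolding norm_mult
        by (intro mult_mono val[OF f _ h] Lam[OF f] avg Gam[OF f] mult_nonneg_nonneg)
           (use n C K(1) in auto)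
    qed
    show "norm (disc_adj_last N n f h) \<le> B"
      unfolding disc_adj_last_def
    proof (rule total)
      fix \<pi>
      have "norm (Gamma_disc N n \<pi> (\<lambda>j. f (2 * j - 1)) h *
          avg N (\<lambda>v. Lambda_disc N n \<pi> (\<lambda>j. f (2 * j)) v * f (2 * n) (real v / real N))) \<le> C * (C * K)"
        unfolding norm_mult
      proof (intro mult_mono Gam[OF f] avg)
        fix v assume v: "v \<in> {1..N}"
        show "norm (Lambda_disc N n \<pi> (\<lambda>j. f (2 * j)) v * f (2 * n) (real v / real N)) \<le> C * K"
          unfolding norm_mult by (intro mult_mono Lam[OF f] val[OF f _ v]) (use n C in auto)
      qed (use C in auto)
      then show "norm (Gamma_disc N n \<pi> (\<lambda>j. f (2 * j - 1)) h *
          avg N (\<lambda>v. Lambda_disc N n \<pi> (\<lambda>j. f (2 * j)) v * f (2 * n) (real v / real N))) \<le> K * C * C"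
        by (simp add: mult_ac)
    qed
  qed
qed

text \<open>The rate is the supremum of the two errors over the family and over
  \<open>[0,1]\<close>.\<close>

lemma uniform_rate:
  assumes S: "equicts (2 * n) S" and n: "n \<ge> 1"
  shows "\<exists>r :: nat \<Rightarrow> real. r \<longlonglongrightarrow> 0 \<and>
    (\<forall>f N (P :: 'a measure) \<xi>. f \<in> S \<longrightarrow> N \<ge> 1 \<longrightarrow> iid_haar P N \<xi> \<longrightarrow>
      (\<forall>t\<in>{0..1}.
         norm (expect_diag_adj_first P \<xi> N n f t - limit_adj_first n f t) \<le> r N \<and>
         norm (expect_diag_adj_last P \<xi> N n f t - limit_adj_last n f t) \<le> r N))"
proof -
  define err where "err N x = max
      (norm (disc_adj_first N n (fst x) (sample_index N (snd x)) - limit_adj_first n (fst x) (snd x)))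
      (norm (disc_adj_last N n (fst x) (sample_index N (snd x)) - limit_adj_last n (fst x) (snd x)))" for N x
  \<comment> \<open>Inserting 0 keeps the set nonempty if the family is empty.\<close>
  define A where "A N = insert 0 (err N ` (S \<times> {0..1}))" for N
  note lim = sampled_limit_disc[OF S n]
  have bdd: "bdd_above (A N)" if N: "N \<ge> 1" for N
  proof -
    obtain B where B: "\<And>f h. f \<in> S \<Longrightarrow> h \<in> {1..N} \<Longrightarrow> norm (disc_adj_first N n f h) \<le> B"
      "\<And>f h. f \<in> S \<Longrightarrow> h \<in> {1..N} \<Longrightarrow> norm (disc_adj_last N n f h) \<le> B"
      using disc_bounded[OF S n N] by blast
    obtain B1 where B1: "B1 > 0" "\<And>f t. f \<in> S \<Longrightarrow> t \<in> {0..1} \<Longrightarrow> norm (limit_adj_first n f t) \<le> B1"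
      using sampled_limit_bound[OF lim(1)] by blast
    obtain B2 where B2: "B2 > 0" "\<And>f t. f \<in> S \<Longrightarrow> t \<in> {0..1} \<Longrightarrow> norm (limit_adj_last n f t) \<le> B2"
      using sampled_limit_bound[OF lim(2)] by blast
    have "bdd_above (err N ` (S \<times> {0..1}))"
    proof (rule bdd_aboveI2)
      fix x assume "x \<in> S \<times> {0..1::real}"
      then have f: "fst x \<in> S" and t: "snd x \<in> {0..1}"
        by auto
      note h = sample_index_props(1)[OF N t]
      show "err N x \<le> max (B + B1) (B + B2)"
        unfolding err_def
        by (intro max.mono order_trans[OF norm_triangle_ineq4] add_mono B(1)[OF f h] B(2)[OF f h] B1(2)[OF f t] B2(2)[OF f t])
    qed
    then show ?thesis
      by (simp add: A_def)
  qed
  have "(\<lambda>N. Sup (A N)) \<longlonglongrightarrow> 0"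
  proof (rule tendstoI)
    fix e :: real assume e: "e > 0"
    then have e2: "e / 2 > 0"
      by simp
    show "\<forall>\<^sub>F N in sequentially. dist (Sup (A N)) 0 < e"
      using sampled_limitD[OF lim(1) e2] sampled_limitD[OF lim(2) e2] eventually_ge_at_top[of 1]
    proof eventually_elim
      case (elim N)
      have "err N x \<le> e / 2" if "x \<in> S \<times> {0..1}" for x
      proof -
        have "fst x \<in> S" "snd x \<in> {0..1}"
          using that by auto
        then show ?thesis
          unfolding err_def using elim(1,2) by (intro max.boundedI less_imp_le) blast+
      qed
      then have "Sup (A N) \<le> e / 2"
        using e2 unfolding A_def by (intro cSup_least) auto
      moreover have "0 \<le> Sup (A N)"
        by (rule cSup_upper[OF _ bdd[OF elim(3)]]) (simp add: A_def)
      ultimately show "dist (Sup (A N)) 0 < e"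
        using e by (simp add: dist_real_def)
    qed
  qed
  moreover have "norm (expect_diag_adj_first P \<xi> N n f t - limit_adj_first n f t) \<le> Sup (A N) \<and>
       norm (expect_diag_adj_last P \<xi> N n f t - limit_adj_last n f t) \<le> Sup (A N)"
    if f: "f \<in> S" and N: "N \<ge> 1" and iid: "iid_haar P N \<xi>" and t: "t \<in> {0..1}"
    for f N \<xi> t and P :: "'a measure"
  proof -
    have "err N (f, t) \<le> Sup (A N)"
      by (rule cSup_upper[OF _ bdd[OF N]]) (use f t in \<open>simp add: A_def\<close>)
    then show ?thesis
      unfolding expect_diag_adj_first_eq[OF n N iid t] expect_diag_adj_last_eq[OF n N iid t]
      by (simp add: err_def)
  qed
  ultimately show ?thesis
    by (intro exI[of _ "\<lambda>N. Sup (A N)"]) blast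
qed

lemma equicts_single:
  assumes "\<And>j. j \<in> {1..m} \<Longrightarrow> continuous_on {0..1} (g j)"
  shows "equicts m {g}"
  unfolding equicts_def
proof (intro conjI allI impI)
  have "\<exists>K. \<forall>s\<in>{0..1}. norm (g j s) \<le> K" if "j \<in> {1..m}" for j
  proof -
    have "bounded (g j ` {0..1})"
      by (intro compact_imp_bounded compact_continuous_image assms that) auto
    then show ?thesis
      unfolding bounded_iff by auto
  qed
  then obtain K where K: "\<And>j s. j \<in> {1..m} \<Longrightarrow> s \<in> {0..1} \<Longrightarrow> norm (g j s) \<le> K j"
    by metis
  show "\<exists>K. \<forall>f\<in>{g}. \<forall>j\<in>{1..m}. \<forall>s\<in>{0..1}. norm (f j s) \<le> K"
  proof (intro exI ballI)
    fix f j and s :: real assume "f \<in> {g}" "j \<in> {1..m}" "s \<in> {0..1}"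
    then have "norm (f j s) \<le> K j"
      using K by simp
    also have "\<dots> \<le> (\<Sum>j=1..m. \<bar>K j\<bar>)"
      using member_le_sum[of j "{1..m}" "\<lambda>j. \<bar>K j\<bar>"] \<open>j \<in> {1..m}\<close> by simp
    finally show "norm (f j s) \<le> (\<Sum>j=1..m. \<bar>K j\<bar>)" .
  qed
next
  fix e :: real assume e: "e > 0"
  have "\<exists>d>0. \<forall>s\<in>{0..1}. \<forall>u\<in>{0..1}. \<bar>s - u\<bar> < d \<longrightarrow> norm (g j s - g j u) < e" if "j \<in> {1..m}" for j
  proof -
    have "uniformly_continuous_on {0..1} (g j)"
      by (intro compact_uniformly_continuous assms that) auto
    then show ?thesis
      using e unfolding uniformly_continuous_on_def dist_norm real_norm_def
      by (auto simp: abs_minus_commute norm_minus_commute)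
  qed
  then obtain d where d: "\<And>j. j \<in> {1..m} \<Longrightarrow> d j > 0"
    "\<And>j s u. j \<in> {1..m} \<Longrightarrow> s \<in> {0..1} \<Longrightarrow> u \<in> {0..1} \<Longrightarrow> \<bar>s - u\<bar> < d j \<Longrightarrow> norm (g j s - g j u) < e"
    by metis
  define d0 where "d0 = Min (insert 1 (d ` {1..m}))"
  have "d0 > 0"
    unfolding d0_def using d(1) by (subst Min_gr_iff) auto
  moreover have "d0 \<le> d j" if "j \<in> {1..m}" for j
    unfolding d0_def using that by (intro Min_le) auto
  ultimately show "\<exists>d>0. \<forall>f\<in>{g}. \<forall>j\<in>{1..m}. \<forall>s\<in>{0..1}. \<forall>u\<in>{0..1}.
      \<bar>s - u\<bar> < d \<longrightarrow> norm (f j s - f j u) < e"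
    using d(2) by (intro exI[of _ d0]) (blast intro: less_le_trans)
qed

text \<open>Equal arguments are treated separately, because the limit of \<open>\<omega>\<close> at
  0 from the right says nothing about its value at 0.\<close>

lemma equicts_modulus_class:
  assumes "(\<omega> \<longlongrightarrow> 0) (at_right 0)"
  shows "equicts m {f. \<forall>j\<in>{1..m}. continuous_on {0..1} (f j) \<and>
    (\<forall>s\<in>{0..1}. norm (f j s) \<le> K) \<and>
    (\<forall>s\<in>{0..1}. \<forall>u\<in>{0..1}. norm (f j s - f j u) \<le> \<omega> \<bar>s - u\<bar>)}" (is "equicts m ?S")
  unfolding equicts_def
proof (intro conjI allI impI)
  show "\<exists>K. \<forall>f\<in>?S. \<forall>j\<in>{1..m}. \<forall>s\<in>{0..1}. norm (f j s) \<le> K"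
    by (intro exI[of _ K]) blast
next
  fix e :: real assume e: "e > 0"
  then have "\<forall>\<^sub>F x in at_right 0. \<omega> x < e"
    using assms by (rule order_tendstoD(2)[rotated])
  then obtain d where d: "d > 0" "\<And>x. 0 < x \<Longrightarrow> x < d \<Longrightarrow> \<omega> x < e"
    unfolding eventually_at_right_field by auto
  show "\<exists>d>0. \<forall>f\<in>?S. \<forall>j\<in>{1..m}. \<forall>s\<in>{0..1}. \<forall>u\<in>{0..1}. \<bar>s - u\<bar> < d \<longrightarrow> norm (f j s - f j u) < e"
  proof (intro exI[of _ d] conjI ballI impI)
    fix f j and s u :: real
    assume f: "f \<in> ?S" and j: "j \<in> {1..m}" and s: "s \<in> {0..1}" and u: "u \<in> {0..1}" and su: "\<bar>s - u\<bar> < d"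
    show "norm (f j s - f j u) < e"
    proof (cases "s = u")
      case False
      have "norm (f j s - f j u) \<le> \<omega> \<bar>s - u\<bar>"
        using f j s u by blast
      also have "\<dots> < e"
        using False su by (intro d(2)) auto
      finally show ?thesis .
    qed (use e in simp)
  qed (rule d(1))
qed

theorem proposition2p2:
  fixes n :: nat
    and M :: "nat \<Rightarrow> 'a measure"
    and \<zeta> :: "nat \<Rightarrow> nat \<Rightarrow> 'a \<Rightarrow> complex"
    and g :: "nat \<Rightarrow> real \<Rightarrow> complex"
  assumes "n \<ge> 1"
    and "\<And>N. N \<ge> 1 \<Longrightarrow> iid_haar (M N) N (\<zeta> N)"
    and "\<And>j. j \<in> {1..2 * n} \<Longrightarrow> continuous_on {0..1} (g j)"
  shows "(\<forall>t\<in>{0..1}.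
            (\<lambda>N. expect_diag_adj_first (M N) (\<zeta> N) N n g t) \<longlonglongrightarrow> limit_adj_first n g t)
       \<and> (\<forall>t\<in>{0..1}.
            (\<lambda>N. expect_diag_adj_last (M N) (\<zeta> N) N n g t) \<longlonglongrightarrow> limit_adj_last n g t)
       \<and> uniform_limit {0..1} (\<lambda>N t. expect_diag_adj_first (M N) (\<zeta> N) N n g t)
            (limit_adj_first n g) sequentially
       \<and> uniform_limit {0..1} (\<lambda>N t. expect_diag_adj_last (M N) (\<zeta> N) N n g t)
            (limit_adj_last n g) sequentially
       \<and> (\<forall>(K :: real) (\<omega> :: real \<Rightarrow> real). (\<omega> \<longlongrightarrow> 0) (at_right 0) \<longrightarrow>
            (\<exists>r :: nat \<Rightarrow> real. r \<longlonglongrightarrow> 0 \<and>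
              (\<forall>(f :: nat \<Rightarrow> real \<Rightarrow> complex) N (P :: 'a measure) \<xi>.
                 (\<forall>j\<in>{1..2 * n}. continuous_on {0..1} (f j) \<and>
                    (\<forall>s\<in>{0..1}. norm (f j s) \<le> K) \<and>
                    (\<forall>s\<in>{0..1}. \<forall>u\<in>{0..1}. norm (f j s - f j u) \<le> \<omega> \<bar>s - u\<bar>)) \<longrightarrow>
                 N \<ge> 1 \<longrightarrow> iid_haar P N \<xi> \<longrightarrow>
                 (\<forall>t\<in>{0..1}.
                    norm (expect_diag_adj_first P \<xi> N n f t - limit_adj_first n f t) \<le> r N \<and>
                    norm (expect_diag_adj_last P \<xi> N n f t - limit_adj_last n f t) \<le> r N))))"
proof -
  have fam: "equicts (2 * n) {g}"
    by (rule equicts_single) (rule assms(3))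
  obtain r :: "nat \<Rightarrow> real" where r: "r \<longlonglongrightarrow> 0"
    and rate_r: "\<forall>f N (P :: 'a measure) \<xi>. f \<in> {g} \<longrightarrow> N \<ge> 1 \<longrightarrow> iid_haar P N \<xi> \<longrightarrow>
      (\<forall>t\<in>{0..1}.
         norm (expect_diag_adj_first P \<xi> N n f t - limit_adj_first n f t) \<le> r N \<and>
         norm (expect_diag_adj_last P \<xi> N n f t - limit_adj_last n f t) \<le> r N)"
    using uniform_rate[OF fam assms(1)] by blast
  have rate_g: "norm (expect_diag_adj_first (M N) (\<zeta> N) N n g t - limit_adj_first n g t) \<le> r N"
    "norm (expect_diag_adj_last (M N) (\<zeta> N) N n g t - limit_adj_last n g t) \<le> r N"
    if "N \<ge> 1" "t \<in> {0..1}" for N t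
    using rate_r assms(2)[OF that(1)] that by blast+
  have lim: "uniform_limit {0..1} F L sequentially"
    if "\<And>N t. N \<ge> 1 \<Longrightarrow> t \<in> {0..1} \<Longrightarrow> norm (F N t - L t) \<le> r N" for F and L :: "real \<Rightarrow> complex"
  proof (rule uniform_limitI)
    fix e :: real assume "e > 0"
    then have "\<forall>\<^sub>F N in sequentially. r N < e"
      by (rule order_tendstoD(2)[OF r])
    then show "\<forall>\<^sub>F N in sequentially. \<forall>t\<in>{0..1}. dist (F N t) (L t) < e"
      using eventually_ge_at_top[of 1]
    proof eventually_elim
      case (elim N)
      show ?case
      proof
        fix t :: real assume "t \<in> {0..1}"
        from that[OF elim(2) this] elim(1) show "dist (F N t) (L t) < e"
          unfolding dist_norm by linarith
      qed
    qed
  qed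
  have unif: "uniform_limit {0..1} (\<lambda>N t. expect_diag_adj_first (M N) (\<zeta> N) N n g t) (limit_adj_first n g) sequentially"
    "uniform_limit {0..1} (\<lambda>N t. expect_diag_adj_last (M N) (\<zeta> N) N n g t) (limit_adj_last n g) sequentially"
    by (rule lim, erule (1) rate_g)+
  show ?thesis
  proof (intro conjI allI impI, goal_cases)
    case (5 K \<omega>)
    define S where "S = {f :: nat \<Rightarrow> real \<Rightarrow> complex. \<forall>j\<in>{1..2 * n}. continuous_on {0..1} (f j) \<and>
      (\<forall>s\<in>{0..1}. norm (f j s) \<le> K) \<and>
      (\<forall>s\<in>{0..1}. \<forall>u\<in>{0..1}. norm (f j s - f j u) \<le> \<omega> \<bar>s - u\<bar>)}"
    have "equicts (2 * n) S"
      unfolding S_def by (rule equicts_modulus_class[OF 5])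
    from uniform_rate[OF this assms(1), where 'a = 'a] show ?case
      unfolding S_def mem_Collect_eq .
  qed (use unif tendsto_uniform_limitI[OF unif(1)] tendsto_uniform_limitI[OF unif(2)] in blast)+
qed

end
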